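(* Let $w(t)$ be the renormalized variance of the fractional Ornstein–Uhlenbeck process $\xi$ described in the context, i.e. $\sigma^2 w(t)=\mathrm{Var}(\xi_t)$, that is, $$w(t)=\frac{1}{\varepsilon^{2H}}\int_0^t\int_0^t e^{\alpha(t,u)/\varepsilon}e^{\alpha(t,v)/\varepsilon}F(u)F(v)\,H(2H-1)|u-v|^{2H-2}\,du\,dv .$$ Then $w$ satisfies the fast-slow ODE $$\varepsilon\frac{d}{dt}w(t)=2a(t)w(t)+2F(t)H(2H-1)\int_0^t\frac{1}{\varepsilon^{2H-1}}e^{\alpha(t,u)/\varepsilon}F(u)(t-u)^{2H-2}\,du .$$ In particular, there is a (globally) asymptotically stable slow manifold of this ODE, i.e. a solution $\zeta=\zeta_\varepsilon$ of the ODE attracting all other solutions, of the form $$\zeta(t)=\frac{F(t)^2}{|a(t)|^{2H}}\,H\,\Gamma(2H)+\mathcal O(\varepsilon).$$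
   Context: Fix $H\in(1/2,1)$, $\sigma>0$ and a small parameter $\varepsilon>0$. $(W^H_t)_{t\ge0}$ is a one-dimensional fractional Brownian motion of Hurst index $H$: a continuous centered Gaussian process with $\mathbb E[W^H_tW^H_s]=\frac12(t^{2H}+s^{2H}-|t-s|^{2H})$. For deterministic $g_1,g_2\in L^p(0,T)$, $p>1/H$, the Wiener integrals $\int_0^{s}g_1\,dW^H$, $\int_0^{t}g_2\,dW^H$ are jointly centered Gaussian with covariance $\int_0^s\int_0^t g_1(u)g_2(v)H(2H-1)|u-v|^{2H-2}\,dv\,du$. Standing assumptions (stable case): (1) $f\in C^2(\mathbb R\times[0,\infty)^2;\mathbb R)$ (arguments $(x,t,\varepsilon)$) and $F\in C^1([0,\infty);(0,\infty))$, as well as all their existing derivatives up to order two, are uniformly bounded by a constant $M>0$ on an interval $I=[0,\infty)$ or $I=[0,T]$, $T>0$, of times $t$. (2) There is $x^*:[0,\infty)\to\mathbb R$ with $f(x^*(t),t,0)=0$ for all $t\ge0$. (3) For $a(t):=\partial_xf(x^*(t),t,0)$ there is $a>0$ with $a(t)\le -a$ for all $t\ge0$. Write $\alpha(t,u):=\int_u^t a(r)\,dr$. The process $\xi$ is the solution with $\xi_0=0$ of $d\xi_t=\frac1\varepsilon a(t)\xi_t\,dt+\frac{\sigma}{\varepsilon^H}F(t)\,dW^H_t$, i.e. $\xi_t=\frac{\sigma}{\varepsilon^H}\int_0^t e^{\alpha(t,u)/\varepsilon}F(u)\,dW^H_u$. $\mathcal O(\varepsilon)$ denotes a quantity bounded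 in absolute value by $C\varepsilon$ for all sufficiently small $\varepsilon>0$, with $C$ independent of $\varepsilon$. $\Gamma$ is Euler's Gamma function.
   Formalization: The branch x* is additionally assumed continuous (if it jumps, a(t) can jump and w fails the ODE there); O(ε) has C uniform in t, but how small ε must be is uniform only for t ≥ δ, any δ > 0 (and t = 0), since each solution has an O(1) initial layer near t = 0. *)

theory Defs
  imports "HOL-Probability.Probability"
begin

text \<open>Derivatives are taken within the set, i.e. one-sided at boundary points.\<close>

definition has_C1_derivative_on ::
  "('a::real_normed_vector \<Rightarrow> 'b::real_normed_vector) \<Rightarrow> ('a \<Rightarrow> 'a \<Rightarrow>\<^sub>L 'b) \<Rightarrow> 'a set \<Rightarrow> bool" where
  "has_C1_derivative_on f f' S \<longleftrightarrow>
     (\<forall>p\<in>S. (f has_derivative blinfun_apply (f' p)) (at p within S)) \<and> continuous_on S f'"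

definition centered_gaussian :: "'a measure \<Rightarrow> ('a \<Rightarrow> real) \<Rightarrow> bool" where
  "centered_gaussian \<Omega> X \<longleftrightarrow> X \<in> borel_measurable \<Omega> \<and>
     ((\<exists>s>0. distributed \<Omega> lborel X (normal_density 0 s)) \<or> (AE \<omega> in \<Omega>. X \<omega> = 0))"

definition fractional_brownian_motion ::
  "'a measure \<Rightarrow> real \<Rightarrow> (real \<Rightarrow> 'a \<Rightarrow> real) \<Rightarrow> bool" where
  "fractional_brownian_motion \<Omega> H W \<longleftrightarrow>
     prob_space \<Omega> \<and>
     (\<forall>t\<ge>0. W t \<in> borel_measurable \<Omega>) \<and>
     (\<forall>\<omega>\<in>space \<Omega>. continuous_on {0..} (\<lambda>t. W t \<omega>)) \<and>
     (\<forall>A c. finite A \<and> A \<subseteq> {0..} \<longrightarrow> centered_gaussian \<Omega> (\<lambda>\<omega>. \<Sum>t\<in>A. c t * W t \<omega>)) \<and>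
     (\<forall>s\<ge>0. \<forall>t\<ge>0. (LINT \<omega>|\<Omega>. W t \<omega> * W s \<omega>) =
        (t powr (2 * H) + s powr (2 * H) - \<bar>t - s\<bar> powr (2 * H)) / 2)"

text \<open>A list of triples \<open>(l, r, c)\<close> encodes the step function that is the sum of the
  functions \<open>c\<close> times the indicator of the interval from \<open>l\<close> (excluded) to \<open>r\<close> (included).\<close>

definition steps_in :: "real \<Rightarrow> (real \<times> real \<times> real) list \<Rightarrow> bool" where
  "steps_in t S \<longleftrightarrow> (\<forall>(l, r, c)\<in>set S. 0 \<le> l \<and> l \<le> r \<and> r \<le> t)"

definition step_fun :: "(real \<times> real \<times> real) list \<Rightarrow> real \<Rightarrow> real" where
  "step_fun S u = (\<Sum>(l, r, c)\<leftarrow>S. c * indicator {l<..r} u)"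

definition step_integral ::
  "(real \<Rightarrow> 'a \<Rightarrow> real) \<Rightarrow> (real \<times> real \<times> real) list \<Rightarrow> 'a \<Rightarrow> real" where
  "step_integral W S \<omega> = (\<Sum>(l, r, c)\<leftarrow>S. c * (W r \<omega> - W l \<omega>))"

text \<open>The Wiener integral of a deterministic \<open>g\<close> in $L^p(0,t)$, $p > 1/H$, with respect to a
  fractional Brownian motion of Hurst index \<open>H\<close>: the mean-square limit of the elementary
  integrals of step functions converging to \<open>g\<close> in $L^p(0,t)$. It is determined up to null
  sets, hence a predicate on the random variable \<open>X\<close>.\<close>

definition has_wiener_integral ::
  "'a measure \<Rightarrow> real \<Rightarrow> (real \<Rightarrow> 'a \<Rightarrow> real) \<Rightarrow> (real \<Rightarrow> real) \<Rightarrow> real \<Rightarrow> ('a \<Rightarrow> real) \<Rightarrow> bool" where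
  "has_wiener_integral \<Omega> H W g t X \<longleftrightarrow>
     X \<in> borel_measurable \<Omega> \<and> integrable \<Omega> (\<lambda>\<omega>. (X \<omega>)\<^sup>2) \<and>
     set_borel_measurable lborel {0..t} g \<and>
     (\<exists>p>1 / H. set_integrable lborel {0..t} (\<lambda>u. \<bar>g u\<bar> powr p) \<and>
       (\<exists>S. (\<forall>n. steps_in t (S n)) \<and>
         (\<lambda>n. LINT u:{0..t}|lborel. \<bar>step_fun (S n) u - g u\<bar> powr p) \<longlonglongrightarrow> 0 \<and>
         (\<lambda>n. LINT \<omega>|\<Omega>. (step_integral W (S n) \<omega> - X \<omega>)\<^sup>2) \<longlonglongrightarrow> 0))"

definition alpha :: "(real \<Rightarrow> real) \<Rightarrow> real \<Rightarrow> real \<Rightarrow> real" where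
  "alpha a t u = (LBINT r=u..t. a r)"

text \<open>\<open>fractional_OU\<close>: the mild (variation of constants) form of
  $d\xi_t = \frac1\varepsilon a(t)\xi_t\,dt + \frac{\sigma}{\varepsilon^H}F(t)\,dW^H_t$, $\xi_0 = 0$.\<close>

definition fractional_OU ::
  "'a measure \<Rightarrow> real \<Rightarrow> (real \<Rightarrow> 'a \<Rightarrow> real) \<Rightarrow> (real \<Rightarrow> real) \<Rightarrow> (real \<Rightarrow> real) \<Rightarrow> real \<Rightarrow> real
    \<Rightarrow> (real \<Rightarrow> 'a \<Rightarrow> real) \<Rightarrow> bool" where
  "fractional_OU \<Omega> H W a F \<sigma> \<epsilon> \<xi> \<longleftrightarrow>
     (\<forall>t\<ge>0. \<exists>J. has_wiener_integral \<Omega> H W (\<lambda>u. exp (alpha a t u / \<epsilon>) * F u) t J \<and>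
        (\<forall>\<omega>\<in>space \<Omega>. \<xi> t \<omega> = \<sigma> / \<epsilon> powr H * J \<omega>))"

definition renorm_variance ::
  "real \<Rightarrow> (real \<Rightarrow> real) \<Rightarrow> (real \<Rightarrow> real) \<Rightarrow> real \<Rightarrow> real \<Rightarrow> real" where
  "renorm_variance H a F \<epsilon> t =
     1 / \<epsilon> powr (2 * H) *
     (LINT v:{0..t}|lborel. LINT u:{0..t}|lborel.
        exp (alpha a t u / \<epsilon>) * exp (alpha a t v / \<epsilon>) * F u * F v
        * (H * (2 * H - 1)) * \<bar>u - v\<bar> powr (2 * H - 2))"

definition solves_variance_ode ::
  "real \<Rightarrow> (real \<Rightarrow> real) \<Rightarrow> (real \<Rightarrow> real) \<Rightarrow> real \<Rightarrow> real \<Rightarrow> (real \<Rightarrow> real) \<Rightarrow> bool" where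
  "solves_variance_ode H a F \<epsilon> t0 z \<longleftrightarrow>
     (\<forall>t\<ge>t0. \<exists>z'. (z has_real_derivative z') (at t within {t0..}) \<and>
        \<epsilon> * z' = 2 * a t * z t + 2 * F t * (H * (2 * H - 1)) *
          (LINT u:{0..t}|lborel.
             1 / \<epsilon> powr (2 * H - 1) * exp (alpha a t u / \<epsilon>) * F u * (t - u) powr (2 * H - 2)))"

text \<open>\<open>sol t0 z\<close> is meant to say that \<open>z\<close> solves a (non-autonomous) scalar ODE from
  time \<open>t0\<close> on.\<close>

definition globally_asymptotically_stable ::
  "(real \<Rightarrow> (real \<Rightarrow> real) \<Rightarrow> bool) \<Rightarrow> (real \<Rightarrow> real) \<Rightarrow> bool" where
  "globally_asymptotically_stable sol \<zeta> \<longleftrightarrow>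
     (\<forall>\<eta>>0. \<exists>\<delta>>0. \<forall>t0\<ge>0. \<forall>z. sol t0 z \<and> \<bar>z t0 - \<zeta> t0\<bar> < \<delta> \<longrightarrow> (\<forall>t\<ge>t0. \<bar>z t - \<zeta> t\<bar> < \<eta>)) \<and>
     (\<forall>t0\<ge>0. \<forall>z. sol t0 z \<longrightarrow> ((\<lambda>t. z t - \<zeta> t) \<longlongrightarrow> 0) at_top)"

text \<open>\<open>h \<epsilon> t = O(\<epsilon>)\<close> for every time \<open>t\<close> in \<open>I\<close>, with a constant depending neither on
  \<open>\<epsilon>\<close> nor on \<open>t\<close>; how small \<open>\<epsilon>\<close> has to be is uniform in \<open>t\<close> away from the initial time.
  Full uniformity down to \<open>t = 0\<close> cannot be asked for: the integral in the ODE vanishes at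
  \<open>t = 0\<close> and takes times large compared to \<open>\<epsilon>\<close> to reach its asymptotic value, so
  that every solution has an initial layer in which it differs from the leading term by order one.\<close>

definition order_eps_on :: "real set \<Rightarrow> (real \<Rightarrow> real \<Rightarrow> real) \<Rightarrow> bool" where
  "order_eps_on I h \<longleftrightarrow>
     (\<exists>C>0. \<forall>\<delta>>0. \<exists>\<epsilon>0>0. \<forall>\<epsilon>. 0 < \<epsilon> \<and> \<epsilon> < \<epsilon>0 \<longrightarrow>
        (\<forall>t\<in>I. t = 0 \<or> \<delta> \<le> t \<longrightarrow> \<bar>h \<epsilon> t\<bar> \<le> C * \<epsilon>))"

end

theory Submission
  imports Defs
begin

text \<open>The double integral of \<open>f u * g v * \<bar>u - v\<bar> powr (2 * H - 2)\<close> is continuous in $L^p$ for every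
  $p > 1/H$ and agrees with the covariance of fractional Brownian motion on step functions, hence it
  gives the second moment of Wiener integrals. Since \<open>exp (alpha a t u / \<epsilon>)\<close> factorises
  into a function of \<open>t\<close> and one of \<open>u\<close>, splitting the square along its diagonal exhibits the
  variance as a product of differentiable functions, and differentiation gives the equation. Two
  solutions differ by a solution of the homogeneous equation, which decays like
  \<open>exp (- 2 * a0 * t / \<epsilon>)\<close>. Substituting \<open>u = t - \<epsilon> * s\<close> turns the forcing
  term into a Gamma integral up to \<open>O(\<epsilon> + \<epsilon>\<^sup>2 / t\<^sup>2)\<close>; the solution \<open>\<zeta>\<close> that starts at
  the leading term stays within distance \<open>O(1)\<close> of it, and restarting the estimate at time
  \<open>t / 2\<close> improves this to \<open>O(\<epsilon>)\<close>.\<close>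

section \<open>The kernel \<open>\<bar>u - v\<bar> powr b\<close>\<close>

text \<open>At the critical exponent \<open>1 / H\<close> Young's inequality fails and the
  Hardy-Littlewood-Sobolev inequality would be needed. The strict bound \<open>p > 1 / H\<close>
  avoids this: for an exponent \<open>q\<close> between \<open>1 / H\<close> and 2 the power of the
  kernel that Young's inequality asks for is still integrable.

  The variance itself cannot serve as \<open>\<zeta>\<close>: it vanishes at time 0, where
  \<open>order_eps_on\<close> already demands closeness to the leading term. Adding a homogeneous
  solution corrects the initial value.

  The constant in \<open>order_eps_on\<close> is fixed before \<open>\<delta>\<close>, so no power
  of \<open>1 / \<delta>\<close> may enter it; the smallness of \<open>\<epsilon>0\<close> has to
  absorb them all.

  An error of order \<open>\<epsilon>\<close> requires \<open>a\<close> to be Lipschitz, while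
  \<open>xs\<close> is only assumed continuous. Differentiating the identity
  \<open>f (xs t, t, 0) = 0\<close> yields the derivative of \<open>xs\<close>, hence that of
  \<open>a\<close>, with a bound at the times where the derivatives of \<open>f\<close> are
  bounded.\<close>

lemma has_integral_nonneg_lborel:
  fixes f :: "real \<Rightarrow> real"
  assumes I: "(f has_integral I) A" and nonneg: "\<And>x. x \<in> A \<Longrightarrow> 0 \<le> f x"
    and [measurable]: "f \<in> borel_measurable borel" "A \<in> sets borel"
  shows "set_integrable lborel A f" "(LINT x:A|lborel. f x) = I"
proof -
  have m: "(\<lambda>x. indicator A x *\<^sub>R f x) \<in> borel_measurable lborel"
    by measurable
  \<comment> \<open>For a nonnegative function gauge integrability implies absolute integrability.
    This carries the fundamental theorem of calculus with exceptional points over to Lebesgue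
    integrals of a singular kernel.\<close>
  have "f absolutely_integrable_on A"
    using I nonneg nonnegative_absolutely_integrable_1 has_integral_integrable by blast
  then have i: "set_integrable lebesgue A f" .
  then show s: "set_integrable lborel A f"
    using integrable_completion[OF m] unfolding set_integrable_def by simp
  have "(LINT x:A|lebesgue. f x) = integral A f"
    using set_lebesgue_integral_eq_integral(2)[OF i] .
  moreover have "(LINT x:A|lebesgue. f x) = (LINT x:A|lborel. f x)"
    unfolding set_lebesgue_integral_def by (rule integral_completion[OF m])
  ultimately show "(LINT x:A|lborel. f x) = I"
    using I by (simp add: integral_unique)
qed

text \<open>This is \<open>sgn x * \<bar>x\<bar> powr (b + 1) / (b + 1)\<close>, written without \<open>sgn\<close> so that continuity
  at \<open>0\<close> is immediate.\<close>

definition abs_powr_prim :: "real \<Rightarrow> real \<Rightarrow> real" where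
  "abs_powr_prim b x = (max x 0 powr (b + 1) - max (- x) 0 powr (b + 1)) / (b + 1)"

lemma continuous_on_abs_powr_prim [continuous_intros]:
  assumes "b > -1" "continuous_on S f"
  shows "continuous_on S (\<lambda>x. abs_powr_prim b (f x))"
  unfolding abs_powr_prim_def using assms
  by (intro continuous_intros continuous_on_powr' ballI impI conjI) auto

lemma powr_prim_has_derivative:
  fixes x c :: real
  assumes "c \<noteq> 0"
  shows "x > 0 \<Longrightarrow> ((\<lambda>x. x powr c / c) has_real_derivative x powr (c - 1)) (at x)"
    and "x < 0 \<Longrightarrow> ((\<lambda>x. (- x) powr c / c) has_real_derivative - ((- x) powr (c - 1))) (at x)"
proof -
  have *: "((\<lambda>x. x powr c / c) has_real_derivative x powr (c - 1)) (at x)" if "x > 0" for x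
    using DERIV_cdivide[OF has_real_derivative_powr[OF that, of c], of c] assms by simp
  then show "x > 0 \<Longrightarrow> ((\<lambda>x. x powr c / c) has_real_derivative x powr (c - 1)) (at x)" .
  assume "x < 0"
  then show "((\<lambda>x. (- x) powr c / c) has_real_derivative - ((- x) powr (c - 1))) (at x)"
    using DERIV_chain2[OF *[of "- x"] DERIV_minus[OF DERIV_ident]] by simp
qed

lemma abs_powr_prim_has_derivative:
  assumes b: "b > -1" "x \<noteq> 0"
  shows "(abs_powr_prim b has_real_derivative \<bar>x\<bar> powr b) (at x)"
proof (cases "x > 0")
  case True
  have "((\<lambda>x. x powr (b + 1) / (b + 1)) has_real_derivative \<bar>x\<bar> powr b) (at x)"
    using True b powr_prim_has_derivative(1)[of "b + 1" x] by simp
  moreover have "\<And>y. y \<in> {0<..} \<Longrightarrow> y powr (b + 1) / (b + 1) = abs_powr_prim b y"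
    by (auto simp: abs_powr_prim_def max_def)
  ultimately show ?thesis
    using True has_field_derivative_transform_within_open[of "\<lambda>x. x powr (b + 1) / (b + 1)" _ x "{0<..}"]
    by simp
next
  case False
  then have x: "x < 0" using assms by simp
  have "((\<lambda>x. - ((- x) powr (b + 1)) / (b + 1)) has_real_derivative \<bar>x\<bar> powr b) (at x)"
    using x b DERIV_minus[OF powr_prim_has_derivative(2)[of "b + 1" x]] by simp
  moreover have "\<And>y. y \<in> {..<0} \<Longrightarrow> - ((- y) powr (b + 1)) / (b + 1) = abs_powr_prim b y"
    by (auto simp: abs_powr_prim_def max_def)
  ultimately show ?thesis
    using x has_field_derivative_transform_within_open[of "\<lambda>x. - ((- x) powr (b + 1)) / (b + 1)" _ x "{..<0}"]
    by simp
qed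

text \<open>For \<open>b = 2 * H - 2\<close> the second primitive of the kernel is a multiple of
  \<open>\<bar>x\<bar> powr (2 * H)\<close>; this is how the covariance of fractional Brownian
  motion comes out of the kernel.\<close>

lemma abs_powr_prim_has_integral:
  assumes b: "b > -1" and "l \<le> r"
  shows "(abs_powr_prim b has_integral
    \<bar>r\<bar> powr (b + 2) / ((b + 1) * (b + 2)) - \<bar>l\<bar> powr (b + 2) / ((b + 1) * (b + 2))) {l..r}"
proof (rule fundamental_theorem_of_calculus_interior_strong[where S="{0}"])
  show "continuous_on {l..r} (\<lambda>x. \<bar>x\<bar> powr (b + 2) / ((b + 1) * (b + 2)))"
    using b by (intro continuous_intros continuous_on_powr' ballI impI conjI) auto
  fix x assume "x \<in> {l<..<r} - {0}"
  then have x0: "x \<noteq> 0" by simp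
  have nz: "b + 1 \<noteq> 0" "b + 2 \<noteq> 0" using b by auto
  have "((\<lambda>x. \<bar>x\<bar> powr (b + 2) / ((b + 1) * (b + 2))) has_real_derivative abs_powr_prim b x) (at x)"
  proof (cases "x > 0")
    case True
    have "((\<lambda>x. x powr (b + 2) / ((b + 1) * (b + 2))) has_real_derivative abs_powr_prim b x) (at x)"
      using True nz DERIV_cdivide[OF powr_prim_has_derivative(1)[of "b + 2" x], of "b + 1"]
      by (simp add: abs_powr_prim_def max_def mult.commute add.commute)
    then show ?thesis
      using True by (rule_tac has_field_derivative_transform_within_open[of _ _ x "{0<..}"]) auto
  next
    case False
    then have x: "x < 0" using x0 by simp
    have "((\<lambda>x. (- x) powr (b + 2) / ((b + 1) * (b + 2))) has_real_derivative abs_powr_prim b x) (at x)"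
      using x nz DERIV_cdivide[OF powr_prim_has_derivative(2)[of "b + 2" x], of "b + 1"]
      by (simp add: abs_powr_prim_def max_def mult.commute add.commute)
    then show ?thesis
      using x by (rule_tac has_field_derivative_transform_within_open[of _ _ x "{..<0}"]) auto
  qed
  then show "((\<lambda>x. \<bar>x\<bar> powr (b + 2) / ((b + 1) * (b + 2))) has_vector_derivative abs_powr_prim b x) (at x)"
    by (simp add: has_real_derivative_iff_has_vector_derivative)
qed (use assms in auto)

text \<open>Because \<open>b > -1\<close>, the primitive is continuous across \<open>v = u\<close>,
  so the fundamental theorem applies with the singularity as its only exceptional point.\<close>

lemma abs_powr_integral:
  assumes b: "b > -1" and lr: "l \<le> r"
  shows "set_integrable lborel {l..r} (\<lambda>v. \<bar>v - u\<bar> powr b)"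
    and "(LINT v:{l..r}|lborel. \<bar>v - u\<bar> powr b) = abs_powr_prim b (r - u) - abs_powr_prim b (l - u)"
proof -
  have *: "((\<lambda>v. \<bar>v - u\<bar> powr b) has_integral abs_powr_prim b (r - u) - abs_powr_prim b (l - u)) {l..r}"
  proof (rule fundamental_theorem_of_calculus_interior_strong[where S="{u}"])
    show "continuous_on {l..r} (\<lambda>v. abs_powr_prim b (v - u))"
      using b by (intro continuous_intros)
    fix v assume v: "v \<in> {l<..<r} - {u}"
    have "((\<lambda>v. abs_powr_prim b (v - u)) has_real_derivative \<bar>v - u\<bar> powr b) (at v)"
      by (rule DERIV_chain2[OF abs_powr_prim_has_derivative, THEN DERIV_cong])
        (use v b in \<open>auto intro!: derivative_eq_intros\<close>)
    then show "((\<lambda>v. abs_powr_prim b (v - u)) has_vector_derivative \<bar>v - u\<bar> powr b) (at v)"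
      by (simp add: has_real_derivative_iff_has_vector_derivative)
  qed (use lr in auto)
  show "set_integrable lborel {l..r} (\<lambda>v. \<bar>v - u\<bar> powr b)"
    "(LINT v:{l..r}|lborel. \<bar>v - u\<bar> powr b) = abs_powr_prim b (r - u) - abs_powr_prim b (l - u)"
    by (rule has_integral_nonneg_lborel[OF *]; simp)+
qed

text \<open>Integrating twice leaves a mixed second difference of the second primitive, the shape of
  the covariance of two increments.\<close>

lemma abs_powr_double_integral:
  fixes b l r l' r' :: real
  assumes b: "b > -1" and "l \<le> r" "l' \<le> r'"
  shows "(LINT u:{l'..r'}|lborel. LINT v:{l..r}|lborel. \<bar>v - u\<bar> powr b) =
    (\<bar>r - l'\<bar> powr (b + 2) + \<bar>l - r'\<bar> powr (b + 2) - \<bar>r - r'\<bar> powr (b + 2) - \<bar>l - l'\<bar> powr (b + 2))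
      / ((b + 1) * (b + 2))"
proof -
  let ?q = "\<lambda>x. \<bar>x\<bar> powr (b + 2) / ((b + 1) * (b + 2))"
  have P: "((\<lambda>u. abs_powr_prim b (c - u)) has_integral ?q (c - l') - ?q (c - r')) {l'..r'}" for c
  proof -
    have "((\<lambda>u. abs_powr_prim b (-u + c)) has_integral ?q (c - l') - ?q (c - r')) {l'..r'}"
      using abs_powr_prim_has_integral[OF b, of "c - r'" "c - l'"] assms(3)
        has_integral_affinity[of "abs_powr_prim b" _ "c - r'" "c - l'" "-1" c]
      by simp
    then show ?thesis by (simp add: add.commute)
  qed
  let ?g = "\<lambda>u. abs_powr_prim b (r - u) - abs_powr_prim b (l - u)"
  have "continuous_on {l'..r'} ?g"
    using b by (intro continuous_intros)
  then have "set_integrable lborel {l'..r'} ?g"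
    by (rule borel_integrable_atLeastAtMost')
  then have "(LINT u:{l'..r'}|lborel. ?g u) = integral {l'..r'} ?g"
    by (rule set_borel_integral_eq_integral(2))
  also have "\<dots> = (?q (r - l') - ?q (r - r')) - (?q (l - l') - ?q (l - r'))"
    by (intro integral_unique has_integral_diff P)
  finally show ?thesis
    using abs_powr_integral(2)[OF b assms(2)] by (simp add: diff_divide_distrib add_divide_distrib)
qed

section \<open>Energy integrals on \<open>{0..t}\<close>\<close>

text \<open>A pointwise form of Young's convolution inequality: the left-hand side is a weighted geometric
  mean of the three summands on the right.\<close>

lemma mult3_le_sum_powr:
  fixes x y k q :: real
  assumes "0 \<le> x" "0 \<le> y" "0 \<le> k" "1 < q" "q < 2"
  defines "r \<equiv> q / (2 * q - 2)"
  shows "x * y * k \<le> x powr q * y powr q + x powr q * k powr r + y powr q * k powr r"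
proof (cases "x = 0 \<or> y = 0 \<or> k = 0")
  case True
  then have "x * y * k = 0" by auto
  then show ?thesis by (simp only:) simp
next
  case False
  then have pos: "x > 0" "y > 0" "k > 0" using assms by auto
  define X Y Z where "X = x powr q * y powr q" and "Y = x powr q * k powr r" and "Z = y powr q * k powr r"
  define m where "m = Max {X, Y, Z}"
  have XYZ: "X > 0" "Y > 0" "Z > 0" using pos by (auto simp: X_def Y_def Z_def)
  have m: "X \<le> m" "Y \<le> m" "Z \<le> m" by (auto simp: m_def)
  \<comment> \<open>The weights are forced: \<open>x\<close> and \<open>y\<close> must get exponent
    \<open>q * (\<alpha> + \<beta>) = 1\<close> and \<open>k\<close> must get
    \<open>2 * r * \<beta> = 1\<close>. The choice of \<open>r\<close> makes them add up to
    \<open>\<alpha> + 2 * \<beta> = 1\<close>, and \<open>1 < q < 2\<close> makes them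
    nonnegative.\<close>
  define \<alpha> \<beta> where "\<alpha> = 2 / q - 1" and "\<beta> = 1 - 1 / q"
  have ab: "0 \<le> \<alpha>" "0 \<le> \<beta>" "\<alpha> + \<beta> + \<beta> = 1"
    using assms(4,5) by (auto simp: \<alpha>_def \<beta>_def field_simps)
  have e: "q * \<alpha> + q * \<beta> = 1" "r * \<beta> + r * \<beta> = 1"
  proof -
    show "q * \<alpha> + q * \<beta> = 1" using assms(4) by (simp add: \<alpha>_def \<beta>_def algebra_simps)
    show "r * \<beta> + r * \<beta> = 1" using assms(4) by (simp add: r_def \<beta>_def divide_simps)
  qed
  have "X powr \<alpha> * Y powr \<beta> * Z powr \<beta> =
    (x powr (q * \<alpha>) * x powr (q * \<beta>)) * (y powr (q * \<alpha>) * y powr (q * \<beta>)) * (k powr (r * \<beta>) * k powr (r * \<beta>))"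
    using pos by (simp add: X_def Y_def Z_def powr_mult powr_powr)
  also have "\<dots> = x * y * k"
    using pos e by (simp add: powr_add [symmetric])
  finally have "x * y * k = X powr \<alpha> * Y powr \<beta> * Z powr \<beta>" ..
  also have "\<dots> \<le> m powr \<alpha> * m powr \<beta> * m powr \<beta>"
    using XYZ m ab by (intro mult_mono powr_mono2) auto
  also have "\<dots> = m"
    using XYZ m ab by (simp add: powr_add [symmetric])
  also have "m \<le> X + Y + Z"
    using XYZ by (auto simp: m_def)
  finally show ?thesis by (simp add: X_def Y_def Z_def)
qed

section \<open>Lebesgue measure on \<open>{0..t}\<close> and the energy form\<close>

abbreviation lborel_upto :: "real \<Rightarrow> real measure" where
  "lborel_upto t \<equiv> restrict_space lborel {0..t}"

text \<open>Restricting the measure instead of carrying indicators pays off here: bounded measurable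
  functions become integrable, and Fubini's theorem is available on the square.\<close>

lemma finite_measure_lborel_upto: "finite_measure (lborel_upto t)"
  by (rule finite_measureI, cases "0 \<le> t")
    (simp_all add: emeasure_restrict_space space_restrict_space)

interpretation upto: finite_measure "lborel_upto t" for t
  by (rule finite_measure_lborel_upto)

interpretation upto: pair_sigma_finite "lborel_upto t" "lborel_upto t" for t ..

lemma set_integral_eq_upto:
  fixes f :: "real \<Rightarrow> real"
  shows "(LINT u:{0..t}|lborel. f u) = (\<integral>u. f u \<partial>lborel_upto t)"
  by (simp add: set_lebesgue_integral_def integral_restrict_space)

lemma set_integrable_iff_upto:
  fixes f :: "real \<Rightarrow> real"
  shows "set_integrable lborel {0..t} f \<longleftrightarrow> integrable (lborel_upto t) f"
  by (simp add: set_integrable_def integrable_restrict_space)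

lemma measurable_upto_borel: "(\<lambda>x. x) \<in> borel_measurable (lborel_upto t)"
  by (rule measurable_restrict_space1) simp

lemma integrable_upto_bounded:
  fixes f :: "real \<Rightarrow> real"
  assumes "f \<in> borel_measurable (lborel_upto t)" "\<And>u. u \<in> {0..t} \<Longrightarrow> \<bar>f u\<bar> \<le> C"
  shows "integrable (lborel_upto t) f"
  using assms by (intro upto.integrable_const_bound[where B=C] AE_I2) (auto simp: space_restrict_space)

lemma kernel_integrable:
  assumes "b > -1" "t \<ge> 0"
  shows "integrable (lborel_upto t) (\<lambda>v. \<bar>v - u\<bar> powr b)"
    and "integrable (lborel_upto t) (\<lambda>v. \<bar>u - v\<bar> powr b)"
  using abs_powr_integral(1)[OF assms(1,2), of u] 
  by (auto simp: set_integrable_iff_upto abs_minus_commute)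

text \<open>Each side of \<open>u\<close> contributes at most
  \<open>t powr (b + 1) / (b + 1)\<close>. The bound is uniform in \<open>u\<close>, so the outer
  variable can be integrated afterwards.\<close>

lemma kernel_integral_le:
  assumes "b > -1" "u \<in> {0..t}"
  shows "(\<integral>v. \<bar>v - u\<bar> powr b \<partial>lborel_upto t) \<le> 2 * t powr (b + 1) / (b + 1)"
proof -
  have "(\<integral>v. \<bar>v - u\<bar> powr b \<partial>lborel_upto t) = abs_powr_prim b (t - u) - abs_powr_prim b (0 - u)"
    using abs_powr_integral(2)[of b 0 t u] assms by (simp add: set_integral_eq_upto)
  also have "\<dots> = ((t - u) powr (b + 1) + u powr (b + 1)) / (b + 1)"
    using assms by (auto simp: abs_powr_prim_def max_def add_divide_distrib)
  also have "\<dots> \<le> (t powr (b + 1) + t powr (b + 1)) / (b + 1)"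
    using assms by (intro divide_right_mono add_mono powr_mono2) auto
  finally show ?thesis by simp
qed

lemma kernel_integral_le':
  assumes "b > -1" "u \<in> {0..t}"
  shows "(\<integral>v. \<bar>u - v\<bar> powr b \<partial>lborel_upto t) \<le> 2 * t powr (b + 1) / (b + 1)"
  using kernel_integral_le[OF assms] by (simp add: abs_minus_commute)

lemma kernel_integrable_pair:
  assumes "b > -1" "t \<ge> 0"
  shows "integrable (lborel_upto t \<Otimes>\<^sub>M lborel_upto t) (\<lambda>z. \<bar>fst z - snd z\<bar> powr b)"
proof (rule upto.Fubini_integrable)
  note [measurable] = measurable_upto_borel
  show [measurable]: "(\<lambda>z. \<bar>fst z - snd z\<bar> powr b) \<in> borel_measurable (lborel_upto t \<Otimes>\<^sub>M lborel_upto t)"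
    by measurable
  show "integrable (lborel_upto t) (\<lambda>x. \<integral>y. norm (\<bar>fst (x, y) - snd (x, y)\<bar> powr b) \<partial>lborel_upto t)"
  proof (rule integrable_upto_bounded)
    show "(\<lambda>x. \<integral>y. norm (\<bar>fst (x, y) - snd (x, y)\<bar> powr b) \<partial>lborel_upto t) \<in> borel_measurable (lborel_upto t)"
      by measurable
    fix u assume "u \<in> {0..t}"
    then show "\<bar>\<integral>y. norm (\<bar>fst (u, y) - snd (u, y)\<bar> powr b) \<partial>lborel_upto t\<bar> \<le> 2 * t powr (b + 1) / (b + 1)"
      using kernel_integral_le'[OF assms(1)] by simp
  qed
  show "AE x in lborel_upto t. integrable (lborel_upto t) (\<lambda>y. \<bar>fst (x, y) - snd (x, y)\<bar> powr b)"
    using kernel_integrable(2)[OF assms] by simp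
qed

lemma energy_integrable:
  fixes f g :: "real \<Rightarrow> real"
  assumes "b > -1" "t \<ge> 0"
    and [measurable]: "f \<in> borel_measurable (lborel_upto t)" "g \<in> borel_measurable (lborel_upto t)"
    and f: "\<And>u. u \<in> {0..t} \<Longrightarrow> \<bar>f u\<bar> \<le> C" and g: "\<And>u. u \<in> {0..t} \<Longrightarrow> \<bar>g u\<bar> \<le> D"
  shows "integrable (lborel_upto t \<Otimes>\<^sub>M lborel_upto t) (\<lambda>z. f (fst z) * g (snd z) * \<bar>fst z - snd z\<bar> powr b)"
proof (rule Bochner_Integration.integrable_bound[OF integrable_mult_right[OF kernel_integrable_pair[OF assms(1,2)]]])
  note [measurable] = measurable_upto_borel
  show "(\<lambda>z. f (fst z) * g (snd z) * \<bar>fst z - snd z\<bar> powr b) \<in> borel_measurable (lborel_upto t \<Otimes>\<^sub>M lborel_upto t)"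
    by measurable
  show "AE z in lborel_upto t \<Otimes>\<^sub>M lborel_upto t.
      norm (f (fst z) * g (snd z) * \<bar>fst z - snd z\<bar> powr b) \<le> norm (C * D * \<bar>fst z - snd z\<bar> powr b)"
  proof (rule AE_I2)
    fix z assume "z \<in> space (lborel_upto t \<Otimes>\<^sub>M lborel_upto t)"
    then have z: "fst z \<in> {0..t}" "snd z \<in> {0..t}"
      by (auto simp: space_pair_measure space_restrict_space)
    have "\<bar>f (fst z)\<bar> * \<bar>g (snd z)\<bar> \<le> C * D"
      using f[OF z(1)] g[OF z(2)] by (intro mult_mono) auto
    moreover have "0 \<le> C" "0 \<le> D" using f[OF z(1)] g[OF z(2)] by linarith+
    ultimately show "norm (f (fst z) * g (snd z) * \<bar>fst z - snd z\<bar> powr b) \<le> norm (C * D * \<bar>fst z - snd z\<bar> powr b)"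
      by (simp add: abs_mult mult_right_mono)
  qed
qed

text \<open>With \<open>b = 2 * H - 2\<close> and the factor \<open>H * (2 * H - 1)\<close> this is
  the covariance form of Wiener integrals. Integration over the product measure, rather than
  iterated integration, gives bilinearity and symmetry directly.\<close>

definition energy :: "real \<Rightarrow> real \<Rightarrow> (real \<Rightarrow> real) \<Rightarrow> (real \<Rightarrow> real) \<Rightarrow> real" where
  "energy b t f g = (\<integral>z. f (fst z) * g (snd z) * \<bar>fst z - snd z\<bar> powr b \<partial>(lborel_upto t \<Otimes>\<^sub>M lborel_upto t))"

text \<open>A class that contains step functions and functions continuous on \<open>{0..t}\<close>
  and is closed under the operations used below. For \<open>b > -1\<close> and
  \<open>t \<ge> 0\<close>, \<open>energy\<close> is bilinear on it without further integrability
  conditions.\<close>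

definition bounded_borel_upto :: "real \<Rightarrow> (real \<Rightarrow> real) \<Rightarrow> bool" where
  "bounded_borel_upto t f \<longleftrightarrow> f \<in> borel_measurable (lborel_upto t) \<and> (\<exists>C. \<forall>u\<in>{0..t}. \<bar>f u\<bar> \<le> C)"

lemma bounded_borel_uptoE:
  assumes "bounded_borel_upto t f"
  obtains C where "f \<in> borel_measurable (lborel_upto t)" "C \<ge> 0" "\<forall>u\<in>{0..t}. \<bar>f u\<bar> \<le> C"
proof -
  obtain C where C: "\<forall>u\<in>{0..t}. \<bar>f u\<bar> \<le> C" and m: "f \<in> borel_measurable (lborel_upto t)"
    using assms by (auto simp: bounded_borel_upto_def)
  show thesis
    by (rule that[of "max C 0"]) (use C m in \<open>auto simp: le_max_iff_disj\<close>)
qed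

lemma bounded_borel_upto_const: "bounded_borel_upto t (\<lambda>_. c)"
  by (auto simp: bounded_borel_upto_def)

lemma bounded_borel_upto_indicator: "bounded_borel_upto t (indicator {x<..y})"
  unfolding bounded_borel_upto_def
  by (intro conjI exI[of _ 1] measurable_restrict_space1) (auto simp: indicator_def)

lemma bounded_borel_upto_continuous:
  assumes "continuous_on {0..t} f"
  shows "bounded_borel_upto t f"
proof -
  have "compact (f ` {0..t})" using assms by (intro compact_continuous_image) auto
  then have "bounded (f ` {0..t})" by (rule compact_imp_bounded)
  then obtain C where "\<forall>u\<in>{0..t}. \<bar>f u\<bar> \<le> C" by (auto simp: bounded_iff)
  moreover have "f \<in> borel_measurable (lborel_upto t)"
    using borel_measurable_continuous_on_restrict[OF assms]
    by (simp add: borel_measurable_restrict_space_iff)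
  ultimately show ?thesis by (auto simp: bounded_borel_upto_def)
qed

lemma bounded_borel_upto_add:
  assumes "bounded_borel_upto t f" "bounded_borel_upto t g"
  shows "bounded_borel_upto t (\<lambda>u. f u + g u)"
proof -
  obtain C where C: "f \<in> borel_measurable (lborel_upto t)" "C \<ge> 0" "\<forall>u\<in>{0..t}. \<bar>f u\<bar> \<le> C"
    using assms(1) by (rule bounded_borel_uptoE)
  obtain D where D: "g \<in> borel_measurable (lborel_upto t)" "D \<ge> 0" "\<forall>u\<in>{0..t}. \<bar>g u\<bar> \<le> D"
    using assms(2) by (rule bounded_borel_uptoE)
  have "\<forall>u\<in>{0..t}. \<bar>f u + g u\<bar> \<le> C + D" using C(3) D(3) by (meson abs_triangle_ineq add_mono order_trans)
  then show ?thesis using C(1) D(1) by (auto simp: bounded_borel_upto_def)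
qed

lemma bounded_borel_upto_mult:
  assumes "bounded_borel_upto t f" "bounded_borel_upto t g"
  shows "bounded_borel_upto t (\<lambda>u. f u * g u)"
proof -
  obtain C where C: "f \<in> borel_measurable (lborel_upto t)" "C \<ge> 0" "\<forall>u\<in>{0..t}. \<bar>f u\<bar> \<le> C"
    using assms(1) by (rule bounded_borel_uptoE)
  obtain D where D: "g \<in> borel_measurable (lborel_upto t)" "D \<ge> 0" "\<forall>u\<in>{0..t}. \<bar>g u\<bar> \<le> D"
    using assms(2) by (rule bounded_borel_uptoE)
  have "\<forall>u\<in>{0..t}. \<bar>f u * g u\<bar> \<le> C * D" using C D by (auto simp: abs_mult intro!: mult_mono)
  then show ?thesis using C(1) D(1) by (auto simp: bounded_borel_upto_def)
qed

lemma bounded_borel_upto_cmult: "bounded_borel_upto t f \<Longrightarrow> bounded_borel_upto t (\<lambda>u. c * f u)"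
  by (intro bounded_borel_upto_mult bounded_borel_upto_const)

lemma bounded_borel_upto_diff:
  assumes "bounded_borel_upto t f" "bounded_borel_upto t g"
  shows "bounded_borel_upto t (\<lambda>u. f u - g u)"
  using bounded_borel_upto_add[OF assms(1) bounded_borel_upto_cmult[OF assms(2), of "-1"]] by simp

lemma bounded_borel_upto_sum:
  assumes "\<And>i. i \<in> A \<Longrightarrow> bounded_borel_upto t (f i)"
  shows "bounded_borel_upto t (\<lambda>u. \<Sum>i\<in>A. f i u)"
  using assms
  by (induction A rule: infinite_finite_induct)
    (auto intro: bounded_borel_upto_const bounded_borel_upto_add)

lemma bounded_borel_upto_powr:
  assumes "bounded_borel_upto t f" "p \<ge> 0"
  shows "bounded_borel_upto t (\<lambda>u. \<bar>f u\<bar> powr p)"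
proof -
  obtain C where C[measurable]: "f \<in> borel_measurable (lborel_upto t)" and "C \<ge> 0" "\<forall>u\<in>{0..t}. \<bar>f u\<bar> \<le> C"
    using assms(1) by (rule bounded_borel_uptoE)
  then have "\<forall>u\<in>{0..t}. \<bar>\<bar>f u\<bar> powr p\<bar> \<le> C powr p" using assms(2) by (auto intro!: powr_mono2)
  moreover have "(\<lambda>u. \<bar>f u\<bar> powr p) \<in> borel_measurable (lborel_upto t)" by measurable
  ultimately show ?thesis by (auto simp: bounded_borel_upto_def)
qed

lemma bounded_borel_upto_integrable:
  assumes "bounded_borel_upto t f"
  shows "integrable (lborel_upto t) f"
  using assms by (auto simp: bounded_borel_upto_def intro: integrable_upto_bounded)

lemma energy_integrable':
  assumes "b > -1" "t \<ge> 0" "bounded_borel_upto t f" "bounded_borel_upto t g"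
  shows "integrable (lborel_upto t \<Otimes>\<^sub>M lborel_upto t) (\<lambda>z. f (fst z) * g (snd z) * \<bar>fst z - snd z\<bar> powr b)"
proof -
  obtain C where C: "f \<in> borel_measurable (lborel_upto t)" "C \<ge> 0" "\<forall>u\<in>{0..t}. \<bar>f u\<bar> \<le> C"
    using assms(3) by (rule bounded_borel_uptoE)
  obtain D where D: "g \<in> borel_measurable (lborel_upto t)" "D \<ge> 0" "\<forall>u\<in>{0..t}. \<bar>g u\<bar> \<le> D"
    using assms(4) by (rule bounded_borel_uptoE)
  show ?thesis by (rule energy_integrable[OF assms(1,2) C(1) D(1)]) (use C(3) D(3) in auto)
qed

lemma energy_iterated:
  assumes "b > -1" "t \<ge> 0" "bounded_borel_upto t f" "bounded_borel_upto t g"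
  shows "energy b t f g = (LINT v:{0..t}|lborel. LINT u:{0..t}|lborel. f u * g v * \<bar>u - v\<bar> powr b)"
  unfolding energy_def set_integral_eq_upto
  using upto.integral_snd[of t "\<lambda>u v. f u * g v * \<bar>u - v\<bar> powr b"] energy_integrable'[OF assms]
  by (simp add: case_prod_unfold)

lemma energy_commute:
  assumes "b > -1" "t \<ge> 0" "bounded_borel_upto t f" "bounded_borel_upto t g"
  shows "energy b t f g = energy b t g f"
proof -
  have "energy b t f g = (\<integral>(x, y). f (fst (y, x)) * g (snd (y, x)) * \<bar>fst (y, x) - snd (y, x)\<bar> powr b
      \<partial>(lborel_upto t \<Otimes>\<^sub>M lborel_upto t))"
    unfolding energy_def
    by (rule upto.integral_product_swap[symmetric]) (rule borel_measurable_integrable, rule energy_integrable'[OF assms])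
  also have "\<dots> = energy b t g f"
    by (simp add: energy_def case_prod_unfold abs_minus_commute mult.commute)
  finally show ?thesis .
qed

lemma energy_sum_left:
  assumes "b > -1" "t \<ge> 0" "\<And>i. i \<in> A \<Longrightarrow> bounded_borel_upto t (f i)" "bounded_borel_upto t g"
  shows "energy b t (\<lambda>u. \<Sum>i\<in>A. f i u) g = (\<Sum>i\<in>A. energy b t (f i) g)"
  unfolding energy_def sum_distrib_right
  by (rule Bochner_Integration.integral_sum) (use energy_integrable' assms in auto)

lemma energy_cmult_left:
  "energy b t (\<lambda>u. c * f u) g = c * energy b t f g"
  by (simp add: energy_def mult.assoc)

lemma energy_add_left:
  assumes "b > -1" "t \<ge> 0" "bounded_borel_upto t f" "bounded_borel_upto t f'" "bounded_borel_upto t g"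
  shows "energy b t (\<lambda>u. f u + f' u) g = energy b t f g + energy b t f' g"
  unfolding energy_def distrib_right
  by (rule Bochner_Integration.integral_add) (use energy_integrable' assms in auto)

text \<open>The error splits into a part quadratic in \<open>h\<close> and a part linear in
  \<open>h\<close> paired with the fixed \<open>g\<close>. The first is controlled by an
  \<open>L^q\<close> norm of \<open>h\<close>, the second by the \<open>L^1\<close> norm.\<close>

lemma energy_square_diff:
  assumes "b > -1" "t \<ge> 0" "bounded_borel_upto t f" "bounded_borel_upto t g"
  defines "h \<equiv> \<lambda>u. f u - g u"
  shows "energy b t f f - energy b t g g = energy b t h h + 2 * energy b t h g"
proof -
  have h: "bounded_borel_upto t h" unfolding h_def by (intro bounded_borel_upto_diff assms)
  have f: "f = (\<lambda>u. h u + g u)" by (simp add: h_def)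
  have 1: "energy b t f f' = energy b t h f' + energy b t g f'" if "bounded_borel_upto t f'" for f'
    by (subst f, rule energy_add_left) (use assms h that in auto)
  have "energy b t f f = energy b t h f + energy b t g f" using 1 assms by auto
  also have "energy b t h f = energy b t h h + energy b t g h"
    using 1[OF h] energy_commute[of b t h f] assms h by simp
  also have "energy b t g f = energy b t h g + energy b t g g"
    using 1[of g] energy_commute[of b t g f] assms h by simp
  finally show ?thesis using energy_commute[of b t g h] assms h by simp
qed

text \<open>Once \<open>g\<close> is replaced by its bound, the second variable can be integrated
  out by the uniform kernel estimate, which leaves the \<open>L^1\<close> norm of
  \<open>h\<close>.\<close>

lemma energy_le_norm:
  assumes "b > -1" "t \<ge> 0" "bounded_borel_upto t h" "bounded_borel_upto t g"
    and C: "\<And>u. u \<in> {0..t} \<Longrightarrow> \<bar>g u\<bar> \<le> C"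
  shows "\<bar>energy b t h g\<bar> \<le> C * (2 * t powr (b + 1) / (b + 1)) * (\<integral>u. \<bar>h u\<bar> \<partial>lborel_upto t)"
proof -
  have h': "bounded_borel_upto t (\<lambda>u. \<bar>h u\<bar>)"
    using bounded_borel_upto_powr[OF assms(3), of 1] by simp
  have C0: "C \<ge> 0" using C[of 0] \<open>t \<ge> 0\<close> by simp
  let ?K = "2 * t powr (b + 1) / (b + 1)"
  have i: "integrable (lborel_upto t \<Otimes>\<^sub>M lborel_upto t) (\<lambda>z. \<bar>h (fst z)\<bar> * C * \<bar>fst z - snd z\<bar> powr b)"
    using energy_integrable'[OF assms(1,2) h' bounded_borel_upto_const] .
  have "\<bar>energy b t h g\<bar> \<le> (\<integral>z. \<bar>h (fst z)\<bar> * C * \<bar>fst z - snd z\<bar> powr b \<partial>(lborel_upto t \<Otimes>\<^sub>M lborel_upto t))"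
    unfolding energy_def real_norm_def[symmetric]
    by (rule Bochner_Integration.integral_norm_bound_integral)
      (use energy_integrable'[OF assms(1-4)] i C C0 in
        \<open>auto simp: abs_mult space_pair_measure space_restrict_space intro!: mult_mono\<close>)
  also have "\<dots> = (\<integral>u. \<bar>h u\<bar> * C * (\<integral>v. \<bar>u - v\<bar> powr b \<partial>lborel_upto t) \<partial>lborel_upto t)"
    using upto.integral_fst'[OF i] by simp
  also have "\<dots> \<le> (\<integral>u. \<bar>h u\<bar> * C * ?K \<partial>lborel_upto t)"
  proof (rule integral_mono)
    show "integrable (lborel_upto t) (\<lambda>u. \<bar>h u\<bar> * C * (\<integral>v. \<bar>u - v\<bar> powr b \<partial>lborel_upto t))"
      using upto.integrable_fst'[OF i] by simp
    show "integrable (lborel_upto t) (\<lambda>u. \<bar>h u\<bar> * C * ?K)"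
      using bounded_borel_upto_integrable[OF h'] by simp
    fix u assume "u \<in> space (lborel_upto t)"
    then have "(\<integral>v. \<bar>u - v\<bar> powr b \<partial>lborel_upto t) \<le> ?K"
      by (intro kernel_integral_le' assms) (simp add: space_restrict_space)
    then show "\<bar>h u\<bar> * C * (\<integral>v. \<bar>u - v\<bar> powr b \<partial>lborel_upto t) \<le> \<bar>h u\<bar> * C * ?K"
      using C0 by (intro mult_left_mono) auto
  qed
  finally show ?thesis by (simp add: ac_simps)
qed

text \<open>An elementary substitute for the Hardy-Littlewood-Sobolev inequality. After
  \<open>mult3_le_sum_powr\<close> one term is a product of two single integrals, and in the other
  two the power \<open>b * r > -1\<close> of the kernel can be integrated out first.\<close>

lemma energy_self_le:
  fixes q r b :: real
  assumes b: "b > -1" and t: "t \<ge> 0" and h: "bounded_borel_upto t h" and q: "1 < q" "q < 2"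
    and r: "r = q / (2 * q - 2)" "b * r > -1" and \<delta>: "\<delta> > 0"
    and small: "(\<integral>u. \<bar>h u\<bar> powr q \<partial>lborel_upto t) \<le> \<delta> powr q"
  shows "\<bar>energy b t h h\<bar> \<le> \<delta>\<^sup>2 * (1 + 2 * (2 * t powr (b * r + 1) / (b * r + 1)))"
proof -
  let ?M = "lborel_upto t \<Otimes>\<^sub>M lborel_upto t"
  let ?K = "2 * t powr (b * r + 1) / (b * r + 1)"
  \<comment> \<open>The three summands of the pointwise bound have degrees \<open>2 * q\<close>,
    \<open>q\<close> and \<open>q\<close> in \<open>h\<close>. Dividing by \<open>\<delta>\<close>
    first makes all of them bounded, and the factor \<open>\<delta>\<^sup>2\<close> restores the
    quadratic scaling of the energy.\<close>
  define X where "X u = \<bar>h u / \<delta>\<bar> powr q" for u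
  have X: "bounded_borel_upto t X"
    unfolding X_def using bounded_borel_upto_cmult[OF h, of "1 / \<delta>"] q
    by (intro bounded_borel_upto_powr) auto
  have X0: "X u \<ge> 0" for u by (simp add: X_def)
  have "X u = \<bar>h u\<bar> powr q / \<delta> powr q" for u
    using \<delta> by (simp add: X_def powr_divide)
  then have "(\<integral>u. X u \<partial>lborel_upto t) = (\<integral>u. \<bar>h u\<bar> powr q \<partial>lborel_upto t) / \<delta> powr q"
    by simp
  also have "\<dots> \<le> 1" using small \<delta> by (simp add: divide_le_eq)
  finally have X1: "(\<integral>u. X u \<partial>lborel_upto t) \<le> 1" .
  have Xpos: "(\<integral>u. X u \<partial>lborel_upto t) \<ge> 0" using X0 by simp
  have K0: "?K \<ge> 0" using r by simp
  have one: "bounded_borel_upto t (\<lambda>_. 1)" by (rule bounded_borel_upto_const)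
  have i1: "integrable ?M (\<lambda>z. X (fst z) * X (snd z))"
  proof -
    interpret P: finite_measure ?M
      by (intro finite_measure_pair_measure finite_measure_lborel_upto)
    obtain C where C: "X \<in> borel_measurable (lborel_upto t)" "C \<ge> 0" "\<forall>u\<in>{0..t}. \<bar>X u\<bar> \<le> C"
      using X by (rule bounded_borel_uptoE)
    note [measurable] = C(1)
    show ?thesis
    proof (rule P.integrable_const_bound[where B="C * C"])
      show "AE z in ?M. norm (X (fst z) * X (snd z)) \<le> C * C"
        using C by (intro AE_I2) (auto simp: space_pair_measure space_restrict_space abs_mult intro!: mult_mono)
    qed measurable
  qed
  have I1: "(\<integral>z. X (fst z) * X (snd z) \<partial>?M) \<le> 1"
  proof -
    have "(\<integral>z. X (fst z) * X (snd z) \<partial>?M) = (\<integral>u. X u \<partial>lborel_upto t) * (\<integral>u. X u \<partial>lborel_upto t)"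
      using upto.integral_fst'[OF i1] by simp
    also have "\<dots> \<le> 1 * 1" using X1 Xpos by (intro mult_mono) auto
    finally show ?thesis by simp
  qed
  have i2: "integrable ?M (\<lambda>z. X (fst z) * \<bar>fst z - snd z\<bar> powr (b * r))"
    using energy_integrable'[OF r(2) t X one] by simp
  have i3: "integrable ?M (\<lambda>z. X (snd z) * \<bar>fst z - snd z\<bar> powr (b * r))"
    using energy_integrable'[OF r(2) t one X] by simp
  have e2: "energy (b * r) t X (\<lambda>_. 1) \<le> ?K"
  proof -
    have "energy (b * r) t X (\<lambda>_. 1) \<le> 1 * ?K * (\<integral>u. \<bar>X u\<bar> \<partial>lborel_upto t)"
      using energy_le_norm[OF r(2) t X one, of 1] by simp
    also have "\<dots> \<le> 1 * ?K * 1" using X1 X0 K0 by (intro mult_left_mono) auto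
    finally show ?thesis by simp
  qed
  have I2: "(\<integral>z. X (fst z) * \<bar>fst z - snd z\<bar> powr (b * r) \<partial>?M) \<le> ?K"
    using e2 by (simp add: energy_def)
  have I3: "(\<integral>z. X (snd z) * \<bar>fst z - snd z\<bar> powr (b * r) \<partial>?M) \<le> ?K"
    using e2 unfolding energy_commute[OF r(2) t X one] by (simp add: energy_def)
  let ?B = "\<lambda>z. \<delta>\<^sup>2 * (X (fst z) * X (snd z) + X (fst z) * \<bar>fst z - snd z\<bar> powr (b * r)
      + X (snd z) * \<bar>fst z - snd z\<bar> powr (b * r))"
  have "norm (energy b t h h) \<le> (\<integral>z. ?B z \<partial>?M)"
    unfolding energy_def
  proof (rule Bochner_Integration.integral_norm_bound_integral)
    show "integrable ?M (\<lambda>z. h (fst z) * h (snd z) * \<bar>fst z - snd z\<bar> powr b)"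
      by (rule energy_integrable'[OF b t h h])
    show "integrable ?M ?B" using i1 i2 i3 by simp
    fix z assume "z \<in> space ?M"
    have "norm (h (fst z) * h (snd z) * \<bar>fst z - snd z\<bar> powr b) =
        \<delta>\<^sup>2 * (\<bar>h (fst z) / \<delta>\<bar> * \<bar>h (snd z) / \<delta>\<bar> * \<bar>fst z - snd z\<bar> powr b)"
      using \<delta> by (simp add: abs_mult power2_eq_square)
    also have "\<dots> \<le> ?B z"
      using mult3_le_sum_powr[of "\<bar>h (fst z) / \<delta>\<bar>" "\<bar>h (snd z) / \<delta>\<bar>" "\<bar>fst z - snd z\<bar> powr b" q] q
      unfolding X_def powr_powr r(1)[symmetric] by (intro mult_left_mono) auto
    finally show "norm (h (fst z) * h (snd z) * \<bar>fst z - snd z\<bar> powr b) \<le> ?B z" .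
  qed
  also have "(\<integral>z. ?B z \<partial>?M) = \<delta>\<^sup>2 * ((\<integral>z. X (fst z) * X (snd z) \<partial>?M)
      + (\<integral>z. X (fst z) * \<bar>fst z - snd z\<bar> powr (b * r) \<partial>?M)
      + (\<integral>z. X (snd z) * \<bar>fst z - snd z\<bar> powr (b * r) \<partial>?M))"
    using i1 i2 i3 by simp
  also have "\<dots> \<le> \<delta>\<^sup>2 * (1 + ?K + ?K)"
    using I1 I2 I3 by (intro mult_left_mono add_mono) auto
  also have "\<dots> = \<delta>\<^sup>2 * (1 + 2 * ?K)" by simp
  finally show ?thesis by (simp only: real_norm_def)
qed

text \<open>Below the threshold \<open>\<delta>\<close> the first summand suffices; above it,
  \<open>x powr (q - p)\<close> has a nonpositive exponent and is largest at
  \<open>\<delta>\<close>. On a finite measure this takes the place of Hoelder's inequality in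
  passing from exponent \<open>p\<close> to \<open>q\<close>.\<close>

lemma powr_le_powr_add:
  fixes x \<delta> p q :: real
  assumes "0 \<le> x" "0 < \<delta>" "0 < q" "q \<le> p"
  shows "x powr q \<le> \<delta> powr q + \<delta> powr (q - p) * x powr p"
proof (cases "x \<le> \<delta>")
  case True
  then have "x powr q \<le> \<delta> powr q" using assms by (intro powr_mono2) auto
  then show ?thesis by (simp add: add_increasing2)
next
  case False
  then have "x powr q = x powr (q - p) * x powr p" using assms by (simp add: powr_add [symmetric])
  also have "\<dots> \<le> \<delta> powr (q - p) * x powr p"
    using False assms by (intro mult_right_mono powr_mono2') auto
  finally show ?thesis by (simp add: add_increasing)
qed

lemma Lp_tendsto_mono:
  fixes h :: "nat \<Rightarrow> real \<Rightarrow> real"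
  assumes t: "t \<ge> 0" and h: "\<And>n. bounded_borel_upto t (h n)" and pq: "0 < q" "q \<le> p"
    and lim: "(\<lambda>n. \<integral>u. \<bar>h n u\<bar> powr p \<partial>lborel_upto t) \<longlonglongrightarrow> 0"
  shows "(\<lambda>n. \<integral>u. \<bar>h n u\<bar> powr q \<partial>lborel_upto t) \<longlonglongrightarrow> 0"
proof (rule LIMSEQ_I)
  fix e :: real assume e: "e > 0"
  \<comment> \<open>Values below the threshold then contribute at most \<open>e / 2\<close>; writing
    \<open>t + 1\<close> instead of \<open>t\<close> covers the case \<open>t = 0\<close>.\<close>
  define \<delta> where "\<delta> = (e / (2 * (t + 1))) powr (1 / q)"
  have \<delta>: "\<delta> > 0" using e t by (simp add: \<delta>_def)
  have \<delta>q: "\<delta> powr q = e / (2 * (t + 1))" using e t pq by (simp add: \<delta>_def powr_powr)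
  have ih: "integrable (lborel_upto t) (\<lambda>u. \<bar>h n u\<bar> powr s)" if "s > 0" for n s
    using bounded_borel_upto_integrable[OF bounded_borel_upto_powr[OF h]] that by simp
  have m: "(\<integral>u. c \<partial>lborel_upto t) = t * c" for c :: real
    using t by (simp add: measure_restrict_space space_restrict_space)
  have le: "(\<integral>u. \<bar>h n u\<bar> powr q \<partial>lborel_upto t) \<le> e / 2 + \<delta> powr (q - p) * (\<integral>u. \<bar>h n u\<bar> powr p \<partial>lborel_upto t)" for n
  proof -
    have "(\<integral>u. \<bar>h n u\<bar> powr q \<partial>lborel_upto t)
      \<le> (\<integral>u. \<delta> powr q + \<delta> powr (q - p) * \<bar>h n u\<bar> powr p \<partial>lborel_upto t)"
      using ih pq \<delta> by (intro integral_mono powr_le_powr_add) auto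
    also have "\<dots> = t * \<delta> powr q + \<delta> powr (q - p) * (\<integral>u. \<bar>h n u\<bar> powr p \<partial>lborel_upto t)"
      using ih[of p n] pq m by simp
    also have "t * \<delta> powr q \<le> e / 2" using e t by (simp add: \<delta>q divide_simps)
    finally show ?thesis by simp
  qed
  have "(\<lambda>n. \<delta> powr (q - p) * (\<integral>u. \<bar>h n u\<bar> powr p \<partial>lborel_upto t)) \<longlonglongrightarrow> \<delta> powr (q - p) * 0"
    by (intro tendsto_intros lim)
  then obtain N where N: "\<And>n. n \<ge> N \<Longrightarrow> \<bar>\<delta> powr (q - p) * (\<integral>u. \<bar>h n u\<bar> powr p \<partial>lborel_upto t)\<bar> < e / 2"
    using LIMSEQ_D[of "\<lambda>n. \<delta> powr (q - p) * (\<integral>u. \<bar>h n u\<bar> powr p \<partial>lborel_upto t)" 0 "e / 2"] e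
    by (simp only: mult_zero_right diff_zero real_norm_def half_gt_zero) blast
  have "norm ((\<integral>u. \<bar>h n u\<bar> powr q \<partial>lborel_upto t) - 0) < e" if "n \<ge> N" for n
  proof -
    have "(\<integral>u. \<bar>h n u\<bar> powr q \<partial>lborel_upto t) \<ge> 0" by simp
    then show ?thesis using le[of n] N[OF that] by (simp only: real_norm_def diff_zero)
  qed
  then show "\<exists>N. \<forall>n\<ge>N. norm ((\<integral>u. \<bar>h n u\<bar> powr q \<partial>lborel_upto t) - 0) < e" by blast
qed

text \<open>With \<open>b = 2 * H - 2\<close> the condition on \<open>p\<close> reads \<open>p > 1 / H\<close>.\<close>

lemma energy_tendsto:
  fixes s :: "nat \<Rightarrow> real \<Rightarrow> real"
  assumes b: "b > -1" "b < 0" and t: "t \<ge> 0" and p: "p > 2 / (b + 2)"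
    and s: "\<And>n. bounded_borel_upto t (s n)" and g: "bounded_borel_upto t g"
    and lim: "(\<lambda>n. \<integral>u. \<bar>s n u - g u\<bar> powr p \<partial>lborel_upto t) \<longlonglongrightarrow> 0"
  shows "(\<lambda>n. energy b t (s n) (s n)) \<longlonglongrightarrow> energy b t g g"
proof -
  define h where "h n u = s n u - g u" for n u
  have h: "bounded_borel_upto t (h n)" for n
    unfolding h_def by (intro bounded_borel_upto_diff s g)
  have "2 / (b + 2) < 2" using b by (simp add: divide_simps)
  \<comment> \<open>Capping \<open>p\<close> at the midpoint of \<open>2 / (b + 2)\<close> and 2
    gives \<open>q < 2\<close>, as the pointwise inequality requires, while
    \<open>q > 2 / (b + 2)\<close> is exactly what makes \<open>b * r > -1\<close>.\<close>
  define q where "q = min p ((2 / (b + 2) + 2) / 2)"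
  have q: "2 / (b + 2) < q" "q \<le> p" "q < 2"
    using p \<open>2 / (b + 2) < 2\<close> by (auto simp: q_def min_less_iff_disj)
  have "2 / (b + 2) > 1" using b by (simp add: divide_simps)
  then have q1: "q > 1" using q by simp
  define r where "r = q / (2 * q - 2)"
  have br: "b * r > -1"
  proof -
    have "2 < q * (b + 2)" using q b by (simp add: pos_divide_less_eq)
    then have "- (2 * q - 2) < b * q" by (simp add: algebra_simps)
    then show ?thesis using q1 by (simp add: r_def pos_less_divide_eq)
  qed
  have lim': "(\<lambda>n. \<integral>u. \<bar>h n u\<bar> powr q' \<partial>lborel_upto t) \<longlonglongrightarrow> 0" if "0 < q'" "q' \<le> p" for q'
    by (rule Lp_tendsto_mono[OF t h that]) (use lim in \<open>simp add: h_def\<close>)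
  let ?K = "2 * t powr (b * r + 1) / (b * r + 1)"
  have hh: "(\<lambda>n. energy b t (h n) (h n)) \<longlonglongrightarrow> 0"
  proof (rule LIMSEQ_I)
    fix e :: real assume e: "e > 0"
    define \<delta> where "\<delta> = sqrt (e / (2 * (1 + 2 * ?K)))"
    have K: "1 + 2 * ?K > 0" using br by (simp add: add_pos_nonneg)
    have \<delta>: "\<delta> > 0" "\<delta>\<^sup>2 * (1 + 2 * ?K) = e / 2" using e K by (simp_all add: \<delta>_def divide_simps)
    have "\<delta> powr q > 0" using \<delta> by simp
    then obtain N where N: "\<And>n. n \<ge> N \<Longrightarrow> norm ((\<integral>u. \<bar>h n u\<bar> powr q \<partial>lborel_upto t) - 0) < \<delta> powr q"
      using LIMSEQ_D[OF lim'[of q], of "\<delta> powr q"] q q1 by auto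
    have "norm (energy b t (h n) (h n) - 0) < e" if "n \<ge> N" for n
    proof -
      have "(\<integral>u. \<bar>h n u\<bar> powr q \<partial>lborel_upto t) \<le> \<delta> powr q" using N[OF that] by simp
      then have "\<bar>energy b t (h n) (h n)\<bar> \<le> \<delta>\<^sup>2 * (1 + 2 * ?K)"
        by (intro energy_self_le[OF b(1) t h q1 q(3) r_def br \<delta>(1)])
      then show ?thesis using \<delta>(2) e by simp
    qed
    then show "\<exists>N. \<forall>n\<ge>N. norm (energy b t (h n) (h n) - 0) < e" by blast
  qed
  obtain C where C: "\<forall>u\<in>{0..t}. \<bar>g u\<bar> \<le> C"
    using g by (rule bounded_borel_uptoE)
  have hg: "(\<lambda>n. energy b t (h n) g) \<longlonglongrightarrow> 0"
  proof (rule Lim_null_comparison)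
    show "\<forall>\<^sub>F n in sequentially. norm (energy b t (h n) g)
        \<le> C * (2 * t powr (b + 1) / (b + 1)) * (\<integral>u. \<bar>h n u\<bar> powr 1 \<partial>lborel_upto t)"
      using energy_le_norm[OF b(1) t h g] C by simp
    have "(\<lambda>n. C * (2 * t powr (b + 1) / (b + 1)) * (\<integral>u. \<bar>h n u\<bar> powr 1 \<partial>lborel_upto t))
        \<longlonglongrightarrow> C * (2 * t powr (b + 1) / (b + 1)) * 0"
      by (intro tendsto_mult tendsto_const lim') (use q q1 in auto)
    then show "(\<lambda>n. C * (2 * t powr (b + 1) / (b + 1)) * (\<integral>u. \<bar>h n u\<bar> powr 1 \<partial>lborel_upto t)) \<longlonglongrightarrow> 0"
      by simp
  qed
  have "(\<lambda>n. energy b t g g + (energy b t (h n) (h n) + 2 * energy b t (h n) g))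
      \<longlonglongrightarrow> energy b t g g + (0 + 2 * 0)"
    by (intro tendsto_intros hh hg)
  moreover have "energy b t (s n) (s n) = energy b t g g + (energy b t (h n) (h n) + 2 * energy b t (h n) g)" for n
    using energy_square_diff[OF b(1) t s g, of n] unfolding h_def by simp
  ultimately show ?thesis by simp
qed

text \<open>Half-open and closed intervals differ by a null set, so this is the double kernel
  integral computed above. For \<open>b = 2 * H - 2\<close> the denominator is
  \<open>2 * (H * (2 * H - 1))\<close>, which matches the covariance of increments.\<close>

lemma energy_indicator:
  assumes b: "b > -1" and lr: "0 \<le> l" "l \<le> r" "r \<le> t" and lr': "0 \<le> l'" "l' \<le> r'" "r' \<le> t"
  shows "energy b t (indicator {l<..r}) (indicator {l'<..r'}) =
    (\<bar>r - l'\<bar> powr (b + 2) + \<bar>l - r'\<bar> powr (b + 2) - \<bar>r - r'\<bar> powr (b + 2) - \<bar>l - l'\<bar> powr (b + 2))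
      / ((b + 1) * (b + 2))"
proof -
  have ind: "(\<integral>u. indicator {0..t} u * (indicator {x<..y} u * f u) \<partial>lborel) = (LINT u:{x..y}|lborel. f u)"
    if "0 \<le> x" "y \<le> t" and [measurable]: "f \<in> borel_measurable borel" for x y and f :: "real \<Rightarrow> real"
    unfolding set_lebesgue_integral_def
  proof (rule integral_cong_AE)
    note [measurable] = that(3)
    show "(\<lambda>u. indicator {0..t} u * (indicator {x<..y} u * f u)) \<in> borel_measurable lborel"
      by measurable
    show "(\<lambda>u. indicator {x..y} u *\<^sub>R f u) \<in> borel_measurable lborel"
      by measurable
    show "AE u in lborel. indicator {0..t} u * (indicator {x<..y} u * f u) = indicator {x..y} u *\<^sub>R f u"
      using AE_lborel_singleton[of x] by eventually_elim (use that in \<open>auto simp: indicator_def\<close>)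
  qed
  have "energy b t (indicator {l<..r}) (indicator {l'<..r'}) =
      (LINT v:{0..t}|lborel. LINT u:{0..t}|lborel. indicator {l<..r} u * indicator {l'<..r'} v * \<bar>u - v\<bar> powr b)"
    using lr by (intro energy_iterated b bounded_borel_upto_indicator) auto
  also have "\<dots> = (\<integral>v. indicator {0..t} v * (indicator {l'<..r'} v * (LINT u:{l..r}|lborel. \<bar>u - v\<bar> powr b)) \<partial>lborel)"
  proof -
    have "(LINT u:{0..t}|lborel. indicator {l<..r} u * indicator {l'<..r'} v * \<bar>u - v\<bar> powr b)
        = indicator {l'<..r'} v * (LINT u:{l..r}|lborel. \<bar>u - v\<bar> powr b)" for v
    proof -
      have "(LINT u:{0..t}|lborel. indicator {l<..r} u * indicator {l'<..r'} v * \<bar>u - v\<bar> powr b)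
        = (\<integral>u. indicator {l'<..r'} v * (indicator {0..t} u * (indicator {l<..r} u * \<bar>u - v\<bar> powr b)) \<partial>lborel)"
        unfolding set_lebesgue_integral_def by (intro Bochner_Integration.integral_cong) auto
      also have "\<dots> = indicator {l'<..r'} v * (LINT u:{l..r}|lborel. \<bar>u - v\<bar> powr b)"
        using lr by (subst integral_mult_right_zero, subst ind) auto
      finally show ?thesis .
    qed
    then show ?thesis by (simp add: set_lebesgue_integral_def)
  qed
  also have "\<dots> = (LINT v:{l'..r'}|lborel. LINT u:{l..r}|lborel. \<bar>u - v\<bar> powr b)"
  proof (rule ind)
    have "(\<lambda>v. LINT u:{l..r}|lborel. \<bar>u - v\<bar> powr b) = (\<lambda>v. abs_powr_prim b (r - v) - abs_powr_prim b (l - v))"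
      using abs_powr_integral(2)[OF b lr(2)] by auto
    also have "\<dots> \<in> borel_measurable borel"
      unfolding abs_powr_prim_def by measurable
    finally show "(\<lambda>v. LINT u:{l..r}|lborel. \<bar>u - v\<bar> powr b) \<in> borel_measurable borel" .
  qed (use lr' in auto)
  also have "\<dots> = (\<bar>r - l'\<bar> powr (b + 2) + \<bar>l - r'\<bar> powr (b + 2) - \<bar>r - r'\<bar> powr (b + 2) - \<bar>l - l'\<bar> powr (b + 2))
      / ((b + 1) * (b + 2))"
    by (rule abs_powr_double_integral[OF b lr(2) lr'(2)])
  finally show ?thesis .
qed

section \<open>Second moments of Wiener integrals\<close>

text \<open>First \<open>\<mu>\<close> is chosen to make \<open>\<mu> * K\<close> small, then
  \<open>n\<close>; hence \<open>c \<mu>\<close> may blow up as \<open>\<mu>\<close> tends to 0.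
  Together with the weighted inequality between products and squares this replaces the
  Cauchy-Schwarz inequality for mean-square limits.\<close>

lemma tendsto_of_trade_off:
  fixes x d :: "nat \<Rightarrow> real"
  assumes d: "d \<longlonglongrightarrow> 0" and K: "K \<ge> 0"
    and le: "\<And>\<mu> n. \<mu> > 0 \<Longrightarrow> \<bar>x n - a\<bar> \<le> c \<mu> * d n + \<mu> * K"
  shows "x \<longlonglongrightarrow> a"
proof (rule LIMSEQ_I)
  fix e :: real assume e: "e > 0"
  define \<mu> where "\<mu> = e / (2 * (K + 1))"
  have \<mu>: "\<mu> > 0" "\<mu> * K \<le> e / 2" using e K by (auto simp: \<mu>_def divide_simps)
  have "(\<lambda>n. c \<mu> * d n) \<longlonglongrightarrow> c \<mu> * 0" by (intro tendsto_intros d)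
  then obtain N where "\<forall>n\<ge>N. norm (c \<mu> * d n - c \<mu> * 0) < e / 2"
    using LIMSEQ_D half_gt_zero[OF e] by blast
  then have "norm (x n - a) < e" if "n \<ge> N" for n
    using le[OF \<mu>(1), of n] \<mu>(2) that by fastforce
  then show "\<exists>N. \<forall>n\<ge>N. norm (x n - a) < e" by blast
qed

lemma centered_gaussian_moments:
  assumes "prob_space \<Omega>" and X: "centered_gaussian \<Omega> X"
  shows "integrable \<Omega> X" "(LINT \<omega>|\<Omega>. X \<omega>) = 0" "integrable \<Omega> (\<lambda>\<omega>. (X \<omega>)\<^sup>2)"
proof -
  interpret prob_space \<Omega> by fact
  have [measurable]: "X \<in> borel_measurable \<Omega>" using X by (simp add: centered_gaussian_def)
  have "integrable \<Omega> X \<and> (LINT \<omega>|\<Omega>. X \<omega>) = 0 \<and> integrable \<Omega> (\<lambda>\<omega>. (X \<omega>)\<^sup>2)"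
  proof (cases "AE \<omega> in \<Omega>. X \<omega> = 0")
    case True
    have "integrable \<Omega> X \<longleftrightarrow> integrable \<Omega> (\<lambda>_. 0 :: real)"
      using True by (intro integrable_cong_AE) auto
    moreover have "(LINT \<omega>|\<Omega>. X \<omega>) = (LINT \<omega>|\<Omega>. 0 :: real)"
      using True by (intro integral_cong_AE) auto
    moreover have "integrable \<Omega> (\<lambda>\<omega>. (X \<omega>)\<^sup>2) \<longleftrightarrow> integrable \<Omega> (\<lambda>_. 0 :: real)"
      using True by (intro integrable_cong_AE) auto
    ultimately show ?thesis by simp
  next
    case False
    then obtain s where s: "s > 0" and D: "distributed \<Omega> lborel X (normal_density 0 s)"
      using X by (auto simp: centered_gaussian_def)
    have "integrable \<Omega> (\<lambda>\<omega>. (X \<omega>) ^ k)" for k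
    proof -
      have "integrable lborel (\<lambda>x. normal_density 0 s x * x ^ k)"
        using integrable_normal_moment[OF s, of 0 k] by simp
      then show ?thesis
        using distributed_integrable[OF D, of "\<lambda>x. x ^ k"] by simp
    qed
    from this[of 1] this[of 2] show ?thesis
      using normal_distributed_expectation[OF s D] by simp
  qed
  then show "integrable \<Omega> X" "(LINT \<omega>|\<Omega>. X \<omega>) = 0" "integrable \<Omega> (\<lambda>\<omega>. (X \<omega>)\<^sup>2)"
    by auto
qed

lemma abs_integral_le:
  fixes f g :: "'a \<Rightarrow> real"
  assumes "integrable M f" "integrable M g" "\<And>x. x \<in> space M \<Longrightarrow> \<bar>f x\<bar> \<le> g x"
  shows "\<bar>\<integral>x. f x \<partial>M\<bar> \<le> (\<integral>x. g x \<partial>M)"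
  using integral_abs_bound[of M f] integral_mono[OF integrable_abs[OF assms(1)] assms(2,3)] by linarith

lemma integrable_mult_square:
  fixes X Y :: "'a \<Rightarrow> real"
  assumes [measurable]: "X \<in> borel_measurable M" "Y \<in> borel_measurable M"
    and "integrable M (\<lambda>\<omega>. (X \<omega>)\<^sup>2)" "integrable M (\<lambda>\<omega>. (Y \<omega>)\<^sup>2)"
  shows "integrable M (\<lambda>\<omega>. X \<omega> * Y \<omega>)"
proof (rule Bochner_Integration.integrable_bound[of M "\<lambda>\<omega>. (X \<omega>)\<^sup>2 + (Y \<omega>)\<^sup>2"])
  show "AE \<omega> in M. norm (X \<omega> * Y \<omega>) \<le> norm ((X \<omega>)\<^sup>2 + (Y \<omega>)\<^sup>2)"
  proof (rule AE_I2)
    fix \<omega>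
    have "2 * \<bar>X \<omega>\<bar> * \<bar>Y \<omega>\<bar> \<le> \<bar>X \<omega>\<bar>\<^sup>2 + \<bar>Y \<omega>\<bar>\<^sup>2" by (rule sum_squares_bound)
    moreover have "0 \<le> \<bar>X \<omega>\<bar> * \<bar>Y \<omega>\<bar>" by simp
    ultimately have "\<bar>X \<omega>\<bar> * \<bar>Y \<omega>\<bar> \<le> \<bar>X \<omega>\<bar>\<^sup>2 + \<bar>Y \<omega>\<bar>\<^sup>2" by linarith
    then show "norm (X \<omega> * Y \<omega>) \<le> norm ((X \<omega>)\<^sup>2 + (Y \<omega>)\<^sup>2)"
      by (simp add: abs_mult)
  qed
qed (use assms in auto)

lemma fbm_moments:
  assumes W: "fractional_brownian_motion \<Omega> H W" and t: "t \<ge> 0"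
  shows "integrable \<Omega> (W t)" "(LINT \<omega>|\<Omega>. W t \<omega>) = 0" "integrable \<Omega> (\<lambda>\<omega>. (W t \<omega>)\<^sup>2)"
proof -
  have P: "prob_space \<Omega>"
    and g: "\<forall>A c. finite A \<and> A \<subseteq> {0..} \<longrightarrow> centered_gaussian \<Omega> (\<lambda>\<omega>. \<Sum>t\<in>A. c t * W t \<omega>)"
    using W by (auto simp: fractional_brownian_motion_def)
  have "centered_gaussian \<Omega> (\<lambda>\<omega>. \<Sum>t\<in>{t}. (\<lambda>_. 1) t * W t \<omega>)"
    by (rule g[rule_format]) (use t in simp)
  then have "centered_gaussian \<Omega> (W t)" by simp
  then show "integrable \<Omega> (W t)" "(LINT \<omega>|\<Omega>. W t \<omega>) = 0" "integrable \<Omega> (\<lambda>\<omega>. (W t \<omega>)\<^sup>2)"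
    using centered_gaussian_moments[OF P] by auto
qed

text \<open>In the expansion into four covariances the pure powers of the single times cancel, and
  only a mixed second difference of \<open>\<bar>x\<bar> powr (2 * H)\<close> remains.\<close>

lemma fbm_increment_moments:
  assumes W: "fractional_brownian_motion \<Omega> H W" and "0 \<le> l" "0 \<le> r" "0 \<le> l'" "0 \<le> r'"
  shows "integrable \<Omega> (\<lambda>\<omega>. (W r \<omega> - W l \<omega>) * (W r' \<omega> - W l' \<omega>))"
    and "(LINT \<omega>|\<Omega>. (W r \<omega> - W l \<omega>) * (W r' \<omega> - W l' \<omega>)) =
      (\<bar>r - l'\<bar> powr (2 * H) + \<bar>l - r'\<bar> powr (2 * H) - \<bar>r - r'\<bar> powr (2 * H) - \<bar>l - l'\<bar> powr (2 * H)) / 2"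
proof -
  have [measurable]: "W t \<in> borel_measurable \<Omega>" if "t \<ge> 0" for t
    using W that by (auto simp: fractional_brownian_motion_def)
  have i: "integrable \<Omega> (\<lambda>\<omega>. W t \<omega> * W s \<omega>)" if "t \<ge> 0" "s \<ge> 0" for s t
    using that fbm_moments(3)[OF W] by (intro integrable_mult_square) auto
  have c: "(LINT \<omega>|\<Omega>. W t \<omega> * W s \<omega>) = (t powr (2 * H) + s powr (2 * H) - \<bar>t - s\<bar> powr (2 * H)) / 2"
    if "t \<ge> 0" "s \<ge> 0" for s t
    using W that by (auto simp: fractional_brownian_motion_def)
  have e: "(\<lambda>\<omega>. (W r \<omega> - W l \<omega>) * (W r' \<omega> - W l' \<omega>)) =
      (\<lambda>\<omega>. W r \<omega> * W r' \<omega> - W r \<omega> * W l' \<omega> - W l \<omega> * W r' \<omega> + W l \<omega> * W l' \<omega>)"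
    by (auto simp: algebra_simps)
  show "integrable \<Omega> (\<lambda>\<omega>. (W r \<omega> - W l \<omega>) * (W r' \<omega> - W l' \<omega>))"
    unfolding e using i assms by simp
  show "(LINT \<omega>|\<Omega>. (W r \<omega> - W l \<omega>) * (W r' \<omega> - W l' \<omega>)) =
      (\<bar>r - l'\<bar> powr (2 * H) + \<bar>l - r'\<bar> powr (2 * H) - \<bar>r - r'\<bar> powr (2 * H) - \<bar>l - l'\<bar> powr (2 * H)) / 2"
    unfolding e using i assms by (simp add: c) (simp add: field_simps)
qed

lemma steps_in_nth:
  assumes "steps_in t S" "i < length S"
  shows "0 \<le> fst (S ! i)" "fst (S ! i) \<le> fst (snd (S ! i))" "fst (snd (S ! i)) \<le> t"
  using assms(1) nth_mem[OF assms(2)] unfolding steps_in_def by (auto simp: case_prod_unfold)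

lemma step_fun_sum:
  "step_fun S = (\<lambda>u. \<Sum>i<length S. snd (snd (S ! i)) * indicator {fst (S ! i)<..fst (snd (S ! i))} u)"
  by (auto simp: step_fun_def sum_list_sum_nth atLeast0LessThan case_prod_unfold)

lemma step_integral_sum:
  "step_integral W S = (\<lambda>\<omega>. \<Sum>i<length S. snd (snd (S ! i)) * (W (fst (snd (S ! i))) \<omega> - W (fst (S ! i)) \<omega>))"
  by (auto simp: step_integral_def sum_list_sum_nth atLeast0LessThan case_prod_unfold)

lemma bounded_borel_upto_step_fun: "bounded_borel_upto t (step_fun S)"
  unfolding step_fun_sum
  by (intro bounded_borel_upto_sum bounded_borel_upto_cmult bounded_borel_upto_indicator)

text \<open>The last claim is the isometry on step functions: both sides expand bilinearly over
  pairs of steps and agree on each pair. Overlapping intervals cause no difficulty, since no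
  orthogonality of increments enters.\<close>

lemma step_integral_moments:
  assumes W: "fractional_brownian_motion \<Omega> H W" and H: "1 / 2 < H" "H < 1"
    and t: "t \<ge> 0" and S: "steps_in t S"
  shows "integrable \<Omega> (step_integral W S)" "(LINT \<omega>|\<Omega>. step_integral W S \<omega>) = 0"
    and "integrable \<Omega> (\<lambda>\<omega>. (step_integral W S \<omega>)\<^sup>2)"
    and "(LINT \<omega>|\<Omega>. (step_integral W S \<omega>)\<^sup>2) =
      H * (2 * H - 1) * energy (2 * H - 2) t (step_fun S) (step_fun S)"
proof -
  let ?l = "\<lambda>i. fst (S ! i)" and ?r = "\<lambda>i. fst (snd (S ! i))" and ?c = "\<lambda>i. snd (snd (S ! i))"
  let ?D = "\<lambda>i \<omega>. W (?r i) \<omega> - W (?l i) \<omega>" and ?I = "\<lambda>i. indicator {?l i<..?r i} :: real \<Rightarrow> real"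
  have lr: "0 \<le> ?l i" "?l i \<le> ?r i" "?r i \<le> t" "0 \<le> ?r i" if "i < length S" for i
    using steps_in_nth[OF S that] by simp_all
  show "integrable \<Omega> (step_integral W S)"
    unfolding step_integral_sum
    by (intro Bochner_Integration.integrable_sum integrable_mult_right Bochner_Integration.integrable_diff
        fbm_moments(1)[OF W]) (use lr in auto)
  show "(LINT \<omega>|\<Omega>. step_integral W S \<omega>) = 0"
    unfolding step_integral_sum using lr fbm_moments(1,2)[OF W] by simp
  have sq: "(step_integral W S \<omega>)\<^sup>2 = (\<Sum>i<length S. \<Sum>j<length S. ?c i * ?c j * (?D i \<omega> * ?D j \<omega>))" for \<omega>
    unfolding step_integral_sum power2_eq_square sum_product by (intro sum.cong) auto
  have iD: "integrable \<Omega> (\<lambda>\<omega>. ?D i \<omega> * ?D j \<omega>)" if "i < length S" "j < length S" for i j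
    using fbm_increment_moments(1)[OF W] lr that by simp
  show "integrable \<Omega> (\<lambda>\<omega>. (step_integral W S \<omega>)\<^sup>2)"
    unfolding sq by (intro Bochner_Integration.integrable_sum integrable_mult_right iD) auto
  have eD: "(LINT \<omega>|\<Omega>. ?D i \<omega> * ?D j \<omega>) = H * (2 * H - 1) * energy (2 * H - 2) t (?I i) (?I j)"
    if "i < length S" "j < length S" for i j
  proof -
    have "(2 * H - 2 + 1) * (2 * H - 2 + 2) = 2 * (H * (2 * H - 1))" by (simp add: algebra_simps)
    moreover have "H * (2 * H - 1) \<noteq> 0" using H by simp
    ultimately show ?thesis
      using energy_indicator[of "2 * H - 2" "?l i" "?r i" t "?l j" "?r j"]
        fbm_increment_moments(2)[OF W, of "?l i" "?r i" "?l j" "?r j"] lr that H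
      by (simp only:) simp
  qed
  have b: "2 * H - 2 > -1" using H by simp
  note bb = bounded_borel_upto_sum bounded_borel_upto_cmult bounded_borel_upto_indicator
  have "energy (2 * H - 2) t (step_fun S) (step_fun S) =
      (\<Sum>i<length S. \<Sum>j<length S. ?c i * ?c j * energy (2 * H - 2) t (?I i) (?I j))"
  proof -
    have "energy (2 * H - 2) t (step_fun S) (step_fun S) =
       (\<Sum>i<length S. ?c i * energy (2 * H - 2) t (?I i) (step_fun S))"
      unfolding step_fun_sum[of S]
      by (subst energy_sum_left[OF b t]) (simp_all only: energy_cmult_left bb)
    also have "\<dots> = (\<Sum>i<length S. ?c i * energy (2 * H - 2) t (step_fun S) (?I i))"
      by (subst energy_commute[OF b t]) (simp_all only: bb bounded_borel_upto_step_fun)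
    also have "\<dots> = (\<Sum>i<length S. ?c i * (\<Sum>j<length S. ?c j * energy (2 * H - 2) t (?I j) (?I i)))"
      unfolding step_fun_sum[of S]
      by (subst energy_sum_left[OF b t]) (simp_all only: energy_cmult_left bb)
    also have "\<dots> = (\<Sum>i<length S. \<Sum>j<length S. ?c i * ?c j * energy (2 * H - 2) t (?I i) (?I j))"
      unfolding sum_distrib_left
      by (subst energy_commute[OF b t]) (simp_all only: bb mult.assoc)
    finally show ?thesis .
  qed
  moreover have "(LINT \<omega>|\<Omega>. (step_integral W S \<omega>)\<^sup>2) =
      (\<Sum>i<length S. \<Sum>j<length S. ?c i * ?c j * (LINT \<omega>|\<Omega>. ?D i \<omega> * ?D j \<omega>))"
  proof -
    have i: "integrable \<Omega> (\<lambda>\<omega>. ?c i * ?c j * (?D i \<omega> * ?D j \<omega>))" if "i \<in> {..<length S}" "j \<in> {..<length S}" for i j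
      using iD[of i j] that by (intro integrable_mult_right) simp
    have "(LINT \<omega>|\<Omega>. (step_integral W S \<omega>)\<^sup>2) =
        (\<Sum>i<length S. LINT \<omega>|\<Omega>. (\<Sum>j<length S. ?c i * ?c j * (?D i \<omega> * ?D j \<omega>)))"
      unfolding sq by (intro Bochner_Integration.integral_sum Bochner_Integration.integrable_sum i)
    also have "\<dots> = (\<Sum>i<length S. \<Sum>j<length S. LINT \<omega>|\<Omega>. ?c i * ?c j * (?D i \<omega> * ?D j \<omega>))"
      by (intro sum.cong refl Bochner_Integration.integral_sum i)
    finally show ?thesis by (simp only: integral_mult_right_zero)
  qed
  ultimately show "(LINT \<omega>|\<Omega>. (step_integral W S \<omega>)\<^sup>2) =
      H * (2 * H - 1) * energy (2 * H - 2) t (step_fun S) (step_fun S)"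
    using eD by (simp add: sum_distrib_left mult.left_commute)
qed

text \<open>\<open>has_wiener_integral\<close> only provides a mean-square limit, so the isometry
  has to be derived. The second moments of the approximations converge both to that of
  \<open>X\<close>, by mean-square convergence, and to the energy of \<open>g\<close>, by
  \<open>energy_tendsto\<close>.\<close>

lemma wiener_integral_moments:
  assumes W: "fractional_brownian_motion \<Omega> H W" and H: "1 / 2 < H" "H < 1" and t: "t \<ge> 0"
    and X: "has_wiener_integral \<Omega> H W g t X" and g: "bounded_borel_upto t g"
  shows "integrable \<Omega> X" "(LINT \<omega>|\<Omega>. X \<omega>) = 0"
    and "(LINT \<omega>|\<Omega>. (X \<omega>)\<^sup>2) = H * (2 * H - 1) * energy (2 * H - 2) t g g"
proof -
  interpret prob_space \<Omega> using W by (simp add: fractional_brownian_motion_def)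
  have Xm[measurable]: "X \<in> borel_measurable \<Omega>" and X2: "integrable \<Omega> (\<lambda>\<omega>. (X \<omega>)\<^sup>2)"
    using X by (auto simp: has_wiener_integral_def)
  obtain p S where p: "p > 1 / H" and S: "\<And>n. steps_in t (S n)"
    and lim: "(\<lambda>n. LINT u:{0..t}|lborel. \<bar>step_fun (S n) u - g u\<bar> powr p) \<longlonglongrightarrow> 0"
    and lim2: "(\<lambda>n. LINT \<omega>|\<Omega>. (step_integral W (S n) \<omega> - X \<omega>)\<^sup>2) \<longlonglongrightarrow> 0"
    using X unfolding has_wiener_integral_def by blast
  let ?Y = "\<lambda>n. step_integral W (S n)"
  note m = step_integral_moments[OF W H t S]
  have [measurable]: "?Y n \<in> borel_measurable \<Omega>" for n using m(1)[of n] by simp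
  show X1: "integrable \<Omega> X"
    using integrable_mult_square[of X \<Omega> "\<lambda>_. 1"] X2 by simp
  have YX: "integrable \<Omega> (\<lambda>\<omega>. ?Y n \<omega> * X \<omega>)" for n
    by (rule integrable_mult_square) (use m(3) X2 in auto)
  have d2: "integrable \<Omega> (\<lambda>\<omega>. (?Y n \<omega> - X \<omega>)\<^sup>2)" for n
    unfolding power2_diff using m(3)[of n] X2 YX[of n] by (simp add: mult.assoc)
  \<comment> \<open>The weight \<open>\<mu>\<close> goes to the factor that stays bounded, and
    \<open>1 / \<mu>\<close> to the difference that tends to 0.\<close>
  have young: "2 * \<bar>x * y\<bar> \<le> 1 / \<mu> * x\<^sup>2 + \<mu> * y\<^sup>2" if "\<mu> > 0" for x y \<mu> :: real
  proof -
    have "2 * (\<bar>x\<bar> / sqrt \<mu>) * (\<bar>y\<bar> * sqrt \<mu>) \<le> (\<bar>x\<bar> / sqrt \<mu>)\<^sup>2 + (\<bar>y\<bar> * sqrt \<mu>)\<^sup>2"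
      by (rule sum_squares_bound)
    then show ?thesis using that by (simp add: abs_mult power_divide power_mult_distrib mult.commute mult.left_commute)
  qed
  have half: "\<bar>x\<bar> \<le> y" if "2 * \<bar>x\<bar> \<le> y" for x y :: real
    using that by linarith
  \<comment> \<open>The constant sequence consists of the means of the step integrals, all of which
    vanish.\<close>
  have "(\<lambda>n. 0) \<longlonglongrightarrow> (LINT \<omega>|\<Omega>. X \<omega>)"
  proof (rule tendsto_of_trade_off[OF lim2, where K=1 and c="\<lambda>\<mu>. 1 / \<mu>"])
    fix \<mu> :: real and n assume \<mu>: "\<mu> > 0"
    have "0 - (LINT \<omega>|\<Omega>. X \<omega>) = (LINT \<omega>|\<Omega>. ?Y n \<omega> - X \<omega>)"
      using m(1,2)[of n] X1 by simp
    also have "\<bar>\<dots>\<bar> \<le> (LINT \<omega>|\<Omega>. 1 / \<mu> * (?Y n \<omega> - X \<omega>)\<^sup>2 + \<mu>)"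
    proof (rule abs_integral_le)
      fix \<omega>
      show "\<bar>?Y n \<omega> - X \<omega>\<bar> \<le> 1 / \<mu> * (?Y n \<omega> - X \<omega>)\<^sup>2 + \<mu>"
        using young[OF \<mu>, of "?Y n \<omega> - X \<omega>" 1] half unfolding mult_1_right power_one by blast
    qed (use m(1)[of n] X1 d2[of n] in auto)
    also have "\<dots> = 1 / \<mu> * (LINT \<omega>|\<Omega>. (?Y n \<omega> - X \<omega>)\<^sup>2) + \<mu> * 1"
      using d2[of n] by (simp add: prob_space)
    finally show "\<bar>0 - (LINT \<omega>|\<Omega>. X \<omega>)\<bar> \<le> 1 / \<mu> * (LINT \<omega>|\<Omega>. (?Y n \<omega> - X \<omega>)\<^sup>2) + \<mu> * 1".
  qed simp
  then show "(LINT \<omega>|\<Omega>. X \<omega>) = 0"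
    using LIMSEQ_unique tendsto_const by blast
  have "(\<lambda>n. LINT \<omega>|\<Omega>. (?Y n \<omega>)\<^sup>2) \<longlonglongrightarrow> (LINT \<omega>|\<Omega>. (X \<omega>)\<^sup>2)"
  proof (rule tendsto_of_trade_off[OF lim2, where K="LINT \<omega>|\<Omega>. (X \<omega>)\<^sup>2" and c="\<lambda>\<mu>. 1 + 1 / \<mu>"])
    fix \<mu> :: real and n assume \<mu>: "\<mu> > 0"
    have "(LINT \<omega>|\<Omega>. (?Y n \<omega>)\<^sup>2) - (LINT \<omega>|\<Omega>. (X \<omega>)\<^sup>2) = (LINT \<omega>|\<Omega>. (?Y n \<omega>)\<^sup>2 - (X \<omega>)\<^sup>2)"
      using m(3)[of n] X2 by simp
    also have "\<bar>\<dots>\<bar> \<le> (LINT \<omega>|\<Omega>. (1 + 1 / \<mu>) * (?Y n \<omega> - X \<omega>)\<^sup>2 + \<mu> * (X \<omega>)\<^sup>2)"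
    proof (rule abs_integral_le)
      fix \<omega>
      have "(?Y n \<omega>)\<^sup>2 - (X \<omega>)\<^sup>2 = (?Y n \<omega> - X \<omega>)\<^sup>2 + 2 * ((?Y n \<omega> - X \<omega>) * X \<omega>)"
        by (simp add: power2_eq_square algebra_simps)
      also have "\<bar>\<dots>\<bar> \<le> (?Y n \<omega> - X \<omega>)\<^sup>2 + 2 * \<bar>(?Y n \<omega> - X \<omega>) * X \<omega>\<bar>"
        by (rule order_trans[OF abs_triangle_ineq]) (simp add: abs_mult)
      also have "\<dots> \<le> (?Y n \<omega> - X \<omega>)\<^sup>2 + (1 / \<mu> * (?Y n \<omega> - X \<omega>)\<^sup>2 + \<mu> * (X \<omega>)\<^sup>2)"
        using young[OF \<mu>, of "?Y n \<omega> - X \<omega>" "X \<omega>"] by (intro add_left_mono)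
      finally show "\<bar>(?Y n \<omega>)\<^sup>2 - (X \<omega>)\<^sup>2\<bar> \<le> (1 + 1 / \<mu>) * (?Y n \<omega> - X \<omega>)\<^sup>2 + \<mu> * (X \<omega>)\<^sup>2"
        by (simp add: distrib_right)
    qed (use m(3)[of n] X2 d2[of n] in auto)
    also have "\<dots> = (1 + 1 / \<mu>) * (LINT \<omega>|\<Omega>. (?Y n \<omega> - X \<omega>)\<^sup>2) + \<mu> * (LINT \<omega>|\<Omega>. (X \<omega>)\<^sup>2)"
      using d2[of n] X2 by simp
    finally show "\<bar>(LINT \<omega>|\<Omega>. (?Y n \<omega>)\<^sup>2) - (LINT \<omega>|\<Omega>. (X \<omega>)\<^sup>2)\<bar>
        \<le> (1 + 1 / \<mu>) * (LINT \<omega>|\<Omega>. (?Y n \<omega> - X \<omega>)\<^sup>2) + \<mu> * (LINT \<omega>|\<Omega>. (X \<omega>)\<^sup>2)".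
  qed simp
  moreover have "(\<lambda>n. LINT \<omega>|\<Omega>. (?Y n \<omega>)\<^sup>2) \<longlonglongrightarrow> H * (2 * H - 1) * energy (2 * H - 2) t g g"
    unfolding m(4)
  proof (intro tendsto_mult tendsto_const energy_tendsto)
    show "(\<lambda>n. \<integral>u. \<bar>step_fun (S n) u - g u\<bar> powr p \<partial>lborel_upto t) \<longlonglongrightarrow> 0"
      using lim by (simp add: set_integral_eq_upto)
  qed (use H t p g bounded_borel_upto_step_fun in auto)
  ultimately show "(LINT \<omega>|\<Omega>. (X \<omega>)\<^sup>2) = H * (2 * H - 1) * energy (2 * H - 2) t g g"
    by (rule LIMSEQ_unique)
qed

section \<open>Derivative of the renormalised variance\<close>

lemma energy_cong:
  assumes "\<And>u. u \<in> {0..t} \<Longrightarrow> f u = f' u" "\<And>u. u \<in> {0..t} \<Longrightarrow> g u = g' u"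
  shows "energy b t f g = energy b t f' g'"
  unfolding energy_def
  by (intro Bochner_Integration.integral_cong) (auto simp: space_pair_measure space_restrict_space assms)

text \<open>By symmetry the square contributes twice its half \<open>u < v\<close>. In this form
  \<open>t\<close> occurs only as the upper limit of the outer integral, so no differentiation under
  a singular integral is needed.\<close>

lemma energy_eq_iterated_below_diagonal:
  assumes b: "b > -1" and t: "t \<ge> 0" and G: "bounded_borel_upto t G"
  shows "energy b t G G =
    2 * (LINT v:{0..t}|lborel. G v * (LINT u:{0..v}|lborel. G u * (v - u) powr b))"
proof -
  let ?M = "lborel_upto t \<Otimes>\<^sub>M lborel_upto t"
  let ?k = "\<lambda>z. G (fst z) * G (snd z) * \<bar>fst z - snd z\<bar> powr b"
  obtain C where [measurable]: "G \<in> borel_measurable (lborel_upto t)" and C: "C \<ge> 0" "\<forall>u\<in>{0..t}. \<bar>G u\<bar> \<le> C"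
    using G by (rule bounded_borel_uptoE)
  have ik: "integrable ?M ?k" by (rule energy_integrable'[OF b t G G])
  define L where "L z = (if fst z < snd z then ?k z else 0)" for z
  note [measurable] = measurable_upto_borel
  have Lm: "L \<in> borel_measurable ?M" unfolding L_def by measurable
  have iL: "integrable ?M L"
    by (rule Bochner_Integration.integrable_bound[OF ik Lm]) (auto simp: L_def)
  have iL': "integrable ?M (\<lambda>(x, y). L (y, x))"
    by (rule upto.integrable_product_swap[OF iL])
  \<comment> \<open>The two halves add up to the integrand at every point: on the diagonal they
    vanish, and so does the kernel, because \<open>0 powr b = 0\<close>.\<close>
  have "energy b t G G = (\<integral>z. L z + (case z of (x, y) \<Rightarrow> L (y, x)) \<partial>?M)"
    unfolding energy_def
    by (intro Bochner_Integration.integral_cong) (auto simp: L_def abs_minus_commute mult.commute)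
  also have "\<dots> = (\<integral>z. L z \<partial>?M) + (\<integral>z. L z \<partial>?M)"
    using upto.integral_product_swap[OF Lm] iL iL' by simp
  also have "(\<integral>z. L z \<partial>?M) = (\<integral>v. (\<integral>u. L (u, v) \<partial>lborel_upto t) \<partial>lborel_upto t)"
    using upto.integral_snd[of t "\<lambda>u v. L (u, v)"] iL by simp
  also have "\<dots> = (LINT v:{0..t}|lborel. G v * (LINT u:{0..v}|lborel. G u * (v - u) powr b))"
    unfolding set_integral_eq_upto[symmetric]
  proof (rule set_lebesgue_integral_cong)
    show "\<forall>v. v \<in> {0..t} \<longrightarrow> (LINT u:{0..t}|lborel. L (u, v)) =
        G v * (LINT u:{0..v}|lborel. G u * (v - u) powr b)"
      unfolding set_lebesgue_integral_def
      by (auto simp: L_def indicator_def simp flip: integral_mult_right_zero intro!: Bochner_Integration.integral_cong)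
  qed auto
  finally show ?thesis by simp
qed

text \<open>The substitution \<open>s = v - u\<close> fixes the singularity at \<open>s = 0\<close>
  and moves \<open>v\<close> into the continuous factor and the upper limit; dominated convergence
  then applies. The result supplies the continuous integrand for the fundamental theorem in the
  derivative of the energy.\<close>

lemma continuous_on_powr_convolution:
  fixes G :: "real \<Rightarrow> real"
  assumes b: "b > -1" and G: "continuous_on {0..} G"
  shows "continuous_on {0..} (\<lambda>v. LINT u:{0..v}|lborel. G u * (v - u) powr b)"
proof -
  \<comment> \<open>Constant extension of \<open>G\<close> to the left, so that
    \<open>E (v - s)\<close> is continuous and measurable also for \<open>s > v\<close>.\<close>
  define E where "E x = G (max 0 x)" for x
  have E: "continuous_on UNIV E"
    unfolding E_def by (intro continuous_on_compose2[OF G] continuous_intros) auto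
  have [measurable]: "E \<in> borel_measurable borel"
    using E by (rule borel_measurable_continuous_onI)
  define P where "P v = (\<integral>s. indicator {0..v} s * (E (v - s) * \<bar>s\<bar> powr b) \<partial>lborel)" for v
  have P: "(LINT u:{0..v}|lborel. G u * (v - u) powr b) = P v" if "v \<ge> 0" for v
  proof -
    have "(LINT u:{0..v}|lborel. G u * (v - u) powr b) =
        \<bar>-1\<bar> *\<^sub>R (\<integral>s. indicator {0..v} (v + (-1) * s) *\<^sub>R (G (v + (-1) * s) * (v - (v + (-1) * s)) powr b) \<partial>lborel)"
      unfolding set_lebesgue_integral_def by (rule lborel_integral_real_affine) simp
    also have "\<dots> = P v"
      unfolding P_def using that
      by (auto simp: E_def indicator_def intro!: Bochner_Integration.integral_cong)
    finally show ?thesis .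
  qed
  have "continuous_on {0..} P"
  proof (rule continuous_on_sequentiallyI)
    fix x :: "nat \<Rightarrow> real" and a assume a: "a \<in> {0..}" and x: "\<forall>n. x n \<in> {0..}" and lim: "x \<longlonglongrightarrow> a"
    have "Bseq x" using lim by (meson convergentI convergent_imp_Bseq)
    then obtain V where "V > 0" "\<forall>n. norm (x n) \<le> V" by (auto simp: Bseq_def)
    then have V: "V > 0" "\<And>n. x n \<le> V" by (auto simp: abs_le_iff)
    have "compact (E ` {0..V})" using E by (intro compact_continuous_image) (auto intro: continuous_on_subset)
    then obtain C where C: "\<forall>y\<in>{0..V}. \<bar>E y\<bar> \<le> C"
      using compact_imp_bounded by (fastforce simp: bounded_iff)
    show "(\<lambda>n. P (x n)) \<longlonglongrightarrow> P a"
      unfolding P_def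
    proof (rule integral_dominated_convergence)
      have "set_integrable lborel {0..V} (\<lambda>s. \<bar>s - 0\<bar> powr b)"
        using V by (intro abs_powr_integral(1) b) simp
      then show "integrable lborel (\<lambda>s. C * (indicator {0..V} s * \<bar>s\<bar> powr b))"
        by (simp add: set_integrable_def)
      show "AE s in lborel. (\<lambda>n. indicator {0..x n} s * (E (x n - s) * \<bar>s\<bar> powr b))
          \<longlonglongrightarrow> indicator {0..a} s * (E (a - s) * \<bar>s\<bar> powr b)"
        \<comment> \<open>At \<open>s = a\<close> the indicators of \<open>{0..x n}\<close> need not
          converge; this one point is discarded.\<close>
        using AE_lborel_singleton[of a]
      proof eventually_elim
        case (elim s)
        have "(\<lambda>n. E (x n - s)) \<longlonglongrightarrow> E (a - s)"
          using E lim by (intro continuous_on_tendsto_compose[OF E] tendsto_intros) auto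
        moreover have "(\<lambda>n. indicator {0..x n} s :: real) \<longlonglongrightarrow> indicator {0..a} s"
        proof (rule tendsto_eventually)
          have "\<forall>\<^sub>F n in sequentially. s < x n" if "s < a" using order_tendstoD(1)[OF lim that] .
          moreover have "\<forall>\<^sub>F n in sequentially. x n < s" if "a < s" using order_tendstoD(2)[OF lim that] .
          ultimately have "\<forall>\<^sub>F n in sequentially. (s < a \<longrightarrow> s < x n) \<and> (a < s \<longrightarrow> x n < s)"
            by (cases "s < a"; cases "a < s") auto
          then show "\<forall>\<^sub>F n in sequentially. indicator {0..x n} s = (indicator {0..a} s :: real)"
            by eventually_elim (use elim in \<open>auto simp: indicator_def\<close>)
        qed
        ultimately show ?case by (intro tendsto_intros)
      qed
      fix n
      show "AE s in lborel. norm (indicator {0..x n} s * (E (x n - s) * \<bar>s\<bar> powr b))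
          \<le> C * (indicator {0..V} s * \<bar>s\<bar> powr b)"
      proof (rule AE_I2)
        fix s
        show "norm (indicator {0..x n} s * (E (x n - s) * \<bar>s\<bar> powr b)) \<le> C * (indicator {0..V} s * \<bar>s\<bar> powr b)"
        proof (cases "s \<in> {0..x n}")
          case True
          then have "x n - s \<in> {0..V}" "s \<in> {0..V}" using V(2)[of n] by auto
          then show ?thesis using True C by (simp add: abs_mult mult_right_mono)
        next
          case False
          have "0 \<le> C" using C V(1) abs_ge_zero[of "E 0"] by fastforce
          then show ?thesis using False by simp
        qed
      qed
    qed measurable
  qed
  then show ?thesis
    by (rule continuous_on_eq) (simp add: P)
qed

lemma has_real_derivative_cong_on:
  fixes f g :: "real \<Rightarrow> real"
  assumes "(f has_real_derivative D) (at x within S)" "x \<in> S" "\<And>y. y \<in> S \<Longrightarrow> f y = g y"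
  shows "(g has_real_derivative D) (at x within S)"
  by (rule has_field_derivative_transform_within[OF assms(1), of 1]) (use assms in auto)

lemma set_integral_has_real_derivative:
  fixes f :: "real \<Rightarrow> real"
  assumes f: "continuous_on {c..} f" and t: "c \<le> t"
  shows "((\<lambda>t. LINT v:{c..t}|lborel. f v) has_real_derivative f t) (at t within {c..})"
proof -
  have ct: "continuous_on {c..x} f" for x using f by (rule continuous_on_subset) auto
  have eq: "(LINT v:{c..x}|lborel. f v) = integral {c..x} f" for x
    by (intro set_borel_integral_eq_integral(2) borel_integrable_atLeastAtMost' ct)
  \<comment> \<open>With the interval ending at \<open>t + 1\<close>, the point \<open>t\<close> is
    not its right end, so near \<open>t\<close> the interval coincides with
    \<open>{c..}\<close>.\<close>
  have "((\<lambda>x. integral {c..x} f) has_real_derivative f t) (at t within {c..t + 1})"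
    by (intro integral_has_real_derivative ct) (use t in auto)
  moreover have "at t within {c..t + 1} = at t within {c..}"
    by (rule at_within_nhd[of _ "{..<t + 1}"]) auto
  ultimately show ?thesis by (simp add: eq)
qed

lemma energy_has_real_derivative:
  assumes b: "b > -1" and G: "continuous_on {0..} G" and t: "t \<ge> 0"
  shows "((\<lambda>t. energy b t G G) has_real_derivative
    2 * G t * (LINT u:{0..t}|lborel. G u * (t - u) powr b)) (at t within {0..})"
proof -
  let ?f = "\<lambda>v. G v * (LINT u:{0..v}|lborel. G u * (v - u) powr b)"
  have "continuous_on {0..} ?f"
    by (intro continuous_intros G continuous_on_powr_convolution b)
  from DERIV_cmult[OF set_integral_has_real_derivative[OF this t], of 2]
  have "((\<lambda>t. 2 * (LINT v:{0..t}|lborel. ?f v)) has_real_derivative 2 * ?f t) (at t within {0..})" .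
  then show ?thesis
    unfolding mult.assoc
  proof (rule has_real_derivative_cong_on)
    fix x :: real assume "x \<in> {0..}"
    then show "2 * (LINT v:{0..x}|lborel. ?f v) = energy b x G G"
      using energy_eq_iterated_below_diagonal[OF b, of x G] bounded_borel_upto_continuous[of x G]
        continuous_on_subset[OF G, of "{0..x}"] by auto
  qed (use t in simp)
qed

lemma alpha_eq_diff:
  assumes a: "continuous_on {0..} a" and u: "0 \<le> u" "u \<le> t"
  shows "alpha a t u = (LINT r:{0..t}|lborel. a r) - (LINT r:{0..u}|lborel. a r)"
proof -
  have c: "continuous_on {x..y} a" if "x \<ge> 0" for x y using a that by (elim continuous_on_subset) auto
  have i: "set_integrable lborel {x..y} a" if "x \<ge> 0" for x y
    using c[OF that] by (rule borel_integrable_atLeastAtMost')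
  have "alpha a t u = integral {u..t} a"
    unfolding alpha_def using u by (intro interval_integral_eq_integral i)
  also have "\<dots> = integral {0..t} a - integral {0..u} a"
    using Henstock_Kurzweil_Integration.integral_combine[of 0 u t a] u
      set_borel_integral_eq_integral(1)[OF i[of 0 t]] by simp
  finally show ?thesis
    using set_borel_integral_eq_integral(2)[OF i[of 0]] by simp
qed

lemma renorm_variance_eq_energy:
  assumes H: "1 / 2 < H" and t: "t \<ge> 0"
    and g: "bounded_borel_upto t (\<lambda>u. exp (alpha a t u / \<epsilon>) * F u)"
  shows "renorm_variance H a F \<epsilon> t = 1 / \<epsilon> powr (2 * H) * (H * (2 * H - 1)) *
    energy (2 * H - 2) t (\<lambda>u. exp (alpha a t u / \<epsilon>) * F u) (\<lambda>u. exp (alpha a t u / \<epsilon>) * F u)"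
proof -
  have "exp (alpha a t u / \<epsilon>) * exp (alpha a t v / \<epsilon>) * F u * F v * (H * (2 * H - 1)) * k
    = (H * (2 * H - 1)) * ((exp (alpha a t u / \<epsilon>) * F u) * (exp (alpha a t v / \<epsilon>) * F v) * k)" for u v k
    by simp
  then show ?thesis
    unfolding renorm_variance_def energy_iterated[OF _ t g g, of "2 * H - 2"]
    using H by (simp only: set_integral_mult_right) (subst energy_iterated[OF _ t g g], auto)
qed

lemma renorm_variance_eq_energy_exp:
  fixes \<epsilon> :: real
  assumes H: "1 / 2 < H" and a: "continuous_on {0..} a" and F: "continuous_on {0..} F" and t: "t \<ge> 0"
  defines "A \<equiv> \<lambda>t. LINT r:{0..t}|lborel. a r"
  defines "G \<equiv> \<lambda>u. exp (- A u / \<epsilon>) * F u"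
  shows "continuous_on {0..} G" "bounded_borel_upto t (\<lambda>u. exp (alpha a t u / \<epsilon>) * F u)"
    and "renorm_variance H a F \<epsilon> t =
      1 / \<epsilon> powr (2 * H) * (H * (2 * H - 1)) * ((exp (A t / \<epsilon>))\<^sup>2 * energy (2 * H - 2) t G G)"
proof -
  let ?g = "\<lambda>u. exp (alpha a t u / \<epsilon>) * F u"
  have A: "continuous_on {0..} A"
    unfolding A_def continuous_on_eq_continuous_within
    using set_integral_has_real_derivative[OF a] DERIV_continuous by fastforce
  then show G: "continuous_on {0..} G"
    unfolding G_def by (cases "\<epsilon> = 0") (simp_all add: F A continuous_intros)
  have g: "?g u = exp (A t / \<epsilon>) * G u" if "u \<in> {0..t}" for u
  proof -
    have "alpha a t u / \<epsilon> = A t / \<epsilon> + - A u / \<epsilon>"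
      using alpha_eq_diff[OF a, of u t] that by (simp add: A_def diff_divide_distrib)
    then show ?thesis by (simp only: exp_add G_def mult.assoc)
  qed
  have "continuous_on {0..t} (\<lambda>u. exp (A t / \<epsilon>) * G u)"
    by (intro continuous_intros continuous_on_subset[OF G]) auto
  then have "continuous_on {0..t} ?g" by (rule continuous_on_eq) (simp add: g)
  then show gb: "bounded_borel_upto t ?g" by (rule bounded_borel_upto_continuous)
  have "energy (2 * H - 2) t ?g ?g = energy (2 * H - 2) t (\<lambda>u. exp (A t / \<epsilon>) * G u) (\<lambda>u. exp (A t / \<epsilon>) * G u)"
    by (intro energy_cong g)
  also have "\<dots> = (exp (A t / \<epsilon>))\<^sup>2 * energy (2 * H - 2) t G G"
    by (simp add: energy_def power2_eq_square mult_ac flip: integral_mult_right_zero)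
  finally show "renorm_variance H a F \<epsilon> t =
      1 / \<epsilon> powr (2 * H) * (H * (2 * H - 1)) * ((exp (A t / \<epsilon>))\<^sup>2 * energy (2 * H - 2) t G G)"
    using renorm_variance_eq_energy[OF H t gb] by simp
qed

text \<open>The product rule separates the two terms of the equation: the derivative of the squared
  exponential prefactor gives \<open>2 * a t\<close> times the variance, and the derivative of the
  energy of the \<open>t\<close>-independent \<open>G\<close> gives the forcing.\<close>

theorem renorm_variance_solves_ode:
  assumes H: "1 / 2 < H" and a: "continuous_on {0..} a" and F: "continuous_on {0..} F" and \<epsilon>: "\<epsilon> > 0"
  shows "solves_variance_ode H a F \<epsilon> 0 (renorm_variance H a F \<epsilon>)"
  unfolding solves_variance_ode_def
proof (intro allI impI)
  fix t :: real assume t: "t \<ge> 0"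
  define A where "A t = (LINT r:{0..t}|lborel. a r)" for t
  define G where "G u = exp (- A u / \<epsilon>) * F u" for u
  define K where "K = 1 / \<epsilon> powr (2 * H) * (H * (2 * H - 1))"
  have w: "renorm_variance H a F \<epsilon> t = K * ((exp (A t / \<epsilon>))\<^sup>2 * energy (2 * H - 2) t G G)" if "t \<ge> 0" for t
    unfolding K_def A_def G_def by (rule renorm_variance_eq_energy_exp[OF H a F that])
  have G: "continuous_on {0..} G"
    unfolding G_def A_def by (rule renorm_variance_eq_energy_exp[OF H a F t])
  let ?J = "LINT u:{0..t}|lborel. G u * (t - u) powr (2 * H - 2)"
  let ?w' = "K * ((exp (A t / \<epsilon>))\<^sup>2 * (2 * G t * ?J) + 2 * exp (A t / \<epsilon>) * (exp (A t / \<epsilon>) * (a t / \<epsilon>)) * energy (2 * H - 2) t G G)"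
  have A': "(A has_real_derivative a t) (at t within {0..})"
    unfolding A_def using set_integral_has_real_derivative[OF a t] .
  have E': "((\<lambda>t. energy (2 * H - 2) t G G) has_real_derivative 2 * G t * ?J) (at t within {0..})"
    using energy_has_real_derivative[OF _ G t, of "2 * H - 2"] H by simp
  have "((\<lambda>t. K * ((exp (A t / \<epsilon>))\<^sup>2 * energy (2 * H - 2) t G G)) has_real_derivative ?w') (at t within {0..})"
  proof -
    have "((\<lambda>t. exp (A t / \<epsilon>)) has_real_derivative exp (A t / \<epsilon>) * (a t / \<epsilon>)) (at t within {0..})"
      by (rule DERIV_chain2[OF DERIV_exp DERIV_cdivide[OF A']])
    from DERIV_cmult[OF DERIV_mult[OF DERIV_power[OF this, of 2] E'], of K] show ?thesis
      by (rule DERIV_cong) (simp add: algebra_simps)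
  qed
  then have D: "(renorm_variance H a F \<epsilon> has_real_derivative ?w') (at t within {0..})"
    by (rule has_real_derivative_cong_on) (use t in \<open>auto simp: w\<close>)
  have "(LINT u:{0..t}|lborel. 1 / \<epsilon> powr (2 * H - 1) * exp (alpha a t u / \<epsilon>) * F u * (t - u) powr (2 * H - 2))
    = (LINT u:{0..t}|lborel. (1 / \<epsilon> powr (2 * H - 1) * exp (A t / \<epsilon>)) * (G u * (t - u) powr (2 * H - 2)))"
  proof (rule set_lebesgue_integral_cong)
    show "\<forall>u. u \<in> {0..t} \<longrightarrow> 1 / \<epsilon> powr (2 * H - 1) * exp (alpha a t u / \<epsilon>) * F u * (t - u) powr (2 * H - 2)
      = (1 / \<epsilon> powr (2 * H - 1) * exp (A t / \<epsilon>)) * (G u * (t - u) powr (2 * H - 2))"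
    proof (intro allI impI)
      fix u assume "u \<in> {0..t}"
      then have "alpha a t u / \<epsilon> = A t / \<epsilon> + - A u / \<epsilon>"
        using alpha_eq_diff[OF a, of u t] by (simp add: A_def diff_divide_distrib)
      then show "1 / \<epsilon> powr (2 * H - 1) * exp (alpha a t u / \<epsilon>) * F u * (t - u) powr (2 * H - 2)
          = (1 / \<epsilon> powr (2 * H - 1) * exp (A t / \<epsilon>)) * (G u * (t - u) powr (2 * H - 2))"
        by (simp only: exp_add G_def mult.assoc)
    qed
  qed simp
  also have "\<dots> = 1 / \<epsilon> powr (2 * H - 1) * exp (A t / \<epsilon>) * ?J" by simp
  finally have J: "(LINT u:{0..t}|lborel. 1 / \<epsilon> powr (2 * H - 1) * exp (alpha a t u / \<epsilon>) * F u * (t - u) powr (2 * H - 2))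
    = 1 / \<epsilon> powr (2 * H - 1) * exp (A t / \<epsilon>) * ?J" .
  \<comment> \<open>Multiplying the derivative by \<open>\<epsilon>\<close> uses up one factor of
    \<open>\<epsilon> powr (2 * H)\<close>. One of the two exponential factors recombines with
    \<open>G t\<close> to \<open>F t\<close>, the other completes the forcing integral.\<close>
  have eps: "\<epsilon> powr (2 * H) = \<epsilon> * \<epsilon> powr (2 * H - 1)"
    using \<epsilon> by (simp add: powr_diff)
  have FG: "exp (A t / \<epsilon>) * G t = F t"
    by (simp add: G_def mult.assoc[symmetric] mult_exp_exp)
  have "\<epsilon> * ?w' = 2 * a t * (K * ((exp (A t / \<epsilon>))\<^sup>2 * energy (2 * H - 2) t G G))
      + \<epsilon> * K * exp (A t / \<epsilon>) * (2 * (exp (A t / \<epsilon>) * G t) * ?J)"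
    using \<epsilon> by (simp add: power2_eq_square algebra_simps)
  also have "\<dots> = 2 * a t * renorm_variance H a F \<epsilon> t + 2 * F t * (H * (2 * H - 1)) *
      (1 / \<epsilon> powr (2 * H - 1) * exp (A t / \<epsilon>) * ?J)"
    unfolding FG w[OF t] using \<epsilon> by (simp add: K_def eps)
  finally show "\<exists>z'. (renorm_variance H a F \<epsilon> has_real_derivative z') (at t within {0..}) \<and>
      \<epsilon> * z' = 2 * a t * renorm_variance H a F \<epsilon> t + 2 * F t * (H * (2 * H - 1)) *
        (LINT u:{0..t}|lborel. 1 / \<epsilon> powr (2 * H - 1) * exp (alpha a t u / \<epsilon>) * F u * (t - u) powr (2 * H - 2))"
    using D J by auto
qed

section \<open>The linear variance equation\<close>

text \<open>Derivatives within \<open>S\<close> are only one-sided at time 0; the mean value theorem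
  tolerates this at an end point.\<close>

lemma real_mvt_within:
  fixes f f' :: "real \<Rightarrow> real"
  assumes "x \<le> y" "{x..y} \<subseteq> S" "\<And>s. s \<in> {x..y} \<Longrightarrow> (f has_real_derivative f' s) (at s within S)"
  shows "\<exists>s\<in>{x..y}. f y - f x = f' s * (y - x)"
proof (cases "x = y")
  case False
  then have "\<exists>s\<in>{x<..<y}. f y - f x = (\<lambda>s h. f' s * h) s (y - x)"
    using assms by (intro mvt_simple) (auto simp: has_field_derivative_def intro: has_derivative_subset)
  then show ?thesis by auto
qed auto

text \<open>With \<open>m s = exp (- 2 * A s / \<epsilon>)\<close> the functions \<open>m * (\<plusminus> d - R / (2 * a0))\<close> are nonincreasing.\<close>

lemma linear_ode_bound:
  fixes A a d d' r :: "real \<Rightarrow> real"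
  assumes eps: "\<epsilon> > 0" and a0: "a0 > 0" and R: "R \<ge> 0" and st: "s \<le> t" "{s..t} \<subseteq> S"
    and A: "\<And>x. x \<in> {s..t} \<Longrightarrow> (A has_real_derivative a x) (at x within S)"
    and a: "\<And>x. x \<in> {s..t} \<Longrightarrow> a x \<le> - a0"
    and d: "\<And>x. x \<in> {s..t} \<Longrightarrow> (d has_real_derivative d' x) (at x within S)"
    and ode: "\<And>x. x \<in> {s..t} \<Longrightarrow> \<epsilon> * d' x = 2 * a x * d x + r x"
    and r: "\<And>x. x \<in> {s..t} \<Longrightarrow> \<bar>r x\<bar> \<le> R"
  shows "\<bar>d t\<bar> \<le> \<bar>d s\<bar> * exp (- 2 * a0 * (t - s) / \<epsilon>) + R / (2 * a0)"
proof -
  define m where "m x = exp (- 2 * A x / \<epsilon>)" for x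
  \<comment> \<open>The equilibrium of the worst case \<open>a = - a0\<close>, \<open>r = R\<close>,
    hence a constant upper barrier. Applying the monotonicity argument with both signs below turns
    it into a bound on the absolute value.\<close>
  define K where "K = R / (2 * a0)"
  have K: "K \<ge> 0" "2 * a0 * K = R" using R a0 by (auto simp: K_def)
  have m': "(m has_real_derivative m x * (- 2 * a x / \<epsilon>)) (at x within S)" if "x \<in> {s..t}" for x
    unfolding m_def by (rule DERIV_chain2[OF DERIV_exp DERIV_cdivide[OF DERIV_cmult[OF A[OF that]]]])
  have *: "m t * (\<sigma> * d t - K) \<le> m s * (\<sigma> * d s - K)" if \<sigma>: "\<bar>\<sigma>\<bar> = 1" for \<sigma> :: real
  proof -
    have "((\<lambda>x. m x * (\<sigma> * d x - K)) has_real_derivative m x / \<epsilon> * (2 * a x * K + \<sigma> * r x)) (at x within S)"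
      if "x \<in> {s..t}" for x
    proof -
      have d': "d' x = (2 * a x * d x + r x) / \<epsilon>" using ode[OF that] eps by (simp add: field_simps)
      have "((\<lambda>x. m x * (\<sigma> * d x - K)) has_real_derivative
          m x * (- 2 * a x / \<epsilon>) * (\<sigma> * d x - K) + (\<sigma> * d' x - 0) * m x) (at x within S)"
        by (intro DERIV_mult m' DERIV_diff DERIV_cmult d DERIV_const that)
      also have "m x * (- 2 * a x / \<epsilon>) * (\<sigma> * d x - K) + (\<sigma> * d' x - 0) * m x =
          m x / \<epsilon> * (2 * a x * K + \<sigma> * r x)"
        unfolding d' by (simp add: diff_divide_distrib add_divide_distrib algebra_simps)
      finally show ?thesis .
    qed
    from real_mvt_within[OF st this] obtain x where x: "x \<in> {s..t}"
      "m t * (\<sigma> * d t - K) - m s * (\<sigma> * d s - K) = m x / \<epsilon> * (2 * a x * K + \<sigma> * r x) * (t - s)"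
      by blast
    have "2 * a x * K \<le> - R"
      using mult_right_mono[OF a[OF x(1)], of "2 * K"] K by (simp add: algebra_simps)
    moreover have "\<sigma> * r x \<le> R"
      using r[OF x(1)] \<sigma> abs_ge_self[of "\<sigma> * r x"] by (simp add: abs_mult)
    ultimately have "m x / \<epsilon> * (2 * a x * K + \<sigma> * r x) * (t - s) \<le> 0"
      using eps st by (intro mult_nonpos_nonneg mult_nonneg_nonpos) (auto simp: m_def)
    then show ?thesis using x(2) by linarith
  qed
  from real_mvt_within[OF st A] obtain x where x: "x \<in> {s..t}" "A t - A s = a x * (t - s)"
    by blast
  have mq: "m s / m t \<le> exp (- 2 * a0 * (t - s) / \<epsilon>)"
  proof -
    have "m s / m t = exp (2 * (A t - A s) / \<epsilon>)"
      by (simp add: m_def exp_diff[symmetric] diff_divide_distrib[symmetric] algebra_simps)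
    also have "A t - A s \<le> - a0 * (t - s)"
      unfolding x(2) using a[OF x(1)] st by (intro mult_right_mono) auto
    then have "2 * (A t - A s) \<le> - 2 * a0 * (t - s)" by (simp add: algebra_simps)
    then have "exp (2 * (A t - A s) / \<epsilon>) \<le> exp (- 2 * a0 * (t - s) / \<epsilon>)"
      using eps by (simp only: exp_le_cancel_iff divide_right_mono less_imp_le)
    finally show ?thesis .
  qed
  have mt: "m t > 0" "m s > 0" by (simp_all add: m_def)
  have "\<sigma> * d t \<le> \<bar>d s\<bar> * exp (- 2 * a0 * (t - s) / \<epsilon>) + K" if \<sigma>: "\<bar>\<sigma>\<bar> = 1" for \<sigma> :: real
  proof -
    have "\<sigma> * d s \<le> \<bar>d s\<bar>" using \<sigma> abs_ge_self[of "\<sigma> * d s"] by (simp add: abs_mult)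
    then have "m s * (\<sigma> * d s - K) \<le> m s * \<bar>d s\<bar>"
      using mt K by (intro mult_left_mono) auto
    then have "m t * (\<sigma> * d t - K) \<le> m s * \<bar>d s\<bar>" using *[OF \<sigma>] by linarith
    then have "\<sigma> * d t - K \<le> \<bar>d s\<bar> * (m s / m t)"
      using mt by (simp add: field_simps)
    also have "\<dots> \<le> \<bar>d s\<bar> * exp (- 2 * a0 * (t - s) / \<epsilon>)"
      by (intro mult_left_mono mq) simp
    finally show ?thesis by simp
  qed
  from this[of 1] this[of "-1"] show ?thesis
    unfolding K_def by (auto simp: abs_le_iff)
qed

lemma variance_ode_globally_asymptotically_stable:
  assumes a: "continuous_on {0..} a" and eps: "\<epsilon> > 0" and a0: "a0 > 0" "\<forall>t\<ge>0. a t \<le> - a0"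
    and \<zeta>: "solves_variance_ode H a F \<epsilon> 0 \<zeta>"
  shows "globally_asymptotically_stable (solves_variance_ode H a F \<epsilon>) \<zeta>"
proof -
  let ?A = "\<lambda>t. LINT r:{0..t}|lborel. a r"
  have bound: "\<bar>z t - \<zeta> t\<bar> \<le> \<bar>z t0 - \<zeta> t0\<bar> * exp (- 2 * a0 * (t - t0) / \<epsilon>)"
    if z: "solves_variance_ode H a F \<epsilon> t0 z" and t: "0 \<le> t0" "t0 \<le> t" for z t0 t
  proof -
    define fc where "fc t = 2 * F t * (H * (2 * H - 1)) * (LINT u:{0..t}|lborel.
      1 / \<epsilon> powr (2 * H - 1) * exp (alpha a t u / \<epsilon>) * F u * (t - u) powr (2 * H - 2))" for t
    have "\<forall>t\<ge>t0. \<exists>z'. (z has_real_derivative z') (at t within {t0..}) \<and> \<epsilon> * z' = 2 * a t * z t + fc t"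
      using z unfolding solves_variance_ode_def fc_def .
    then obtain z' where z': "\<And>t. t \<ge> t0 \<Longrightarrow> (z has_real_derivative z' t) (at t within {t0..})"
        "\<And>t. t \<ge> t0 \<Longrightarrow> \<epsilon> * z' t = 2 * a t * z t + fc t"
      by metis
    have "\<forall>t\<ge>0. \<exists>z'. (\<zeta> has_real_derivative z') (at t within {0..}) \<and> \<epsilon> * z' = 2 * a t * \<zeta> t + fc t"
      using \<zeta> unfolding solves_variance_ode_def fc_def .
    then obtain \<zeta>' where \<zeta>': "\<And>t. t \<ge> 0 \<Longrightarrow> (\<zeta> has_real_derivative \<zeta>' t) (at t within {0..})"
        "\<And>t. t \<ge> 0 \<Longrightarrow> \<epsilon> * \<zeta>' t = 2 * a t * \<zeta> t + fc t"
      by metis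
    have "\<bar>z t - \<zeta> t\<bar> \<le> \<bar>z t0 - \<zeta> t0\<bar> * exp (- 2 * a0 * (t - t0) / \<epsilon>) + 0 / (2 * a0)"
    \<comment> \<open>The forcing cancels in the difference, so \<open>R = 0\<close>. The
      derivatives are taken within \<open>{t0..}\<close> because a competitor \<open>z\<close> is a
      solution only from \<open>t0\<close> on.\<close>
    proof (rule linear_ode_bound[OF eps a0(1) order_refl t(2), where S="{t0..}" and A="?A" and a=a
          and d'="\<lambda>t. z' t - \<zeta>' t" and r="\<lambda>_. 0"])
      fix x assume "x \<in> {t0..t}"
      then have x: "t0 \<le> x" "0 \<le> x" using t by auto
      show "(?A has_real_derivative a x) (at x within {t0..})"
        by (rule DERIV_subset[OF set_integral_has_real_derivative[OF a x(2)]]) (use t in auto)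
      show "((\<lambda>t. z t - \<zeta> t) has_real_derivative z' x - \<zeta>' x) (at x within {t0..})"
        by (intro DERIV_diff z' x DERIV_subset[OF \<zeta>'(1)]) (use t in auto)
      show "\<epsilon> * (z' x - \<zeta>' x) = 2 * a x * (z x - \<zeta> x) + 0"
        unfolding right_diff_distrib z'(2)[OF x(1)] \<zeta>'(2)[OF x(2)] by simp
      show "a x \<le> - a0" using a0 x by auto
    qed auto
    then show ?thesis by simp
  qed
  show ?thesis
    unfolding globally_asymptotically_stable_def
  proof (intro conjI allI impI)
    fix \<eta> :: real assume "\<eta> > 0"
    show "\<exists>\<delta>>0. \<forall>t0\<ge>0. \<forall>z. solves_variance_ode H a F \<epsilon> t0 z \<and> \<bar>z t0 - \<zeta> t0\<bar> < \<delta> \<longrightarrow>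
        (\<forall>t\<ge>t0. \<bar>z t - \<zeta> t\<bar> < \<eta>)"
    \<comment> \<open>Distances between solutions never increase, so
      \<open>\<delta> = \<eta>\<close> works for every starting time.\<close>
    proof (intro exI[of _ \<eta>] conjI allI impI \<open>\<eta> > 0\<close>, elim conjE)
      fix t0 z t assume *: "0 \<le> t0" "solves_variance_ode H a F \<epsilon> t0 z" "\<bar>z t0 - \<zeta> t0\<bar> < \<eta>" "t0 \<le> t"
      have "\<bar>z t - \<zeta> t\<bar> \<le> \<bar>z t0 - \<zeta> t0\<bar> * exp (- 2 * a0 * (t - t0) / \<epsilon>)"
        using * by (intro bound)
      also have "\<dots> \<le> \<bar>z t0 - \<zeta> t0\<bar> * 1"
        using * a0 eps by (intro mult_left_mono) (auto simp: divide_nonpos_pos mult_nonneg_nonneg)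
      finally show "\<bar>z t - \<zeta> t\<bar> < \<eta>" using * by simp
    qed
  next
    fix t0 z assume t0: "(0::real) \<le> t0" and z: "solves_variance_ode H a F \<epsilon> t0 z"
    show "((\<lambda>t. z t - \<zeta> t) \<longlongrightarrow> 0) at_top"
    proof (rule Lim_null_comparison)
      show "\<forall>\<^sub>F t in at_top. norm (z t - \<zeta> t) \<le> \<bar>z t0 - \<zeta> t0\<bar> * exp (- 2 * a0 * (t - t0) / \<epsilon>)"
        using eventually_ge_at_top[of t0] by eventually_elim (use bound[OF z t0] in simp)
      have "filterlim (\<lambda>t. (2 * a0 / \<epsilon>) * (- t0 + t)) at_top at_top"
        using eps a0 by (intro filterlim_tendsto_pos_mult_at_top[OF tendsto_const]
            filterlim_tendsto_add_at_top[OF tendsto_const filterlim_ident]) auto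
      then have "((\<lambda>t. exp (- ((2 * a0 / \<epsilon>) * (- t0 + t)))) \<longlongrightarrow> 0) at_top"
        by (intro filterlim_compose[OF exp_at_bot] filterlim_compose[OF filterlim_uminus_at_bot_at_top])
      then have "((\<lambda>t. \<bar>z t0 - \<zeta> t0\<bar> * exp (- ((2 * a0 / \<epsilon>) * (- t0 + t)))) \<longlongrightarrow> \<bar>z t0 - \<zeta> t0\<bar> * 0) at_top"
        by (intro tendsto_intros)
      moreover have "- ((2 * a0 / \<epsilon>) * (- t0 + t)) = - 2 * a0 * (t - t0) / \<epsilon>" for t
        using eps by (simp add: field_simps)
      ultimately show "((\<lambda>t. \<bar>z t0 - \<zeta> t0\<bar> * exp (- 2 * a0 * (t - t0) / \<epsilon>)) \<longlongrightarrow> 0) at_top"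
        by simp
    qed
  qed
qed

section \<open>Exponential moments and asymptotics of the forcing term\<close>

lemma Gamma_integral_exp:
  fixes c x :: real
  assumes c: "c > 0" and x: "x > 0"
  shows "set_integrable lborel {0..} (\<lambda>s. exp (- c * s) * s powr (x - 1))"
    and "(LINT s:{0..}|lborel. exp (- c * s) * s powr (x - 1)) = Gamma x / c powr x"
proof -
  note G = has_integral_nonneg_lborel[OF Gamma_integral_real[OF x]]
  have i: "integrable lborel (\<lambda>t. indicator {0..} t * (t powr (x - 1) / exp t) :: real)"
    using G(1) by (simp add: set_integrable_def)
  have I: "(\<integral>t. indicator {0..} t * (t powr (x - 1) / exp t) \<partial>lborel) = Gamma x"
    using G(2) by (simp add: set_lebesgue_integral_def)
  have e: "indicator {0..} (0 + c * s) * ((0 + c * s) powr (x - 1) / exp (0 + c * s)) =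
      c powr (x - 1) * (indicator {0..} s * (exp (- c * s) * s powr (x - 1)))" for s :: real
    using c by (auto simp: indicator_def zero_le_mult_iff powr_mult exp_minus field_simps)
  have "integrable lborel (\<lambda>s. c powr (x - 1) * (indicator {0..} s * (exp (- c * s) * s powr (x - 1))))"
    using lborel_integrable_real_affine[OF i, of c 0] c unfolding e by simp
  then show "set_integrable lborel {0..} (\<lambda>s. exp (- c * s) * s powr (x - 1))"
    using c by (simp add: set_integrable_def)
  have "Gamma x = c * (c powr (x - 1) * (LINT s:{0..}|lborel. exp (- c * s) * s powr (x - 1)))"
    using lborel_integral_real_affine[of c "\<lambda>t. indicator {0..} t * (t powr (x - 1) / exp t)" 0] c
    unfolding I e by (simp add: set_lebesgue_integral_def)
  also have "\<dots> = c powr x * (LINT s:{0..}|lborel. exp (- c * s) * s powr (x - 1))"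
    using c by (simp add: powr_diff)
  finally show "(LINT s:{0..}|lborel. exp (- c * s) * s powr (x - 1)) = Gamma x / c powr x"
    using c by simp
qed

text \<open>The common upper bound \<open>m\<close> is kept in the estimate because it will be
  \<open>- a0 * s\<close>; the exponential weight is what keeps the resulting moments
  finite.\<close>

lemma abs_exp_diff_le:
  fixes x y m :: real
  assumes "x \<le> m" "y \<le> m"
  shows "\<bar>exp x - exp y\<bar> \<le> exp m * \<bar>x - y\<bar>"
proof -
  have *: "exp v - exp u \<le> exp m * (v - u)" if "u \<le> v" "v \<le> m" for u v :: real
  proof -
    have "exp v - exp u = exp v * (1 - exp (u - v))" by (simp add: exp_diff algebra_simps)
    also have "1 - exp (u - v) \<le> v - u"
      using exp_ge_add_one_self[of "u - v"] by linarith
    then have "exp v * (1 - exp (u - v)) \<le> exp v * (v - u)" by (intro mult_left_mono) auto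
    also have "\<dots> \<le> exp m * (v - u)" using that by (intro mult_right_mono) auto
    finally show ?thesis .
  qed
  show ?thesis
    using *[of x y] *[of y x] assms by (cases "x \<le> y") (auto simp: abs_if)
qed

lemma forcing_rescaled:
  fixes \<alpha> F :: "real \<Rightarrow> real"
  assumes eps: "\<epsilon> > 0"
  shows "(LINT u:{0..t}|lborel. 1 / \<epsilon> powr (2 * H - 1) * exp (\<alpha> u) * F u * (t - u) powr (2 * H - 2)) =
    (LINT s:{0..t / \<epsilon>}|lborel. exp (\<alpha> (t - \<epsilon> * s)) * F (t - \<epsilon> * s) * s powr (2 * H - 2))"
proof -
  let ?f = "\<lambda>u. 1 / \<epsilon> powr (2 * H - 1) * exp (\<alpha> u) * F u * (t - u) powr (2 * H - 2)"
  have e: "\<epsilon> * (indicator {0..t} (t + - \<epsilon> * s) *\<^sub>R ?f (t + - \<epsilon> * s)) =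
      indicator {0..t / \<epsilon>} s *\<^sub>R (exp (\<alpha> (t - \<epsilon> * s)) * F (t - \<epsilon> * s) * s powr (2 * H - 2))" for s
  proof (cases "s \<in> {0..t / \<epsilon>}")
    case True
    then have s: "0 \<le> s" "\<epsilon> * s \<le> t" using eps by (auto simp: field_simps)
    \<comment> \<open>The prefactor of the forcing, the Jacobian and the scaled kernel contribute
      powers of \<open>\<epsilon>\<close> that cancel exactly.\<close>
    have "\<epsilon> * (1 / \<epsilon> powr (2 * H - 1) * \<epsilon> powr (2 * H - 2)) = 1"
      using eps powr_diff[of \<epsilon> "2 * H - 1" 1] by (simp add: field_simps)
    then have "\<epsilon> * (1 / \<epsilon> powr (2 * H - 1) * x * y * (\<epsilon> powr (2 * H - 2) * z)) = x * y * z" for x y z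
      by (metis (no_types, opaque_lifting) mult.assoc mult.commute mult.left_neutral)
    moreover have "(t - (t + - \<epsilon> * s)) powr (2 * H - 2) = \<epsilon> powr (2 * H - 2) * s powr (2 * H - 2)"
      using eps s by (simp add: powr_mult)
    ultimately show ?thesis using True s eps by simp
  next
    case False
    then have "t + - \<epsilon> * s \<notin> {0..t}" using eps by (auto simp: field_simps zero_le_mult_iff)
    then show ?thesis using False by simp
  qed
  have "(LINT u:{0..t}|lborel. ?f u) = \<epsilon> * (\<integral>s. indicator {0..t} (t + - \<epsilon> * s) *\<^sub>R ?f (t + - \<epsilon> * s) \<partial>lborel)"
    unfolding set_lebesgue_integral_def
    using lborel_integral_real_affine[of "- \<epsilon>" "\<lambda>u. indicator {0..t} u *\<^sub>R ?f u" t] eps by simp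
  also have "\<dots> = (\<integral>s. \<epsilon> * (indicator {0..t} (t + - \<epsilon> * s) *\<^sub>R ?f (t + - \<epsilon> * s)) \<partial>lborel)"
    by (rule integral_mult_right_zero[symmetric])
  finally show ?thesis unfolding e set_lebesgue_integral_def .
qed

text \<open>For \<open>c > 0\<close> and \<open>p > -1\<close> the value is
  \<open>Gamma (p + 1) / c powr (p + 1)\<close>. Below it only serves as a constant independent of
  \<open>\<epsilon>\<close> and \<open>t\<close>.\<close>

definition exp_moment :: "real \<Rightarrow> real \<Rightarrow> real" where
  "exp_moment c p = (LINT s:{0..}|lborel. exp (- c * s) * s powr p)"

lemma exp_moment_integrable:
  fixes c p :: real
  assumes "c > 0" "p > -1"
  shows "integrable lborel (\<lambda>s. indicator {0..} s * (exp (- c * s) * s powr p))"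
  using Gamma_integral_exp(1)[OF assms(1), of "p + 1"] assms(2) by (simp add: set_integrable_def)

lemma exp_moment_nonneg: "exp_moment c p \<ge> 0"
  unfolding exp_moment_def set_lebesgue_integral_def by (intro integral_nonneg_AE) auto

text \<open>The leading term is the integral of \<open>F t * exp (a t * s) * s powr (2 * H - 2)\<close> over
  all \<open>s \<ge> 0\<close>; cutting it off at \<open>t / \<epsilon>\<close> costs \<open>O((\<epsilon> / t)\<^sup>2)\<close> because
  \<open>1 \<le> (\<epsilon> * s / t)\<^sup>2\<close> beyond that point.\<close>

lemma forcing_asymptotics:
  fixes a F A :: "real \<Rightarrow> real"
  assumes H: "1 / 2 < H" and eps: "\<epsilon> > 0" and t: "t \<ge> 0" and a0: "a0 > 0"
    and S: "{0..t} \<subseteq> S" and A: "\<And>x. x \<in> {0..t} \<Longrightarrow> (A has_real_derivative a x) (at x within S)"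
    and a: "\<And>x. x \<in> {0..t} \<Longrightarrow> a x \<le> - a0"
    and L: "L \<ge> 0" and a_lip: "\<And>x. x \<in> {0..t} \<Longrightarrow> \<bar>a x - a t\<bar> \<le> L * (t - x)"
    and F: "continuous_on {0..t} F" "\<And>x. x \<in> {0..t} \<Longrightarrow> \<bar>F x\<bar> \<le> B"
    and F_lip: "\<And>x. x \<in> {0..t} \<Longrightarrow> \<bar>F x - F t\<bar> \<le> B * (t - x)"
  defines "b \<equiv> 2 * H - 2"
  defines "\<Delta> \<equiv> (LINT u:{0..t}|lborel. 1 / \<epsilon> powr (2 * H - 1) * exp ((A t - A u) / \<epsilon>) * F u * (t - u) powr b)
      - F t * Gamma (2 * H - 1) / \<bar>a t\<bar> powr (2 * H - 1)"
  shows "\<bar>\<Delta>\<bar> \<le> 2 * B * exp_moment a0 b"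
    and "t > 0 \<Longrightarrow> \<bar>\<Delta>\<bar> \<le> \<epsilon> * (B * exp_moment a0 (b + 1) + B * L * exp_moment a0 (b + 2))
      + B * (\<epsilon>\<^sup>2 / t\<^sup>2) * exp_moment a0 (b + 2)"
proof -
  have B: "B \<ge> 0" using F(2)[of 0] t by simp
  have tt: "t \<in> {0..t}" using t by simp
  have b: "b > -1" using H by (simp add: b_def)
  define X where "X s = exp ((A t - A (t - \<epsilon> * s)) / \<epsilon>) * F (t - \<epsilon> * s)" for s
  define k where "k j s = indicator {0..} s * (exp (- a0 * s) * s powr (b + j))" for j s :: real
  define D where "D s = indicator {0..t / \<epsilon>} s * (X s * s powr b) -
      indicator {0..} s * (F t * (exp (- \<bar>a t\<bar> * s) * s powr b))" for s
  have k: "integrable lborel (k j)" "(\<integral>s. k j s \<partial>lborel) = exp_moment a0 (b + j)" if "j \<ge> 0" for j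
    using exp_moment_integrable[OF a0, of "b + j"] b that
    by (auto simp: k_def[abs_def] exp_moment_def set_lebesgue_integral_def)
  have k0: "k j s \<ge> 0" for j s by (simp add: k_def)
  have in_range: "t - \<epsilon> * s \<in> {0..t}" "\<epsilon> * s \<le> t" "s \<ge> 0" if "s \<in> {0..t / \<epsilon>}" for s
    using that eps by (auto simp: field_simps)
  have X: "\<bar>X s - F t * exp (- \<bar>a t\<bar> * s)\<bar> \<le> exp (- a0 * s) * (B * (\<epsilon> * s) + B * (L * \<epsilon> * s\<^sup>2))"
    "\<bar>X s\<bar> \<le> B * exp (- a0 * s)" if s: "s \<in> {0..t / \<epsilon>}" for s
  proof -
    note r = in_range[OF s]
    have sub: "{t - \<epsilon> * s..t} \<subseteq> S" "t - \<epsilon> * s \<le> t" using S r by auto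
    have "\<exists>x\<in>{t - \<epsilon> * s..t}. A t - A (t - \<epsilon> * s) = a x * (t - (t - \<epsilon> * s))"
      by (rule real_mvt_within[OF sub(2,1)]) (use A r in auto)
    then obtain x where x: "x \<in> {t - \<epsilon> * s..t}" "A t - A (t - \<epsilon> * s) = a x * (\<epsilon> * s)" by auto
    \<comment> \<open>The mean value theorem removes \<open>\<epsilon>\<close> from the exponent. As
      \<open>x\<close> lies within \<open>\<epsilon> * s\<close> of \<open>t\<close>, freezing
      \<open>a\<close> at \<open>t\<close> changes the exponent by at most
      \<open>L * \<epsilon> * s\<^sup>2\<close>.\<close>
    then have e: "(A t - A (t - \<epsilon> * s)) / \<epsilon> = a x * s" using eps by simp
    have x': "x \<in> {0..t}" using x r by auto
    have up: "a x * s \<le> - a0 * s" "- \<bar>a t\<bar> * s \<le> - a0 * s"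
      by (rule mult_right_mono; use a[OF x'] a[OF tt] r a0 in simp)+
    show "\<bar>X s\<bar> \<le> B * exp (- a0 * s)"
      unfolding X_def e abs_mult using up F(2)[OF r(1)] B
      by (subst mult.commute) (intro mult_mono, auto)
    have at: "- \<bar>a t\<bar> = a t" using a[OF tt] a0 by simp
    have "\<bar>a x - a t\<bar> \<le> L * (t - x)" by (rule a_lip[OF x'])
    also have "\<dots> \<le> L * (\<epsilon> * s)"
      using x r L by (intro mult_left_mono) auto
    finally have "\<bar>a x - a t\<bar> * s \<le> L * (\<epsilon> * s) * s" using r by (intro mult_right_mono) auto
    moreover have "\<bar>a x * s - a t * s\<bar> = \<bar>a x - a t\<bar> * s"
      using r by (simp add: abs_mult flip: left_diff_distrib)
    ultimately have da: "\<bar>a x * s - a t * s\<bar> \<le> L * \<epsilon> * s\<^sup>2"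
      by (simp add: power2_eq_square mult.assoc)
    have "X s - F t * exp (- \<bar>a t\<bar> * s) =
        exp (a x * s) * (F (t - \<epsilon> * s) - F t) + F t * (exp (a x * s) - exp (a t * s))"
      unfolding X_def e at by (simp add: algebra_simps)
    also have "\<bar>\<dots>\<bar> \<le> exp (a x * s) * \<bar>F (t - \<epsilon> * s) - F t\<bar> + \<bar>F t\<bar> * \<bar>exp (a x * s) - exp (a t * s)\<bar>"
      by (rule order_trans[OF abs_triangle_ineq]) (simp add: abs_mult)
    also have "\<dots> \<le> exp (- a0 * s) * (B * (\<epsilon> * s)) + B * (exp (- a0 * s) * (L * \<epsilon> * s\<^sup>2))"
    proof (intro add_mono mult_mono)
      show "\<bar>F (t - \<epsilon> * s) - F t\<bar> \<le> B * (\<epsilon> * s)" using F_lip[OF r(1)] by simp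
      have "\<bar>exp (a x * s) - exp (a t * s)\<bar> \<le> exp (- a0 * s) * \<bar>a x * s - a t * s\<bar>"
        using up unfolding at by (rule abs_exp_diff_le)
      also have "\<dots> \<le> exp (- a0 * s) * (L * \<epsilon> * s\<^sup>2)" using da by (intro mult_left_mono) auto
      finally show "\<bar>exp (a x * s) - exp (a t * s)\<bar> \<le> exp (- a0 * s) * (L * \<epsilon> * s\<^sup>2)" .
    qed (use up B F(2)[OF tt] in auto)
    finally show "\<bar>X s - F t * exp (- \<bar>a t\<bar> * s)\<bar> \<le> exp (- a0 * s) * (B * (\<epsilon> * s) + B * (L * \<epsilon> * s\<^sup>2))"
      by (simp add: algebra_simps)
  qed
  have lead: "\<bar>F t * exp (- \<bar>a t\<bar> * s)\<bar> \<le> B * exp (- a0 * s)" if "s \<ge> 0" for s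
  proof -
    have "- \<bar>a t\<bar> * s \<le> - a0 * s" using a[OF tt] a0 that by (intro mult_right_mono) auto
    then show ?thesis using F(2)[OF tt] B by (simp add: abs_mult mult_mono)
  qed
  have A_cont: "continuous_on {0..t} A"
    unfolding continuous_on_eq_continuous_within
    using DERIV_continuous[OF DERIV_subset[OF A S]] by blast
  have im: "(\<lambda>s. t - \<epsilon> * s) ` {0..t / \<epsilon>} \<subseteq> {0..t}"
    using in_range(1) by blast
  have lin: "continuous_on {0..t / \<epsilon>} (\<lambda>s. t - \<epsilon> * s)"
    by (intro continuous_intros)
  have "continuous_on {0..t / \<epsilon>} X"
    unfolding X_def using eps
    by (intro continuous_on_mult continuous_on_exp continuous_on_divide continuous_on_diff continuous_on_const
        continuous_on_compose2[OF A_cont lin im] continuous_on_compose2[OF F(1) lin im]) simp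
  then have "(\<lambda>s. indicator {0..t / \<epsilon>} s *\<^sub>R X s) \<in> borel_measurable borel"
    by (intro borel_measurable_continuous_on_indicator) auto
  then have "(\<lambda>s. (indicator {0..t / \<epsilon>} s *\<^sub>R X s) * s powr b) \<in> borel_measurable borel"
    by measurable
  then have m1: "(\<lambda>s. indicator {0..t / \<epsilon>} s * (X s * s powr b)) \<in> borel_measurable lborel"
    by (simp add: mult.assoc)
  have i1: "integrable lborel (\<lambda>s. indicator {0..t / \<epsilon>} s * (X s * s powr b))"
  proof (rule Bochner_Integration.integrable_bound[OF integrable_mult_right[OF k(1)[of 0], of B] m1])
    show "AE s in lborel. norm (indicator {0..t / \<epsilon>} s * (X s * s powr b)) \<le> norm (B * k 0 s)"
    proof (rule AE_I2)
      fix s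
      show "norm (indicator {0..t / \<epsilon>} s * (X s * s powr b)) \<le> norm (B * k 0 s)"
      proof (cases "s \<in> {0..t / \<epsilon>}")
        case True
        then have "\<bar>X s\<bar> * s powr b \<le> B * exp (- a0 * s) * s powr b"
          by (intro mult_right_mono X(2)) auto
        then show ?thesis using True B by (simp add: k_def abs_mult mult.assoc)
      qed simp
    qed
  qed simp
  have at0: "\<bar>a t\<bar> > 0" using a[OF tt] a0 by simp
  have i2: "integrable lborel (\<lambda>s. indicator {0..} s * (F t * (exp (- \<bar>a t\<bar> * s) * s powr b)))"
    using integrable_mult_right[OF exp_moment_integrable[OF at0 b], of "F t"] by (simp add: mult.left_commute)
  have "(\<integral>s. indicator {0..} s * (F t * (exp (- \<bar>a t\<bar> * s) * s powr b)) \<partial>lborel) =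
      F t * Gamma (2 * H - 1) / \<bar>a t\<bar> powr (2 * H - 1)"
    using Gamma_integral_exp(2)[OF at0, of "2 * H - 1"] H
    by (simp add: set_lebesgue_integral_def b_def mult.left_commute[of _ "F t"])
  then have \<Delta>: "\<Delta> = (\<integral>s. D s \<partial>lborel)"
    unfolding \<Delta>_def D_def
    using i1 i2 forcing_rescaled[OF eps, of t H "\<lambda>u. (A t - A u) / \<epsilon>" F]
    by (simp add: b_def X_def set_lebesgue_integral_def)
  have iD: "integrable lborel D" unfolding D_def using i1 i2 by simp
  \<comment> \<open>The crude bound is uniform down to \<open>t = 0\<close>: the integrand and its
    limit are each dominated by \<open>B * k 0 s\<close>. It controls the initial layer.\<close>
  have "\<bar>\<Delta>\<bar> \<le> (\<integral>s. 2 * B * k 0 s \<partial>lborel)"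
    unfolding \<Delta>
  proof (rule abs_integral_le[OF iD])
    fix s
    show "\<bar>D s\<bar> \<le> 2 * B * k 0 s"
    proof (cases "s \<ge> 0")
      case True
      have "\<bar>D s\<bar> \<le> \<bar>indicator {0..t / \<epsilon>} s * X s\<bar> * s powr b + \<bar>F t * exp (- \<bar>a t\<bar> * s)\<bar> * s powr b"
        unfolding D_def using True
        by (intro order_trans[OF abs_triangle_ineq4]) (simp add: abs_mult mult.assoc)
      also have "\<dots> \<le> (B * exp (- a0 * s)) * s powr b + (B * exp (- a0 * s)) * s powr b"
        using X(2)[of s] B lead[OF True] by (intro add_mono mult_right_mono) (auto simp: indicator_def)
      finally show ?thesis using True by (simp add: k_def mult_ac)
    next
      case False
      then show ?thesis by (simp add: D_def k_def)
    qed
  qed (use k in simp)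
  then show "\<bar>\<Delta>\<bar> \<le> 2 * B * exp_moment a0 b" using k(2)[of 0] by simp
  assume t0: "t > 0"
  \<comment> \<open>For \<open>s \<le> t / \<epsilon>\<close> the first two terms pay for freezing
    \<open>F\<close> and \<open>a\<close> at \<open>t\<close>; the last term pays for the tail
    beyond \<open>t / \<epsilon>\<close>.\<close>
  let ?Q = "\<lambda>s. \<epsilon> * (B * k 1 s + B * L * k 2 s) + B * (\<epsilon>\<^sup>2 / t\<^sup>2) * k 2 s"
  have "\<bar>\<Delta>\<bar> \<le> (\<integral>s. ?Q s \<partial>lborel)"
    unfolding \<Delta>
  proof (rule abs_integral_le[OF iD])
    fix s
    have k12: "k 1 s = exp (- a0 * s) * (s * s powr b)" "k 2 s = exp (- a0 * s) * (s\<^sup>2 * s powr b)" if "s \<ge> 0"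
      using that b by (cases "s = 0"; simp add: k_def powr_add)+
    show "\<bar>D s\<bar> \<le> ?Q s"
    proof (cases "s \<in> {0..t / \<epsilon>}")
      case True
      then have s0: "s \<ge> 0" by simp
      have "\<bar>D s\<bar> = \<bar>X s - F t * exp (- \<bar>a t\<bar> * s)\<bar> * s powr b"
        unfolding D_def using True
        by (subst abs_of_nonneg[symmetric, of "s powr b"], simp, subst abs_mult[symmetric])
          (simp add: left_diff_distrib mult.assoc)
      also have "\<dots> \<le> (exp (- a0 * s) * (B * (\<epsilon> * s) + B * (L * \<epsilon> * s\<^sup>2))) * s powr b"
        by (intro mult_right_mono X(1) True) simp
      also have "\<dots> = \<epsilon> * (B * k 1 s + B * L * k 2 s)"
        unfolding k12[OF s0] by (simp add: algebra_simps)
      also have "\<dots> \<le> ?Q s" using B k0[of 2 s] by simp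
      finally show ?thesis .
    next
      case False
      show ?thesis
      proof (cases "s \<ge> 0")
        case True
        then have "1 \<le> \<epsilon> * s / t" using False eps t0 by (simp add: field_simps)
        then have "1 \<le> (\<epsilon> * s / t)\<^sup>2" using one_le_power by blast
        then have one: "1 \<le> \<epsilon>\<^sup>2 / t\<^sup>2 * s\<^sup>2" by (simp add: power_divide power_mult_distrib)
        have "\<bar>D s\<bar> = \<bar>F t * exp (- \<bar>a t\<bar> * s)\<bar> * s powr b"
          unfolding D_def using True False by (simp add: abs_mult)
        also have "\<dots> \<le> (B * exp (- a0 * s)) * s powr b * 1"
          using lead[OF True] by (simp add: mult_right_mono)
        also have "\<dots> \<le> (B * exp (- a0 * s)) * s powr b * (\<epsilon>\<^sup>2 / t\<^sup>2 * s\<^sup>2)"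
          using one B by (intro mult_left_mono) auto
        also have "\<dots> = B * (\<epsilon>\<^sup>2 / t\<^sup>2) * k 2 s" unfolding k12[OF True] by (simp add: ac_simps)
        also have "\<dots> \<le> ?Q s" using B L k0 eps by simp
        finally show ?thesis .
      next
        case neg: False
        then show ?thesis by (simp add: D_def k_def)
      qed
    qed
  qed (use k in simp)
  also have "(\<integral>s. ?Q s \<partial>lborel) = \<epsilon> * (B * exp_moment a0 (b + 1) + B * L * exp_moment a0 (b + 2))
      + B * (\<epsilon>\<^sup>2 / t\<^sup>2) * exp_moment a0 (b + 2)"
    using k[of 1] k[of 2] by simp
  finally show "\<bar>\<Delta>\<bar> \<le> \<epsilon> * (B * exp_moment a0 (b + 1) + B * L * exp_moment a0 (b + 2))
      + B * (\<epsilon>\<^sup>2 / t\<^sup>2) * exp_moment a0 (b + 2)" .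
qed

section \<open>Linearisation along the slow manifold\<close>

text \<open>The points considered lie on the boundary of the domain of \<open>f\<close>, so the
  derivative holds only within it and the implicit function theorem is not directly applicable. But
  the zero \<open>xs\<close> is given and continuous: linearising the zero identity first shows that
  its increments are at most linear in those of time, and then identifies the derivative.\<close>

lemma implicit_zero_has_derivative:
  fixes f :: "real \<times> real \<times> real \<Rightarrow> real" and xs :: "real \<Rightarrow> real"
  assumes D: "(f has_derivative f') (at (xs t, t, 0) within UNIV \<times> {0..} \<times> {0..})"
    and cont: "continuous_on {0..} xs" and zero: "\<And>s. s \<ge> 0 \<Longrightarrow> f (xs s, s, 0) = 0"
    and t: "t \<ge> 0" and nz: "f' (1, 0, 0) \<noteq> 0"
  shows "(xs has_real_derivative - f' (0, 1, 0) / f' (1, 0, 0)) (at t within {0..})"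
proof -
  define p q where "p = f' (1, 0, 0)" and "q = f' (0, 1, 0)"
  have p0: "\<bar>p\<bar> > 0" using nz by (simp add: p_def)
  have lin: "f' (h, k, 0) = h * p + k * q" for h k
  proof -
    interpret f': bounded_linear f' using D by (rule has_derivative_bounded_linear)
    have "f' (h *\<^sub>R (1, 0, 0) + k *\<^sub>R (0, 1, 0)) = h *\<^sub>R p + k *\<^sub>R q"
      unfolding p_def q_def by (simp only: f'.add f'.scaleR)
    then show ?thesis by simp
  qed
  define K where "K = 2 * (\<bar>q\<bar> + \<bar>p\<bar>) / \<bar>p\<bar>"
  have K: "K \<ge> 0" unfolding K_def by simp
  have "\<exists>d>0. \<forall>s\<in>{0..}. norm (s - t) < d \<longrightarrow>
      norm (xs s - xs t - (s - t) * (- q / p)) \<le> e * norm (s - t)" if e: "e > 0" for e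
  proof -
    \<comment> \<open>The first bound allows half of the \<open>xs\<close> increment to be absorbed
      on the left; the second produces the final accuracy \<open>e\<close> after division by
      \<open>\<bar>p\<bar>\<close>.\<close>
    define e' where "e' = min (\<bar>p\<bar> / 2) (e * \<bar>p\<bar> / (K + 1))"
    have "e' > 0" using p0 e K by (simp add: e'_def)
    moreover have "e' \<le> \<bar>p\<bar> / 2" unfolding e'_def by (rule min.cobounded1)
    ultimately have e': "e' > 0" "e' \<le> \<bar>p\<bar> / 2" .
    have "e' \<le> e * \<bar>p\<bar> / (K + 1)" by (simp add: e'_def)
    then have eK: "e' * (K + 1) \<le> e * \<bar>p\<bar>" using K by (subst (asm) pos_le_divide_eq) auto
    obtain d where d: "d > 0" and dd: "\<And>y. y \<in> UNIV \<times> {0..} \<times> {0..} \<Longrightarrow> norm (y - (xs t, t, 0)) < d \<Longrightarrow>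
        norm (f y - f (xs t, t, 0) - f' (y - (xs t, t, 0))) \<le> e' * norm (y - (xs t, t, 0))"
      using D e'(1) unfolding has_derivative_within_alt by blast
    obtain d2 where d2: "d2 > 0" "\<And>s. s \<in> {0..} \<Longrightarrow> dist s t < d2 \<Longrightarrow> dist (xs s) (xs t) < d / 2"
      using cont t half_gt_zero[OF d] unfolding continuous_on_iff by (metis atLeast_iff)
    have "norm (xs s - xs t - (s - t) * (- q / p)) \<le> e * norm (s - t)"
      if s: "s \<in> {0..}" "norm (s - t) < min d2 (d / 2)" for s
    proof -
      let ?x = "xs s - xs t" and ?s = "s - t"
      have nle: "norm (?x, ?s, 0::real) \<le> \<bar>?x\<bar> + \<bar>?s\<bar>"
        using norm_Pair_le[of ?x "(?s, 0::real)"] norm_Pair_le[of ?s "0::real"] by simp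
      have "\<bar>?x\<bar> < d / 2" using d2(2)[OF s(1)] s(2) by (simp add: dist_real_def)
      then have "norm (?x, ?s, 0::real) < d" using nle s(2) by simp
      then have "norm (f (xs s, s, 0) - f (xs t, t, 0) - f' (?x, ?s, 0)) \<le> e' * norm (?x, ?s, 0::real)"
        using dd[of "(xs s, s, 0)"] s(1) by simp
      then have "\<bar>?x * p + ?s * q\<bar> \<le> e' * norm (?x, ?s, 0::real)"
        using zero s(1) t by (simp add: lin)
      also have "\<dots> \<le> e' * (\<bar>?x\<bar> + \<bar>?s\<bar>)" using nle e' by (intro mult_left_mono) auto
      finally have main: "\<bar>?x * p + ?s * q\<bar> \<le> e' * (\<bar>?x\<bar> + \<bar>?s\<bar>)" .
      \<comment> \<open>Absorption step: the error term still contains \<open>?x\<close>, but with a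
        factor of at most \<open>\<bar>p\<bar> / 2\<close>, and is moved to the left to give
        \<open>\<bar>?x\<bar> \<le> K * \<bar>?s\<bar>\<close>.\<close>
      have "\<bar>?x\<bar> * \<bar>p\<bar> \<le> \<bar>?x * p + ?s * q\<bar> + \<bar>?s\<bar> * \<bar>q\<bar>"
        using abs_triangle_ineq4[of "?x * p + ?s * q" "?s * q"] by (simp add: abs_mult)
      also have "\<dots> \<le> (\<bar>p\<bar> / 2) * (\<bar>?x\<bar> + \<bar>?s\<bar>) + \<bar>?s\<bar> * \<bar>q\<bar>"
        using main e'(2) by (intro add_right_mono order_trans[OF main] mult_right_mono) auto
      finally have "\<bar>?x\<bar> * \<bar>p\<bar> \<le> (2 * \<bar>q\<bar> + \<bar>p\<bar>) * \<bar>?s\<bar>"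
        by (simp add: algebra_simps)
      also have "\<dots> \<le> 2 * (\<bar>q\<bar> + \<bar>p\<bar>) * \<bar>?s\<bar>"
        by (intro mult_right_mono) auto
      finally have "\<bar>?x\<bar> * \<bar>p\<bar> \<le> 2 * (\<bar>q\<bar> + \<bar>p\<bar>) * \<bar>?s\<bar>" .
      then have xK: "\<bar>?x\<bar> \<le> K * \<bar>?s\<bar>"
        using p0 by (simp add: K_def field_simps)
      have "\<bar>?x + ?s * q / p\<bar> * \<bar>p\<bar> = \<bar>?x * p + ?s * q\<bar>"
        unfolding abs_mult[symmetric] using p0 by (simp add: distrib_right)
      also have "\<dots> \<le> e' * (K * \<bar>?s\<bar> + \<bar>?s\<bar>)"
        using xK e' by (intro order_trans[OF main] mult_left_mono) auto
      also have "\<dots> = e' * (K + 1) * \<bar>?s\<bar>" by (simp add: algebra_simps)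
      also have "\<dots> \<le> e * \<bar>p\<bar> * \<bar>?s\<bar>" using eK by (intro mult_right_mono) auto
      finally have "\<bar>?x + ?s * q / p\<bar> * \<bar>p\<bar> \<le> (e * \<bar>?s\<bar>) * \<bar>p\<bar>" by (simp add: mult_ac)
      then have "\<bar>?x + ?s * q / p\<bar> \<le> e * \<bar>?s\<bar>" using p0 by (rule mult_right_le_imp_le)
      then show ?thesis by simp
    qed
    then show ?thesis using d d2(1) by (intro exI[of _ "min d2 (d / 2)"]) auto
  qed
  then have "(xs has_derivative (\<lambda>h. h * (- q / p))) (at t within {0..})"
    unfolding has_derivative_within_alt by (intro conjI bounded_linear_mult_left allI impI) blast
  moreover have "(\<lambda>h. h * (- q / p)) = (\<lambda>h. (- q / p) * h)"
    by (auto simp: fun_eq_iff)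
  ultimately show ?thesis
    by (simp only: has_field_derivative_def p_def q_def)
qed

text \<open>By the chain rule \<open>a'\<close> is the second derivative of \<open>f\<close> in the
  directions \<open>(x' t, 1, 0)\<close> and \<open>(1, 0, 0)\<close>, and
  \<open>\<bar>x' t\<bar> \<le> B / a0\<close> because the partial derivative in \<open>x\<close> is
  at least \<open>a0\<close> in modulus. The bound is stated pointwise in \<open>t\<close>: the
  derivative exists at all times, but bounds on \<open>f\<close> are only assumed for times in
  \<open>I\<close>.\<close>

lemma slow_manifold_linearisation:
  fixes f :: "real \<times> real \<times> real \<Rightarrow> real"
    and Df :: "real \<times> real \<times> real \<Rightarrow> (real \<times> real \<times> real) \<Rightarrow>\<^sub>L real"
    and D2f :: "real \<times> real \<times> real \<Rightarrow> (real \<times> real \<times> real) \<Rightarrow>\<^sub>L ((real \<times> real \<times> real) \<Rightarrow>\<^sub>L real)"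
    and xs a :: "real \<Rightarrow> real"
  assumes f: "has_C1_derivative_on f Df (UNIV \<times> {0..} \<times> {0..})"
      "has_C1_derivative_on Df D2f (UNIV \<times> {0..} \<times> {0..})"
    and cont: "continuous_on {0..} xs" and zero: "\<forall>t\<ge>0. f (xs t, t, 0) = 0"
    and a: "\<forall>t\<ge>0. a t = deriv (\<lambda>x. f (x, t, 0)) (xs t)"
    and a0: "a0 > 0" "\<forall>t\<ge>0. a t \<le> - a0"
  shows "continuous_on {0..} a"
    and "\<exists>a'. \<forall>t\<ge>0. (a has_real_derivative a' t) (at t within {0..}) \<and>
      (\<forall>B. (\<forall>b\<in>Basis. \<bar>Df (xs t, t, 0) b\<bar> \<le> B) \<longrightarrow>
        (\<forall>b\<in>Basis. \<forall>c\<in>Basis. \<bar>D2f (xs t, t, 0) b c\<bar> \<le> B) \<longrightarrow> \<bar>a' t\<bar> \<le> B / a0 * B + B)"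
proof -
  let ?S = "UNIV \<times> {0..} \<times> {0..} :: (real \<times> real \<times> real) set"
  let ?g = "\<lambda>t. (xs t, t, 0::real)"
  have D: "(f has_derivative Df p) (at p within ?S)" "(Df has_derivative D2f p) (at p within ?S)" if "p \<in> ?S" for p
    using f that by (auto simp: has_C1_derivative_on_def)
  have gS: "?g t \<in> ?S" if "t \<ge> 0" for t using that by simp
  have aD: "a t = Df (?g t) (1, 0, 0)" if t: "t \<ge> 0" for t
  proof -
    have "((\<lambda>x. f (x, t, 0)) has_derivative (\<lambda>h. Df (?g t) (h, 0, 0))) (at (xs t) within UNIV)"
      by (rule has_derivative_in_compose2[where t="?S" and f="\<lambda>x. (x, t, 0)", OF D(1)])
        (use t in \<open>auto intro!: derivative_eq_intros simp: zero_prod_def\<close>)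
    moreover have "(\<lambda>h. Df (?g t) (h, 0, 0)) = (\<lambda>h. h * Df (?g t) (1, 0, 0))"
    proof
      fix h :: real
      show "Df (?g t) (h, 0, 0) = h * Df (?g t) (1, 0, 0)"
        using blinfun.scaleR_right[of "Df (?g t)" h "(1, 0, 0)"] by simp
    qed
    ultimately have "((\<lambda>x. f (x, t, 0)) has_real_derivative Df (?g t) (1, 0, 0)) (at (xs t))"
      by (simp add: has_field_derivative_def mult_commute_abs)
    then show ?thesis using a t DERIV_imp_deriv by metis
  qed
  define x' where "x' t = - Df (?g t) (0, 1, 0) / Df (?g t) (1, 0, 0)" for t
  have xs': "(xs has_real_derivative x' t) (at t within {0..})" if "t \<ge> 0" for t
    unfolding x'_def
    by (rule implicit_zero_has_derivative[OF D(1)[OF gS[OF that]] cont])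
      (use zero a0 aD that in force)+
  define a' where "a' t = D2f (?g t) (x' t, 1, 0) (1, 0, 0)" for t
  have a': "(a has_real_derivative a' t) (at t within {0..})" if t: "t \<ge> 0" for t
  proof -
    have g: "(?g has_derivative (\<lambda>h. (h * x' t, h, 0))) (at t within {0..})"
      using xs'[OF t] unfolding has_field_derivative_def
      by (intro has_derivative_Pair has_derivative_ident has_derivative_const) (simp add: mult_commute_abs)
    have "((\<lambda>s. Df (?g s)) has_derivative (\<lambda>h. D2f (?g t) (h * x' t, h, 0))) (at t within {0..})"
      by (rule has_derivative_in_compose2[where t="?S", OF D(2) _ _ g]) (use t in auto)
    then have "((\<lambda>s. Df (?g s) (1, 0, 0)) has_derivative (\<lambda>h. D2f (?g t) (h * x' t, h, 0) (1, 0, 0))) (at t within {0..})"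
      by (rule bounded_linear.has_derivative[OF blinfun.bounded_linear_left])
    moreover have "(\<lambda>h. D2f (?g t) (h * x' t, h, 0) (1, 0, 0)) = (\<lambda>h. h * a' t)"
    proof
      fix h :: real
      have "D2f (?g t) (h *\<^sub>R (x' t, 1, 0)) (1, 0, 0) = h *\<^sub>R a' t"
        by (simp only: blinfun.scaleR_right blinfun.scaleR_left a'_def)
      then show "D2f (?g t) (h * x' t, h, 0) (1, 0, 0) = h * a' t" by simp
    qed
    ultimately have "((\<lambda>s. Df (?g s) (1, 0, 0)) has_real_derivative a' t) (at t within {0..})"
      by (simp add: has_field_derivative_def mult_commute_abs)
    then show ?thesis
      by (rule has_real_derivative_cong_on) (use t aD in auto)
  qed
  show "continuous_on {0..} a"
    unfolding continuous_on_eq_continuous_within using a' DERIV_continuous by fastforce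
  have "\<bar>a' t\<bar> \<le> B / a0 * B + B"
    if t: "t \<ge> 0" and B1: "\<forall>b\<in>Basis. \<bar>Df (?g t) b\<bar> \<le> B"
      and B2: "\<forall>b\<in>Basis. \<forall>c\<in>Basis. \<bar>D2f (?g t) b c\<bar> \<le> B" for t B
  proof -
    have basis: "(1, 0, 0) \<in> (Basis :: (real \<times> real \<times> real) set)" "(0, 1, 0) \<in> (Basis :: (real \<times> real \<times> real) set)"
      by (auto simp: Basis_prod_def zero_prod_def)
    have "\<bar>Df (?g t) (0, 1, 0)\<bar> \<le> B" using B1 basis by blast
    moreover have "\<bar>Df (?g t) (1, 0, 0)\<bar> \<ge> a0" using aD[OF t] a0 t by auto
    ultimately have x: "\<bar>x' t\<bar> \<le> B / a0"
      unfolding x'_def abs_divide abs_minus_cancel using a0 by (intro frac_le) auto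
    have "D2f (?g t) (x' t *\<^sub>R (1, 0, 0) + (0, 1, 0)) (1, 0, 0) =
        x' t *\<^sub>R D2f (?g t) (1, 0, 0) (1, 0, 0) + D2f (?g t) (0, 1, 0) (1, 0, 0)"
      by (simp only: blinfun.scaleR_right blinfun.scaleR_left blinfun.add_right blinfun.add_left)
    then have "\<bar>a' t\<bar> = \<bar>x' t * D2f (?g t) (1, 0, 0) (1, 0, 0) + D2f (?g t) (0, 1, 0) (1, 0, 0)\<bar>"
      by (simp add: a'_def)
    also have "\<dots> \<le> \<bar>x' t\<bar> * \<bar>D2f (?g t) (1, 0, 0) (1, 0, 0)\<bar> + \<bar>D2f (?g t) (0, 1, 0) (1, 0, 0)\<bar>"
      by (rule order_trans[OF abs_triangle_ineq]) (simp add: abs_mult)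
    also have "\<dots> \<le> B / a0 * B + B"
      using x B2 basis by (intro add_mono mult_mono) (auto intro: order_trans[OF abs_ge_zero])
    finally show ?thesis .
  qed
  then show "\<exists>a'. \<forall>t\<ge>0. (a has_real_derivative a' t) (at t within {0..}) \<and>
      (\<forall>B. (\<forall>b\<in>Basis. \<bar>Df (xs t, t, 0) b\<bar> \<le> B) \<longrightarrow>
        (\<forall>b\<in>Basis. \<forall>c\<in>Basis. \<bar>D2f (xs t, t, 0) b c\<bar> \<le> B) \<longrightarrow> \<bar>a' t\<bar> \<le> B / a0 * B + B)"
    using a' by (intro exI[of _ a']) auto
qed

section \<open>The slow manifold of the variance equation\<close>

text \<open>This is used to move the initial value: the variance starts at 0, the manifold has to
  start at the leading term.\<close>

lemma solves_variance_ode_add_homogeneous: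
  assumes a: "continuous_on {0..} a" and eps: "\<epsilon> > 0" and z: "solves_variance_ode H a F \<epsilon> 0 z"
  shows "solves_variance_ode H a F \<epsilon> 0 (\<lambda>t. z t + c * exp (2 * (LINT r:{0..t}|lborel. a r) / \<epsilon>))"
  unfolding solves_variance_ode_def
proof (intro allI impI)
  fix t :: real assume t: "t \<ge> 0"
  let ?A = "\<lambda>t. LINT r:{0..t}|lborel. a r"
  obtain z' where z': "(z has_real_derivative z') (at t within {0..})"
    "\<epsilon> * z' = 2 * a t * z t + 2 * F t * (H * (2 * H - 1)) *
      (LINT u:{0..t}|lborel. 1 / \<epsilon> powr (2 * H - 1) * exp (alpha a t u / \<epsilon>) * F u * (t - u) powr (2 * H - 2))"
    using z t unfolding solves_variance_ode_def by blast
  have "((\<lambda>t. z t + c * exp (2 * ?A t / \<epsilon>)) has_real_derivative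
      z' + c * (exp (2 * ?A t / \<epsilon>) * (2 * a t / \<epsilon>))) (at t within {0..})"
    by (intro DERIV_add z' DERIV_cmult DERIV_chain2[OF DERIV_exp] DERIV_cdivide
        set_integral_has_real_derivative[OF a t])
  moreover have "\<epsilon> * (z' + c * (exp (2 * ?A t / \<epsilon>) * (2 * a t / \<epsilon>))) =
      \<epsilon> * z' + 2 * a t * (c * exp (2 * ?A t / \<epsilon>))"
    using eps by (simp add: distrib_left)
  ultimately show "\<exists>z'. ((\<lambda>t. z t + c * exp (2 * ?A t / \<epsilon>)) has_real_derivative z') (at t within {0..}) \<and>
    \<epsilon> * z' = 2 * a t * (z t + c * exp (2 * ?A t / \<epsilon>)) + 2 * F t * (H * (2 * H - 1)) *
      (LINT u:{0..t}|lborel. 1 / \<epsilon> powr (2 * H - 1) * exp (alpha a t u / \<epsilon>) * F u * (t - u) powr (2 * H - 2))"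
    unfolding z'(2) by (intro exI conjI) (assumption, simp add: distrib_left)
qed

text \<open>The leading term is the equilibrium of the equation with \<open>a\<close> and
  \<open>F\<close> frozen and the forcing replaced by its Gamma limit;
  \<open>Gamma (2 * H) = (2 * H - 1) * Gamma (2 * H - 1)\<close> reconciles the two
  constants.\<close>

lemma leading_term_balance:
  fixes a F H :: real
  assumes H: "1 / 2 < H" and a: "a < 0"
  shows "2 * a * (F\<^sup>2 / \<bar>a\<bar> powr (2 * H) * H * Gamma (2 * H)) +
    2 * F * (H * (2 * H - 1)) * (F * Gamma (2 * H - 1) / \<bar>a\<bar> powr (2 * H - 1)) = 0"
proof -
  have "2 * H - 1 \<notin> \<int>\<^sub>\<le>\<^sub>0" using H by (auto elim!: nonpos_Ints_cases)
  then have "Gamma (2 * H) = (2 * H - 1) * Gamma (2 * H - 1)"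
    using Gamma_plus1[of "2 * H - 1"] by simp
  moreover have "\<bar>a\<bar> powr (2 * H) = - a * \<bar>a\<bar> powr (2 * H - 1)"
    using a by (simp add: powr_diff)
  ultimately show ?thesis using a by (simp add: power2_eq_square)
qed

lemma leading_term_has_derivative:
  fixes a a' F F' :: "real \<Rightarrow> real"
  assumes F: "(F has_real_derivative F' t) (at t within S)"
    and a: "(a has_real_derivative a' t) (at t within S)" and t: "t \<in> S"
    and neg: "\<And>s. s \<in> S \<Longrightarrow> a s < 0"
  shows "((\<lambda>t. (F t)\<^sup>2 / \<bar>a t\<bar> powr (2 * H) * H * Gamma (2 * H)) has_real_derivative
    H * Gamma (2 * H) * (2 * F t * F' t * (- a t) powr (- 2 * H)
      + (F t)\<^sup>2 * (2 * H * a' t * (- a t) powr (- 2 * H - 1)))) (at t within S)"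
proof (rule has_real_derivative_cong_on[OF _ t])
  have "((\<lambda>t. (- a t) powr (- 2 * H)) has_real_derivative
      (- 2 * H) * (- a t) powr (- 2 * H - 1) * (- a' t)) (at t within S)"
    by (rule DERIV_chain2[OF has_real_derivative_powr DERIV_minus[OF a]]) (use neg t in simp)
  from DERIV_cmult[OF DERIV_mult[OF DERIV_power[OF F, of 2] this], of "H * Gamma (2 * H)"]
  show "((\<lambda>t. H * Gamma (2 * H) * ((F t)\<^sup>2 * (- a t) powr (- 2 * H))) has_real_derivative
    H * Gamma (2 * H) * (2 * F t * F' t * (- a t) powr (- 2 * H)
      + (F t)\<^sup>2 * (2 * H * a' t * (- a t) powr (- 2 * H - 1)))) (at t within S)"
    by (rule DERIV_cong) (simp add: algebra_simps)
  fix s assume "s \<in> S"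
  then show "H * Gamma (2 * H) * ((F s)\<^sup>2 * (- a s) powr (- 2 * H)) =
      (F s)\<^sup>2 / \<bar>a s\<bar> powr (2 * H) * H * Gamma (2 * H)"
    using neg[of s] by (simp add: powr_minus divide_inverse)
qed

text \<open>The distance to the leading term obeys the same linear equation with remainder
  \<open>r\<close>. This remainder is only bounded near time 0 but of order
  \<open>\<epsilon>\<close> later, hence the two applications of
  \<open>linear_ode_bound\<close>.\<close>

lemma order_eps_slow_manifold:
  fixes a a' F F' :: "real \<Rightarrow> real" and \<zeta> :: "real \<Rightarrow> real \<Rightarrow> real"
  assumes H: "1 / 2 < H" and I: "I \<subseteq> {0..}" "\<And>t. t \<in> I \<Longrightarrow> {0..t} \<subseteq> I"
    and F: "\<And>t. t \<ge> 0 \<Longrightarrow> (F has_real_derivative F' t) (at t within {0..})"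
    and FB: "\<And>t. t \<in> I \<Longrightarrow> \<bar>F t\<bar> \<le> B \<and> \<bar>F' t\<bar> \<le> B"
    and a: "\<And>t. t \<ge> 0 \<Longrightarrow> (a has_real_derivative a' t) (at t within {0..})"
    and a'L: "\<And>t. t \<in> I \<Longrightarrow> \<bar>a' t\<bar> \<le> L"
    and BL: "B \<ge> 0" "L \<ge> 0"
    and a0: "a0 > 0" "\<And>t. t \<ge> 0 \<Longrightarrow> a t \<le> - a0"
    and \<zeta>: "\<And>\<epsilon>. \<epsilon> > 0 \<Longrightarrow> solves_variance_ode H a F \<epsilon> 0 (\<zeta> \<epsilon>)"
    and \<zeta>0: "\<And>\<epsilon>. \<epsilon> > 0 \<Longrightarrow> \<zeta> \<epsilon> 0 = (F 0)\<^sup>2 / \<bar>a 0\<bar> powr (2 * H) * H * Gamma (2 * H)"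
  shows "order_eps_on I (\<lambda>\<epsilon> t. \<zeta> \<epsilon> t - (F t)\<^sup>2 / \<bar>a t\<bar> powr (2 * H) * H * Gamma (2 * H))"
proof -
  define w0 where "w0 t = (F t)\<^sup>2 / \<bar>a t\<bar> powr (2 * H) * H * Gamma (2 * H)" for t
  define w0' where "w0' t = H * Gamma (2 * H) * (2 * F t * F' t * (- a t) powr (- 2 * H)
      + (F t)\<^sup>2 * (2 * H * a' t * (- a t) powr (- 2 * H - 1)))" for t
  define wB where "wB = H * Gamma (2 * H) * (2 * B * B * a0 powr (- 2 * H)
      + B\<^sup>2 * (2 * H * L * a0 powr (- 2 * H - 1)))"
  define c where "c = H * (2 * H - 1)"
  have c: "c > 0" using H by (simp add: c_def)
  have G: "Gamma (2 * H) > 0" using H by (intro Gamma_real_pos) simp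
  have wB0: "wB \<ge> 0" using H G BL by (simp add: wB_def)
  have w0: "(w0 has_real_derivative w0' t) (at t within {0..})" if "t \<ge> 0" for t
    unfolding w0_def[abs_def] w0'_def
    by (rule leading_term_has_derivative[where F=F and F'=F' and a=a and a'=a', OF F[OF that] a[OF that]])
      (use that a0 in force)+
  have w0'B: "\<bar>w0' t\<bar> \<le> wB" if "t \<in> I" for t
  proof -
    have t: "t \<ge> 0" using I that by auto
    have p: "(- a t) powr (- 2 * H) \<le> a0 powr (- 2 * H)" "(- a t) powr (- 2 * H - 1) \<le> a0 powr (- 2 * H - 1)"
      using a0(1) a0(2)[OF t] H by (auto intro!: powr_mono2')
    have "\<bar>w0' t\<bar> \<le> H * Gamma (2 * H) * (2 * \<bar>F t\<bar> * \<bar>F' t\<bar> * (- a t) powr (- 2 * H)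
        + \<bar>F t\<bar>\<^sup>2 * (2 * H * \<bar>a' t\<bar> * (- a t) powr (- 2 * H - 1)))"
      unfolding w0'_def abs_mult[of "H * Gamma (2 * H)"] using H G
      by (subst abs_of_pos[of "H * Gamma (2 * H)"], simp)
        (intro mult_left_mono order_trans[OF abs_triangle_ineq], auto simp: abs_mult)
    also have "\<dots> \<le> wB"
      unfolding wB_def using FB[OF that] a'L[OF that] p H G BL
      by (intro mult_left_mono add_mono mult_mono power_mono) auto
    finally show ?thesis .
  qed
  have a_cont: "continuous_on {0..} a" and F_cont: "continuous_on {0..} F"
    unfolding continuous_on_eq_continuous_within using a F DERIV_continuous by fastforce+
  let ?A = "\<lambda>t. LINT r:{0..t}|lborel. a r"
  have A: "(?A has_real_derivative a t) (at t within {0..})" if "t \<ge> 0" for t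
    by (rule set_integral_has_real_derivative[OF a_cont that])
  have lip: "\<bar>f u - f t\<bar> \<le> K * (t - u)"
    if f: "\<And>s. s \<ge> 0 \<Longrightarrow> (f has_real_derivative f' s) (at s within {0..})" and K: "\<And>s. s \<in> I \<Longrightarrow> \<bar>f' s\<bar> \<le> K"
      and t: "t \<in> I" and u: "u \<in> {0..t}" for f f' :: "real \<Rightarrow> real" and K t u
  proof -
    have "\<exists>s\<in>{u..t}. f t - f u = f' s * (t - u)"
      by (rule real_mvt_within[where S="{0..}"]) (use f u in auto)
    then obtain s where s: "s \<in> {u..t}" "f t - f u = f' s * (t - u)" by blast
    have "s \<in> I" using s u I(2)[OF t] by auto
    have "\<bar>f u - f t\<bar> = \<bar>f' s\<bar> * (t - u)"
      using s u by (subst abs_minus_commute) (simp add: abs_mult)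
    also have "\<dots> \<le> K * (t - u)" using K[OF \<open>s \<in> I\<close>] u by (intro mult_right_mono) auto
    finally show ?thesis .
  qed
  define J where "J \<epsilon> t = (LINT u:{0..t}|lborel. 1 / \<epsilon> powr (2 * H - 1) * exp (alpha a t u / \<epsilon>) * F u
      * (t - u) powr (2 * H - 2))" for \<epsilon> t
  define P0 where "P0 t = F t * Gamma (2 * H - 1) / \<bar>a t\<bar> powr (2 * H - 1)" for t
  \<comment> \<open>The first part is the error of the Gamma asymptotics; the second arises because
    the leading term itself moves in time.\<close>
  define r where "r \<epsilon> t = 2 * F t * c * (J \<epsilon> t - P0 t) - \<epsilon> * w0' t" for \<epsilon> t
  define m0 m1 m2 where "m0 = exp_moment a0 (2 * H - 2)" and "m1 = exp_moment a0 (2 * H - 2 + 1)"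
    and "m2 = exp_moment a0 (2 * H - 2 + 2)"
  have m: "m0 \<ge> 0" "m1 \<ge> 0" "m2 \<ge> 0" by (simp_all add: m0_def m1_def m2_def exp_moment_nonneg)
  have J: "\<bar>J \<epsilon> t - P0 t\<bar> \<le> 2 * B * m0"
    "t > 0 \<Longrightarrow> \<bar>J \<epsilon> t - P0 t\<bar> \<le> \<epsilon> * (B * m1 + B * L * m2) + B * (\<epsilon>\<^sup>2 / t\<^sup>2) * m2"
    if eps: "\<epsilon> > 0" and t: "t \<in> I" for \<epsilon> t
  proof -
    have t0: "t \<ge> 0" and tI: "{0..t} \<subseteq> I" using I t by auto
    have "J \<epsilon> t = (LINT u:{0..t}|lborel. 1 / \<epsilon> powr (2 * H - 1) * exp ((?A t - ?A u) / \<epsilon>) * F u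
        * (t - u) powr (2 * H - 2))"
      unfolding J_def by (rule set_lebesgue_integral_cong) (auto simp: alpha_eq_diff[OF a_cont])
    note J' = this
    have "continuous_on {0..t} F" using F_cont by (rule continuous_on_subset) auto
    note FA = forcing_asymptotics[where A="?A" and S="{0..}" and a=a and F=F, OF H eps t0 a0(1) _ A a0(2) BL(2)
        lip[OF a a'L t] this _ lip[OF F _ t]]
    show "\<bar>J \<epsilon> t - P0 t\<bar> \<le> 2 * B * m0"
      unfolding J' P0_def m0_def by (rule FA) (use FB tI in auto)
    assume "t > 0"
    then show "\<bar>J \<epsilon> t - P0 t\<bar> \<le> \<epsilon> * (B * m1 + B * L * m2) + B * (\<epsilon>\<^sup>2 / t\<^sup>2) * m2"
      unfolding J' P0_def m1_def m2_def by (rule FA(2)[rotated -1]) (use FB tI in auto)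
  qed
  have r_le: "\<bar>r \<epsilon> t\<bar> \<le> 2 * B * c * q + \<epsilon> * wB"
    if eps: "\<epsilon> > 0" and t: "t \<in> I" and q: "\<bar>J \<epsilon> t - P0 t\<bar> \<le> q" for \<epsilon> t q
  proof -
    have "\<bar>r \<epsilon> t\<bar> \<le> 2 * \<bar>F t\<bar> * c * \<bar>J \<epsilon> t - P0 t\<bar> + \<epsilon> * \<bar>w0' t\<bar>"
      unfolding r_def using c eps by (intro order_trans[OF abs_triangle_ineq4]) (simp add: abs_mult)
    also have "\<dots> \<le> 2 * B * c * q + \<epsilon> * wB"
      using FB[OF t] w0'B[OF t] q c eps BL by (intro add_mono mult_mono) auto
    finally show ?thesis .
  qed
  have bound: "\<bar>\<zeta> \<epsilon> t - w0 t\<bar> \<le> \<bar>\<zeta> \<epsilon> s - w0 s\<bar> * exp (- 2 * a0 * (t - s) / \<epsilon>) + R / (2 * a0)"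
    if eps: "\<epsilon> > 0" and st: "0 \<le> s" "s \<le> t" and R: "R \<ge> 0" "\<And>x. x \<in> {s..t} \<Longrightarrow> \<bar>r \<epsilon> x\<bar> \<le> R" for \<epsilon> s t R
  proof -
    have "\<forall>t\<ge>0. \<exists>z'. (\<zeta> \<epsilon> has_real_derivative z') (at t within {0..}) \<and>
        \<epsilon> * z' = 2 * a t * \<zeta> \<epsilon> t + 2 * F t * c * J \<epsilon> t"
      using \<zeta>[OF eps] unfolding solves_variance_ode_def c_def J_def .
    then obtain z' where z': "\<And>t. t \<ge> 0 \<Longrightarrow> (\<zeta> \<epsilon> has_real_derivative z' t) (at t within {0..})"
      "\<And>t. t \<ge> 0 \<Longrightarrow> \<epsilon> * z' t = 2 * a t * \<zeta> \<epsilon> t + 2 * F t * c * J \<epsilon> t"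
      by metis
    show ?thesis
    proof (rule linear_ode_bound[OF eps a0(1) R(1) st(2), where S="{0..}" and A="?A" and a=a
          and d'="\<lambda>t. z' t - w0' t" and r="r \<epsilon>"])
      fix x assume x: "x \<in> {s..t}"
      then have x0: "x \<ge> 0" using st by auto
      show "(?A has_real_derivative a x) (at x within {0..})" by (rule A[OF x0])
      show "a x \<le> - a0" by (rule a0(2)[OF x0])
      show "((\<lambda>t. \<zeta> \<epsilon> t - w0 t) has_real_derivative z' x - w0' x) (at x within {0..})"
        by (intro DERIV_diff z' w0 x0)
      have "2 * a x * w0 x + 2 * F x * c * P0 x = 0"
        unfolding w0_def c_def P0_def by (rule leading_term_balance[OF H]) (use a0(1) a0(2)[OF x0] in simp)
      then show "\<epsilon> * (z' x - w0' x) = 2 * a x * (\<zeta> \<epsilon> x - w0 x) + r \<epsilon> x"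
        unfolding right_diff_distrib z'(2)[OF x0] r_def by linarith
      show "\<bar>r \<epsilon> x\<bar> \<le> R" by (rule R(2)[OF x])
    qed (use st in auto)
  qed
  \<comment> \<open>\<open>D0\<close> is the distance that the crude forcing bound guarantees for
    \<open>\<epsilon> < 1\<close>; \<open>R2\<close> is the coefficient of \<open>\<epsilon>\<close>
    in the remainder away from time 0. Neither depends on \<open>\<delta>\<close>.\<close>
  define D0 where "D0 = (2 * B * c * (2 * B * m0) + wB) / (2 * a0)"
  define R2 where "R2 = 2 * B * c * (B * m1 + B * L * m2 + B * m2) + wB"
  have D0: "D0 \<ge> 0" and R2: "R2 \<ge> 0"
    using BL c m wB0 a0 by (auto simp: D0_def R2_def)
  have crude: "\<bar>\<zeta> \<epsilon> t - w0 t\<bar> \<le> D0" if eps: "0 < \<epsilon>" "\<epsilon> < 1" and t: "t \<in> I" for \<epsilon> t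
  proof -
    have "\<bar>\<zeta> \<epsilon> t - w0 t\<bar> \<le> \<bar>\<zeta> \<epsilon> 0 - w0 0\<bar> * exp (- 2 * a0 * (t - 0) / \<epsilon>) +
        (2 * B * c * (2 * B * m0) + wB) / (2 * a0)"
    proof (rule bound[OF eps(1)])
      fix x assume "x \<in> {0..t}"
      then have x: "x \<in> I" using I(2)[OF t] by auto
      have "\<bar>r \<epsilon> x\<bar> \<le> 2 * B * c * (2 * B * m0) + \<epsilon> * wB" by (rule r_le[OF eps(1) x J(1)[OF eps(1) x]])
      also have "\<epsilon> * wB \<le> wB" using eps wB0 by (intro mult_left_le_one_le) auto
      finally show "\<bar>r \<epsilon> x\<bar> \<le> 2 * B * c * (2 * B * m0) + wB" by simp
    qed (use I t BL c m wB0 in auto)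
    then show ?thesis using \<zeta>0[OF eps(1)] by (simp add: D0_def w0_def)
  qed
  show ?thesis
    unfolding order_eps_on_def w0_def[symmetric]
  \<comment> \<open>The summand 1 ensures that the constant is strictly positive.\<close>
  proof (rule exI[of _ "D0 + R2 / (2 * a0) + 1"], intro conjI allI impI)
    show "D0 + R2 / (2 * a0) + 1 > 0" using D0 R2 a0 by (simp add: add_nonneg_pos)
    fix \<delta> :: real assume \<delta>: "\<delta> > 0"
    \<comment> \<open>The bound \<open>\<delta>\<^sup>2 / 4\<close> gives
      \<open>\<epsilon>\<^sup>2 / x\<^sup>2 \<le> \<epsilon>\<close> for
      \<open>x \<ge> \<delta> / 2\<close>, and \<open>(a0 * \<delta>)\<^sup>2 / 2\<close> makes the
      exponential damping factor at most \<open>\<epsilon>\<close>.\<close>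
    define \<epsilon>0 where "\<epsilon>0 = min 1 (min (\<delta>\<^sup>2 / 4) ((a0 * \<delta>)\<^sup>2 / 2))"
    have "\<bar>\<zeta> \<epsilon> t - w0 t\<bar> \<le> (D0 + R2 / (2 * a0) + 1) * \<epsilon>"
      if eps: "0 < \<epsilon>" "\<epsilon> < \<epsilon>0" and t: "t \<in> I" "t = 0 \<or> \<delta> \<le> t" for \<epsilon> t
    proof (cases "t = 0")
      case True
      then show ?thesis using \<zeta>0[OF eps(1)] D0 R2 a0 eps by (simp add: w0_def)
    next
      case False
      then have t\<delta>: "\<delta> \<le> t" using t by simp
      have e: "\<epsilon> < 1" "\<epsilon> \<le> \<delta>\<^sup>2 / 4" "\<epsilon> \<le> (a0 * \<delta>)\<^sup>2 / 2" using eps(2) by (simp_all add: \<epsilon>0_def)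
      \<comment> \<open>From \<open>t / 2\<close> on, times stay above \<open>\<delta> / 2\<close>,
        where the remainder is of order \<open>\<epsilon>\<close>, and the remaining time
        \<open>t / 2\<close> is long enough to damp the distance \<open>D0\<close>.\<close>
      have "t / 2 \<in> {0..t}" using t\<delta> \<delta> by simp
      then have t2: "t / 2 \<in> I" using I(2)[OF t(1)] by blast
      have "\<bar>\<zeta> \<epsilon> t - w0 t\<bar> \<le> \<bar>\<zeta> \<epsilon> (t / 2) - w0 (t / 2)\<bar> * exp (- 2 * a0 * (t - t / 2) / \<epsilon>) + \<epsilon> * R2 / (2 * a0)"
      proof (rule bound[OF eps(1)])
        fix x assume x: "x \<in> {t / 2..t}"
        then have "x \<in> {0..t}" using t\<delta> \<delta> by auto
        then have xI: "x \<in> I" using I(2)[OF t(1)] by blast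
        have x0: "x \<ge> \<delta> / 2" "x > 0" using x t\<delta> \<delta> by auto
        have "\<epsilon>\<^sup>2 / x\<^sup>2 \<le> \<epsilon>\<^sup>2 / (\<delta> / 2)\<^sup>2"
          using x0 \<delta> by (intro divide_left_mono power_mono) auto
        also have "\<dots> = \<epsilon> * (\<epsilon> / (\<delta>\<^sup>2 / 4))" by (simp add: power2_eq_square)
        also have "\<dots> \<le> \<epsilon> * 1"
          using e(2) eps(1) \<delta> by (intro mult_left_mono) auto
        finally have "B * (\<epsilon>\<^sup>2 / x\<^sup>2) * m2 \<le> B * \<epsilon> * m2"
          using BL m by (intro mult_right_mono mult_left_mono) auto
        then have "\<bar>J \<epsilon> x - P0 x\<bar> \<le> \<epsilon> * (B * m1 + B * L * m2 + B * m2)"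
          using J(2)[OF eps(1) xI x0(2)] by (simp add: algebra_simps)
        from r_le[OF eps(1) xI this]
        show "\<bar>r \<epsilon> x\<bar> \<le> \<epsilon> * R2" by (simp add: R2_def algebra_simps)
      qed (use t\<delta> \<delta> eps R2 in auto)
      also have "\<bar>\<zeta> \<epsilon> (t / 2) - w0 (t / 2)\<bar> * exp (- 2 * a0 * (t - t / 2) / \<epsilon>) \<le> D0 * \<epsilon>"
      proof (rule mult_mono)
        show "\<bar>\<zeta> \<epsilon> (t / 2) - w0 (t / 2)\<bar> \<le> D0" by (rule crude[OF eps(1) e(1) t2])
        \<comment> \<open>The quadratic Taylor bound for \<open>exp y\<close> already turns
          exponential decay into \<open>2 / y\<^sup>2\<close>, which is of order
          \<open>\<epsilon>\<^sup>2\<close>; one factor \<open>\<epsilon>\<close> absorbs the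
          dependence on \<open>\<delta>\<close>.\<close>
        define y where "y = a0 * \<delta> / \<epsilon>"
        have y: "y > 0" using a0 \<delta> eps by (simp add: y_def)
        have "y \<le> a0 * t / \<epsilon>"
          unfolding y_def using t\<delta> a0 eps by (intro divide_right_mono mult_left_mono) auto
        then have "exp (- 2 * a0 * (t - t / 2) / \<epsilon>) \<le> exp (- y)"
          by (simp add: algebra_simps)
        also have "\<dots> = 1 / exp y" by (simp add: exp_minus divide_inverse)
        also have "\<dots> \<le> 1 / (y\<^sup>2 / 2)"
        proof (rule divide_left_mono)
          show "y\<^sup>2 / 2 \<le> exp y" using exp_lower_Taylor_quadratic[of y] y by simp
        qed (use y in auto)
        also have "\<dots> = \<epsilon> * (\<epsilon> / ((a0 * \<delta>)\<^sup>2 / 2))"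
          by (simp add: y_def power_divide power2_eq_square)
        also have "\<dots> \<le> \<epsilon> * 1"
          using e(3) eps(1) \<delta> a0 by (intro mult_left_mono) auto
        finally show "exp (- 2 * a0 * (t - t / 2) / \<epsilon>) \<le> \<epsilon>" by simp
      qed (use D0 in auto)
      finally have "\<bar>\<zeta> \<epsilon> t - w0 t\<bar> \<le> (D0 + R2 / (2 * a0)) * \<epsilon>"
        by (simp add: algebra_simps)
      then show ?thesis using eps by (simp add: algebra_simps)
    qed
    moreover have "\<epsilon>0 > 0" using \<delta> a0 by (simp add: \<epsilon>0_def)
    ultimately show "\<exists>\<epsilon>0>0. \<forall>\<epsilon>. 0 < \<epsilon> \<and> \<epsilon> < \<epsilon>0 \<longrightarrow>
        (\<forall>t\<in>I. t = 0 \<or> \<delta> \<le> t \<longrightarrow> \<bar>\<zeta> \<epsilon> t - w0 t\<bar> \<le> (D0 + R2 / (2 * a0) + 1) * \<epsilon>)"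
      by blast
  qed
qed

text \<open>The mean vanishes, so the variance is the second moment given by the isometry; the
  squared prefactor \<open>\<sigma> / \<epsilon> powr H\<close> supplies the normalisation of
  \<open>renorm_variance\<close>.\<close>

lemma variance_fractional_OU:
  assumes H: "1 / 2 < H" "H < 1" and a: "continuous_on {0..} a" and F: "continuous_on {0..} F"
    and W: "fractional_brownian_motion \<Omega> H W" and \<xi>: "fractional_OU \<Omega> H W a F \<sigma> \<epsilon> \<xi>"
    and eps: "\<epsilon> > 0" and t: "t \<ge> 0"
  shows "prob_space.variance \<Omega> (\<xi> t) = \<sigma>\<^sup>2 * renorm_variance H a F \<epsilon> t"
proof -
  interpret prob_space \<Omega> using W by (simp add: fractional_brownian_motion_def)
  note g = renorm_variance_eq_energy_exp(2)[OF H(1) a F t, of \<epsilon>]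
  let ?g = "\<lambda>u. exp (alpha a t u / \<epsilon>) * F u"
  obtain X where X: "has_wiener_integral \<Omega> H W ?g t X" and \<xi>X: "\<forall>\<omega>\<in>space \<Omega>. \<xi> t \<omega> = \<sigma> / \<epsilon> powr H * X \<omega>"
    using \<xi> t unfolding fractional_OU_def by blast
  note m = wiener_integral_moments[OF W H t X g]
  have "expectation (\<xi> t) = (LINT \<omega>|\<Omega>. \<sigma> / \<epsilon> powr H * X \<omega>)"
    using \<xi>X by (intro Bochner_Integration.integral_cong) auto
  also have "\<dots> = 0" using m(2) by simp
  finally have "expectation (\<xi> t) = 0" .
  then have "variance (\<xi> t) = (LINT \<omega>|\<Omega>. (\<sigma> / \<epsilon> powr H)\<^sup>2 * (X \<omega>)\<^sup>2)"
    using \<xi>X by (intro Bochner_Integration.integral_cong) (auto simp: power_mult_distrib power_divide)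
  also have "\<dots> = (\<sigma> / \<epsilon> powr H)\<^sup>2 * (LINT \<omega>|\<Omega>. (X \<omega>)\<^sup>2)" by simp
  also have "(\<sigma> / \<epsilon> powr H)\<^sup>2 = \<sigma>\<^sup>2 / \<epsilon> powr (2 * H)"
    by (simp add: power_divide power2_eq_square powr_add[symmetric])
  finally show ?thesis
    unfolding m(3) renorm_variance_eq_energy[OF H(1) t g] by simp
qed

theorem proposition3p2:
  fixes H \<sigma> B a0 :: real
    and f :: "real \<times> real \<times> real \<Rightarrow> real"
    and Df :: "real \<times> real \<times> real \<Rightarrow> (real \<times> real \<times> real) \<Rightarrow>\<^sub>L real"
    and D2f :: "real \<times> real \<times> real \<Rightarrow> (real \<times> real \<times> real) \<Rightarrow>\<^sub>L ((real \<times> real \<times> real) \<Rightarrow>\<^sub>L real)"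
    and F F' xs a :: "real \<Rightarrow> real"
    and I :: "real set"
    and \<Omega> :: "'a measure"
    and W :: "real \<Rightarrow> 'a \<Rightarrow> real"
    and \<xi> :: "real \<Rightarrow> real \<Rightarrow> 'a \<Rightarrow> real"
  assumes H: "1 / 2 < H" "H < 1"
    and \<sigma>: "\<sigma> > 0"
    and I: "I = {0..} \<or> (\<exists>T>0. I = {0..T})"
    and f_C2: "has_C1_derivative_on f Df (UNIV \<times> {0..} \<times> {0..})"
      "has_C1_derivative_on Df D2f (UNIV \<times> {0..} \<times> {0..})"
    and F_C1: "\<forall>t\<ge>0. (F has_real_derivative F' t) (at t within {0..})"
      "continuous_on {0..} F'"
    and F_pos: "\<forall>t\<ge>0. F t > 0"
    and B: "B > 0"
    and f_bounded: "\<forall>x. \<forall>t\<in>I. \<forall>e\<ge>0. \<bar>f (x, t, e)\<bar> \<le> B \<and>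
      (\<forall>b\<in>Basis. \<bar>Df (x, t, e) b\<bar> \<le> B) \<and>
      (\<forall>b\<in>Basis. \<forall>c\<in>Basis. \<bar>D2f (x, t, e) b c\<bar> \<le> B)"
    and F_bounded: "\<forall>t\<in>I. \<bar>F t\<bar> \<le> B \<and> \<bar>F' t\<bar> \<le> B"
    and xs_cont: "continuous_on {0..} xs"
    and xs_zero: "\<forall>t\<ge>0. f (xs t, t, 0) = 0"
    and a_def: "\<forall>t\<ge>0. a t = deriv (\<lambda>x. f (x, t, 0)) (xs t)"
    and a_neg: "a0 > 0" "\<forall>t\<ge>0. a t \<le> - a0"
    and W: "fractional_brownian_motion \<Omega> H W"
    and \<xi>: "\<forall>\<epsilon>>0. fractional_OU \<Omega> H W a F \<sigma> \<epsilon> (\<xi> \<epsilon>)"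
  shows "(\<forall>\<epsilon>>0. \<forall>t\<ge>0. prob_space.variance \<Omega> (\<xi> \<epsilon> t) = \<sigma>\<^sup>2 * renorm_variance H a F \<epsilon> t) \<and>
    (\<forall>\<epsilon>>0. solves_variance_ode H a F \<epsilon> 0 (renorm_variance H a F \<epsilon>)) \<and>
    (\<exists>\<zeta>. (\<forall>\<epsilon>>0. solves_variance_ode H a F \<epsilon> 0 (\<zeta> \<epsilon>) \<and>
           globally_asymptotically_stable (solves_variance_ode H a F \<epsilon>) (\<zeta> \<epsilon>)) \<and>
         order_eps_on I (\<lambda>\<epsilon> t. \<zeta> \<epsilon> t - (F t)\<^sup>2 / \<bar>a t\<bar> powr (2 * H) * H * Gamma (2 * H)))"
proof (intro conjI allI impI)
  have F_cont: "continuous_on {0..} F"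
    unfolding continuous_on_eq_continuous_within using F_C1(1) DERIV_continuous by fastforce
  note lin = slow_manifold_linearisation[OF f_C2 xs_cont xs_zero a_def a_neg]
  note a_cont = lin(1)
  show "prob_space.variance \<Omega> (\<xi> \<epsilon> t) = \<sigma>\<^sup>2 * renorm_variance H a F \<epsilon> t" if "\<epsilon> > 0" "t \<ge> 0" for \<epsilon> t
    using variance_fractional_OU[OF H a_cont F_cont W] \<xi> that by blast
  show ode: "solves_variance_ode H a F \<epsilon> 0 (renorm_variance H a F \<epsilon>)" if "\<epsilon> > 0" for \<epsilon>
    by (rule renorm_variance_solves_ode[OF H(1) a_cont F_cont that])
  obtain a' where a': "\<And>t. t \<ge> 0 \<Longrightarrow> (a has_real_derivative a' t) (at t within {0..})"
    and a'B: "\<And>t B. t \<ge> 0 \<Longrightarrow> \<forall>b\<in>Basis. \<bar>Df (xs t, t, 0) b\<bar> \<le> B \<Longrightarrow>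
      \<forall>b\<in>Basis. \<forall>c\<in>Basis. \<bar>D2f (xs t, t, 0) b c\<bar> \<le> B \<Longrightarrow> \<bar>a' t\<bar> \<le> B / a0 * B + B"
    using lin(2) by blast
  have I': "I \<subseteq> {0..}" "\<And>t. t \<in> I \<Longrightarrow> {0..t} \<subseteq> I"
    using I by auto
  \<comment> \<open>The renormalised variance is 0 at \<open>t = 0\<close> and the exponential is 1
    there, so this coefficient makes \<open>\<zeta>\<close> start exactly at the leading
    term.\<close>
  define \<zeta> where "\<zeta> \<epsilon> t = renorm_variance H a F \<epsilon> t +
    (F 0)\<^sup>2 / \<bar>a 0\<bar> powr (2 * H) * H * Gamma (2 * H) * exp (2 * (LINT r:{0..t}|lborel. a r) / \<epsilon>)" for \<epsilon> t
  have \<zeta>: "solves_variance_ode H a F \<epsilon> 0 (\<zeta> \<epsilon>)" if "\<epsilon> > 0" for \<epsilon>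
    unfolding \<zeta>_def[abs_def] by (rule solves_variance_ode_add_homogeneous[OF a_cont that ode[OF that]])
  have null: "(LINT u:{0..0}|lborel. h u) = 0" for h :: "real \<Rightarrow> real"
    unfolding set_lebesgue_integral_def
    by (rule integral_eq_zero_AE) (use AE_lborel_singleton[of "0::real"] in eventually_elim, simp)
  have \<zeta>0: "\<zeta> \<epsilon> 0 = (F 0)\<^sup>2 / \<bar>a 0\<bar> powr (2 * H) * H * Gamma (2 * H)" for \<epsilon>
    unfolding \<zeta>_def renorm_variance_def null by simp
  have "order_eps_on I (\<lambda>\<epsilon> t. \<zeta> \<epsilon> t - (F t)\<^sup>2 / \<bar>a t\<bar> powr (2 * H) * H * Gamma (2 * H))"
  \<comment> \<open>The Lipschitz constant of \<open>a\<close> combines \<open>B / a0\<close>, the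
    bound on the velocity of \<open>xs\<close>, with the bound \<open>B\<close> on second
    derivatives of \<open>f\<close>.\<close>
  proof (rule order_eps_slow_manifold[OF H(1) I' _ _ a', where F'=F' and B=B and L="B / a0 * B + B" and ?a0.0=a0])
    fix t assume "t \<in> I"
    then show "\<bar>a' t\<bar> \<le> B / a0 * B + B"
      using f_bounded I'(1) by (intro a'B) auto
  qed (use F_C1 F_bounded B a_neg \<zeta> \<zeta>0 in auto)
  then show "\<exists>\<zeta>. (\<forall>\<epsilon>>0. solves_variance_ode H a F \<epsilon> 0 (\<zeta> \<epsilon>) \<and>
           globally_asymptotically_stable (solves_variance_ode H a F \<epsilon>) (\<zeta> \<epsilon>)) \<and>
         order_eps_on I (\<lambda>\<epsilon> t. \<zeta> \<epsilon> t - (F t)\<^sup>2 / \<bar>a t\<bar> powr (2 * H) * H * Gamma (2 * H))"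
    using \<zeta> variance_ode_globally_asymptotically_stable[OF a_cont _ a_neg] by blast
qed

end
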